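(* Let $(\mathfrak g,\diamond)$ be a Novikov algebra over $\mathbb K$ and $(M;l,r)$ a representation of it. For $n\ge1$ let $$\mathfrak C^n_{\mathrm{Nov}}(\mathfrak g;M)=\bigoplus_{(k_{n-1},\dots,k_0)\in K_n}\mathrm{Hom}(\wedge^{k_{n-1}}\mathfrak g\otimes\cdots\otimes\wedge^{k_0}\mathfrak g,M)$$ and $\hat d^n_{\mathrm{Nov}}=\Gamma_{n+1}\circ\hat d^n_{\mathrm{CE}}\circ\Gamma_n^{-1}:\mathfrak C^n_{\mathrm{Nov}}(\mathfrak g;M)\to\mathfrak C^{n+1}_{\mathrm{Nov}}(\mathfrak g;M)$. Then $(\mathfrak C^\bullet_{\mathrm{Nov}}(\mathfrak g;M),\hat d_{\mathrm{Nov}})$ is a cochain complex, i.e. $\hat d^{n+1}_{\mathrm{Nov}}\circ\hat d^n_{\mathrm{Nov}}=0$ for all $n\ge1$.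
   Context: $\mathbb K$ is a field of characteristic $0$; all vector spaces are over $\mathbb K$. A (left) Novikov algebra is a vector space $\mathfrak g$ with a bilinear operation $\diamond$ satisfying $(x\diamond y)\diamond z-x\diamond(y\diamond z)=(y\diamond x)\diamond z-y\diamond(x\diamond z)$ and $(x\diamond y)\diamond z=(x\diamond z)\diamond y$; write $\omega(x\otimes y)=x\diamond y$. A representation $(M;l,r)$ of $(\mathfrak g,\diamond)$ is a vector space $M$ with $l,r\in\mathrm{Hom}(\mathfrak g\otimes M,M)$ such that for all $x,y\in\mathfrak g$, $m\in M$, writing $l_x m=l(x\otimes m)$, $r_xm=r(x\otimes m)$: $l_{x\diamond y}m-l_{y\diamond x}m=l_xl_ym-l_yl_xm$; $\ l_xr_ym-r_yl_xm=r_{x\diamond y}m-r_yr_xm$; $\ l_{x\diamond y}m=r_yl_xm$; $\ r_xr_ym=r_yr_xm$. Conventions: for an $n$-linear map $f$ and $\sigma\in S_n$, $f^\sigma(x_1,\dots,x_n)=f(x_{\sigma^{-1}(1)},\dots,x_{\sigma^{-1}(n)})$; $(-1)^\sigma$ is the sign. $\mathrm{Sh}^{-1}(i,j)$ ($i+j=m$) is the set of $\sigma\in S_m$ with $\sigma^{-1}(1)<\dots<\sigma^{-1}(i)$ and $\sigma^{-1}(i+1)<\dots<\sigma^{-1}(m)$. Operad $rNov$: let $ComDer$ be the operad generated by a unary $D$ and a symmetric binary $\mu$ with $\mu\circ(\mu,\mathrm{id})=\mu\circ(\mathrm{id},\mu)$, $D\circ\mu=\mu\circ(D,\mathrm{id})+\mu\circ(\mathrm{id},D)$;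 $\mu_n$ is the $n$-fold product. The operad $rNov$ of right Novikov algebras is identified with the suboperad of $ComDer$ for which $rNov(n)$ has basis $\mu_n\circ(D^{p_1},\dots,D^{p_n})$, $(p_1,\dots,p_n)\in P_n=\{p\in\mathbb N^n\mid\sum p_i=n-1\}$ ($\mathbb N=\{0,1,\dots\}$), with $\big(\mu_n\circ(D^{p_1},\dots,D^{p_n})\big)^\sigma=\mu_n\circ(D^{p_{\sigma(1)}},\dots,D^{p_{\sigma(n)}})$. Pseudo-tensor category $rNov\otimes\mathcal Vec$: objects are vector spaces, and the $n$-ary operations from $L_1,\dots,L_n$ to $M$ are $rNov(n)\otimes\mathrm{Hom}(L_1\otimes\cdots\otimes L_n,M)$, with componentwise composition and diagonal symmetric group action. In it put $\alpha(\nu)=\mu\circ(D,\mathrm{id})\otimes\omega-\mu\circ(\mathrm{id},D)\otimes\omega^{(1\,2)}\in rNov(2)\otimes\mathrm{Hom}(\mathfrak g\otimes\mathfrak g,\mathfrak g)$ (a Lie algebra structure on $\mathfrak g$) and $\rho=\mu\circ(D,\mathrm{id})\otimes l-\mu\circ(\mathrm{id},D)\otimes r\in rNov(2)\otimes\mathrm{Hom}(\mathfrak g\otimes M,M)$ (a representation of it). Let $\mathrm{CE}^n_{rNov\otimes\mathcal Vec}(\mathfrak g;M)=\{F\in rNov(n)\otimes\mathrm{Hom}(\mathfrak g^{\otimes n},M)\mid F^\sigma=(-1)^\sigma F\ \forall\sigma\in S_n\}$ and $$\hat d^n_{\mathrm{CE}}(F)=\sum_{\sigma\in\mathrm{Sh}^{-1}(1,n)}(-1)^\sigma\big(\rho\circ(\mathrm{id},F)\big)^\sigma-\sum_{\sigma\in\mathrm{Sh}^{-1}(2,n-1)}(-1)^\sigma\big(F\circ(\alpha(\nu),\mathrm{id},\dots,\mathrm{id})\big)^\sigma,$$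 where $\mathrm{id}=\mathrm{id}_{rNov}\otimes\mathrm{id}_{\mathfrak g}$. $K_n=\{(k_{n-1},\dots,k_0)\in\mathbb N^n\mid\sum_ik_i=n,\ \sum_iik_i=n-1\}$; weakly decreasing $p\in P_n$ correspond bijectively to elements of $K_n$ via $k_j=|\{i\mid p_i=j\}|$. $\Gamma_n:\mathrm{CE}^n_{rNov\otimes\mathcal Vec}(\mathfrak g;M)\to\mathfrak C^n_{\mathrm{Nov}}(\mathfrak g;M)$ is the linear isomorphism sending $\sum_{P_n}\mu_n\circ(D^{p_1},\dots,D^{p_n})\otimes f^{(p_1,\dots,p_n)}$ to the collection of those $f^{(p_1,\dots,p_n)}$ with $p_1\ge\dots\ge p_n$, each placed in the summand indexed by the corresponding element of $K_n$. *)

theory Defs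
  imports
    Complex_Main
    "HOL-Library.Function_Algebras"
    "HOL-Combinatorics.Permutations"
begin

section \<open>Novikov algebras and their representations\<close>

definition bilinear_map ::
  "('k::field \<Rightarrow> 'a::ab_group_add \<Rightarrow> 'a) \<Rightarrow> ('k \<Rightarrow> 'b::ab_group_add \<Rightarrow> 'b) \<Rightarrow> ('k \<Rightarrow> 'c::ab_group_add \<Rightarrow> 'c)
    \<Rightarrow> ('a \<Rightarrow> 'b \<Rightarrow> 'c) \<Rightarrow> bool" where
  "bilinear_map sA sB sC f \<longleftrightarrow>
     (\<forall>y. Vector_Spaces.linear sA sC (\<lambda>x. f x y)) \<and> (\<forall>x. Vector_Spaces.linear sB sC (f x))"

locale novikov_algebra = vector_space sG
  for sG :: "'k::field_char_0 \<Rightarrow> 'g::ab_group_add \<Rightarrow> 'g" +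
  fixes om :: "'g \<Rightarrow> 'g \<Rightarrow> 'g"
  assumes om_bilinear: "bilinear_map sG sG sG om"
    and left_symmetric: "om (om x y) z - om x (om y z) = om (om y x) z - om y (om x z)"
    and right_commutative: "om (om x y) z = om (om x z) y"

locale novikov_representation = novikov_algebra sG om + M: vector_space sM
  for sG :: "'k::field_char_0 \<Rightarrow> 'g::ab_group_add \<Rightarrow> 'g" and om :: "'g \<Rightarrow> 'g \<Rightarrow> 'g"
    and sM :: "'k \<Rightarrow> 'm::ab_group_add \<Rightarrow> 'm" +
  fixes l r :: "'g \<Rightarrow> 'm \<Rightarrow> 'm"
  assumes l_bilinear: "bilinear_map sG sM sM l"
    and r_bilinear: "bilinear_map sG sM sM r"
    and rep1: "l (om x y) m - l (om y x) m = l x (l y m) - l y (l x m)"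
    and rep2: "l x (r y m) - r y (l x m) = r (om x y) m - r y (r x m)"
    and rep3: "l (om x y) m = r y (l x m)"
    and rep4: "r x (r y m) = r y (r x m)"


section \<open>The operad ComDer\<close>

text \<open>Tree monomials in a unary operation (\<open>Der\<close>) and a binary operation (\<open>Prd\<close>). Inputs are
  numbered from 0. A monomial of arity \<open>n\<close> uses each of the inputs \<open>0, \<dots>, n - 1\<close> exactly once.\<close>

datatype monomial = Inp nat | Der monomial | Prd monomial monomial

primrec inputs :: "monomial \<Rightarrow> nat list" where
  "inputs (Inp i) = [i]"
| "inputs (Der t) = inputs t"
| "inputs (Prd s t) = inputs s @ inputs t"

definition monomials :: "nat \<Rightarrow> monomial set" where
  "monomials n = {t. distinct (inputs t) \<and> set (inputs t) = {..<n}}"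

primrec plug :: "(nat \<Rightarrow> monomial) \<Rightarrow> monomial \<Rightarrow> monomial" where
  "plug \<theta> (Inp i) = \<theta> i"
| "plug \<theta> (Der t) = Der (plug \<theta> t)"
| "plug \<theta> (Prd s t) = Prd (plug \<theta> s) (plug \<theta> t)"

text \<open>Operadic composition \<open>t \<circ> (t\<^sub>1, \<dots>, t\<^sub>n)\<close>: the inputs of the grafted monomials are
  renumbered consecutively, block by block.\<close>

definition graft :: "monomial \<Rightarrow> monomial list \<Rightarrow> monomial" where
  "graft t ts =
     plug (\<lambda>i. plug (\<lambda>j. Inp ((\<Sum>h<i. length (inputs (ts ! h))) + j)) (ts ! i)) t"

text \<open>\<open>comder_rel t ts\<close>: one of the defining relations of ComDer, applied at some place inside
  the monomial \<open>t\<close>, equates \<open>t\<close> with the sum of the monomials in the list \<open>ts\<close>.\<close>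

inductive comder_rel :: "monomial \<Rightarrow> monomial list \<Rightarrow> bool" where
  symmetric: "comder_rel (Prd s t) [Prd t s]"
| associative: "comder_rel (Prd (Prd s t) u) [Prd s (Prd t u)]"
| leibniz: "comder_rel (Der (Prd s t)) [Prd (Der s) t, Prd s (Der t)]"
| under_Der: "comder_rel t ts \<Longrightarrow> comder_rel (Der t) (map Der ts)"
| under_Prd1: "comder_rel t ts \<Longrightarrow> comder_rel (Prd t u) (map (\<lambda>s. Prd s u) ts)"
| under_Prd2: "comder_rel t ts \<Longrightarrow> comder_rel (Prd u t) (map (\<lambda>s. Prd u s) ts)"

text \<open>Linear combinations of monomials are coefficient functions \<open>monomial \<Rightarrow> 'k\<close>. The space
  \<open>ComDer(n)\<close> is the space of combinations of elements of \<open>monomials n\<close> modulo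
  \<open>comder_ideal n\<close>, the arity \<open>n\<close> part of the operadic ideal generated by the relations. Its
  elements are handled through representatives and the congruence \<open>comder_eq n\<close>.\<close>

definition single :: "monomial \<Rightarrow> monomial \<Rightarrow> 'k::field" where
  "single t = (\<lambda>s. if s = t then 1 else 0)"

definition fscale :: "'k::field \<Rightarrow> (monomial \<Rightarrow> 'k) \<Rightarrow> monomial \<Rightarrow> 'k" where
  "fscale c a = (\<lambda>t. c * a t)"

definition comder_ideal :: "nat \<Rightarrow> (monomial \<Rightarrow> 'k::field) set" where
  "comder_ideal n = module.span fscale
     {single t - sum_list (map single ts) | t ts. t \<in> monomials n \<and> comder_rel t ts}"

definition comder_eq :: "nat \<Rightarrow> (monomial \<Rightarrow> 'k::field) \<Rightarrow> (monomial \<Rightarrow> 'k) \<Rightarrow> bool" where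
  "comder_eq n a b \<longleftrightarrow> a - b \<in> comder_ideal n"


section \<open>The operad rNov\<close>

text \<open>\<open>P\<^sub>n\<close>; the equation \<open>\<Sum> p\<^sub>i = n - 1\<close> is written without subtraction.\<close>

definition P :: "nat \<Rightarrow> nat list set" where
  "P n = {p. length p = n \<and> sum_list p + 1 = n}"

text \<open>\<open>bas p\<close> is \<open>\<mu>\<^sub>n \<circ> (D\<^bsup>p\<^sub>1\<^esup>, \<dots>, D\<^bsup>p\<^sub>n\<^esup>)\<close> (for nonempty \<open>p\<close>), with the
  \<open>n\<close>-fold product bracketed from the left.\<close>

definition bas :: "nat list \<Rightarrow> monomial" where
  "bas p = (let ts = map (\<lambda>i. (Der ^^ (p ! i)) (Inp i)) [0..<length p]
            in foldl Prd (hd ts) (tl ts))"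

text \<open>\<open>struct_const p [q\<^sub>1, \<dots>, q\<^sub>n] u\<close> is the coefficient of \<open>bas u\<close> when the composite
  \<open>bas p \<circ> (bas q\<^sub>1, \<dots>, bas q\<^sub>n)\<close> is expanded in the basis \<open>{bas u | u. u \<in> P N}\<close> of \<open>rNov(N)\<close>.\<close>

definition struct_const :: "nat list \<Rightarrow> nat list list \<Rightarrow> nat list \<Rightarrow> 'k::field" where
  "struct_const p qs =
     (let N = sum_list (map length qs) in
      THE c. (\<forall>u. u \<notin> P N \<longrightarrow> c u = 0) \<and>
             comder_eq N (single (graft (bas p) (map bas qs)))
                         (\<Sum>u\<in>P N. fscale (c u) (single (bas u))))"


section \<open>Multilinear maps\<close>

text \<open>\<open>Hom(g\<^bsup>\<otimes>n\<^esup>, M)\<close> is the space of \<open>n\<close>-linear maps, as functions on lists of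
  length \<open>n\<close>, set to \<open>0\<close> on lists of any other length.\<close>

definition multilinear_maps ::
  "('k::field \<Rightarrow> 'g::ab_group_add \<Rightarrow> 'g) \<Rightarrow> ('k \<Rightarrow> 'm::ab_group_add \<Rightarrow> 'm) \<Rightarrow> nat \<Rightarrow> ('g list \<Rightarrow> 'm) set" where
  "multilinear_maps sG sM n =
     {f. (\<forall>xs. length xs \<noteq> n \<longrightarrow> f xs = 0) \<and>
         (\<forall>xs i. length xs = n \<longrightarrow> i < n \<longrightarrow> Vector_Spaces.linear sG sM (\<lambda>x. f (xs[i := x])))}"

text \<open>\<open>f\<^sup>\<sigma>(x\<^sub>1, \<dots>, x\<^sub>n) = f(x\<^bsub>\<sigma>\<^sup>-\<^sup>1(1)\<^esub>, \<dots>, x\<^bsub>\<sigma>\<^sup>-\<^sup>1(n)\<^esub>)\<close>;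
  permutations act on the positions \<open>{..<n}\<close>.\<close>

definition hom_act :: "(nat \<Rightarrow> nat) \<Rightarrow> ('g list \<Rightarrow> 'm) \<Rightarrow> 'g list \<Rightarrow> 'm" where
  "hom_act \<sigma> f = (\<lambda>xs. f (permute_list (inv \<sigma>) xs))"

primrec blocks :: "nat list \<Rightarrow> 'a list \<Rightarrow> 'a list list" where
  "blocks [] xs = []"
| "blocks (n # ns) xs = take n xs # blocks ns (drop n xs)"

definition hom_comp ::
  "nat list \<Rightarrow> ('b list \<Rightarrow> 'c::zero) \<Rightarrow> ('a list \<Rightarrow> 'b) list \<Rightarrow> 'a list \<Rightarrow> 'c" where
  "hom_comp ns f gs = (\<lambda>xs. if length xs = sum_list ns
      then f (map2 (\<lambda>g ys. g ys) gs (blocks ns xs)) else 0)"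

definition hom_comp2 ::
  "nat \<Rightarrow> nat \<Rightarrow> ('b \<Rightarrow> 'c \<Rightarrow> 'd::zero) \<Rightarrow> ('a list \<Rightarrow> 'b) \<Rightarrow> ('a list \<Rightarrow> 'c) \<Rightarrow> 'a list \<Rightarrow> 'd" where
  "hom_comp2 m n f g h = (\<lambda>xs. if length xs = m + n
      then f (g (take m xs)) (h (drop m xs)) else 0)"


section \<open>The pseudo-tensor category\<close>

text \<open>An element \<open>\<Sum>\<^bsub>p \<in> P n\<^esub> bas p \<otimes> F p\<close> of \<open>rNov(n) \<otimes> Hom(\<dots>)\<close> is the
  function \<open>F\<close>, set to \<open>0\<close> outside \<open>P n\<close>.\<close>

definition pure_tensor :: "nat list \<Rightarrow> 'h::zero \<Rightarrow> nat list \<Rightarrow> 'h" where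
  "pure_tensor p f = (\<lambda>q. if q = p then f else 0)"

definition rNov_tensor ::
  "('k::field \<Rightarrow> 'g::ab_group_add \<Rightarrow> 'g) \<Rightarrow> ('k \<Rightarrow> 'm::ab_group_add \<Rightarrow> 'm) \<Rightarrow> nat
    \<Rightarrow> (nat list \<Rightarrow> 'g list \<Rightarrow> 'm) set" where
  "rNov_tensor sG sM n =
     {F. (\<forall>p\<in>P n. F p \<in> multilinear_maps sG sM n) \<and> (\<forall>p. p \<notin> P n \<longrightarrow> F p = 0)}"

definition tscale ::
  "('k \<Rightarrow> 'm \<Rightarrow> 'm) \<Rightarrow> 'k \<Rightarrow> (nat list \<Rightarrow> 'g list \<Rightarrow> 'm) \<Rightarrow> nat list \<Rightarrow> 'g list \<Rightarrow> 'm" where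
  "tscale sM c F = (\<lambda>p xs. sM c (F p xs))"

text \<open>Diagonal action: since \<open>(bas p)\<^sup>\<sigma> = bas (p\<^bsub>\<sigma>(1)\<^esub>, \<dots>, p\<^bsub>\<sigma>(n)\<^esub>)\<close>, the
  component of \<open>F\<^sup>\<sigma>\<close> at \<open>q\<close> comes from the component of \<open>F\<close> at
  \<open>p = (q\<^bsub>\<sigma>\<^sup>-\<^sup>1(1)\<^esub>, \<dots>, q\<^bsub>\<sigma>\<^sup>-\<^sup>1(n)\<^esub>)\<close>.\<close>

definition act :: "(nat \<Rightarrow> nat) \<Rightarrow> (nat list \<Rightarrow> 'g list \<Rightarrow> 'm) \<Rightarrow> nat list \<Rightarrow> 'g list \<Rightarrow> 'm" where
  "act \<sigma> F = (\<lambda>q. hom_act \<sigma> (F (permute_list (inv \<sigma>) q)))"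

text \<open>Componentwise composition \<open>F \<circ> (G\<^sub>1, \<dots>, G\<^sub>n)\<close> with \<open>G\<^sub>i\<close> of arity \<open>ns ! (i - 1)\<close>,
  when all inputs of \<open>F\<close> are the same space; \<open>tcomp2\<close> is \<open>R \<circ> (G, H)\<close> for a binary \<open>R\<close>
  whose two inputs may be different spaces.\<close>

definition tcomp ::
  "('k::field \<Rightarrow> 'c::ab_group_add \<Rightarrow> 'c) \<Rightarrow> nat list \<Rightarrow> (nat list \<Rightarrow> 'b list \<Rightarrow> 'c)
    \<Rightarrow> (nat list \<Rightarrow> 'a list \<Rightarrow> 'b) list \<Rightarrow> nat list \<Rightarrow> 'a list \<Rightarrow> 'c" where
  "tcomp sC ns F Gs = (\<lambda>u xs.
     \<Sum>p\<in>P (length ns). \<Sum>qs\<in>listset (map P ns).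
       sC (struct_const p qs u) (hom_comp ns (F p) (map2 (\<lambda>G q. G q) Gs qs) xs))"

definition tcomp2 ::
  "('k::field \<Rightarrow> 'd::ab_group_add \<Rightarrow> 'd) \<Rightarrow> nat \<Rightarrow> nat \<Rightarrow> (nat list \<Rightarrow> 'b \<Rightarrow> 'c \<Rightarrow> 'd)
    \<Rightarrow> (nat list \<Rightarrow> 'a list \<Rightarrow> 'b) \<Rightarrow> (nat list \<Rightarrow> 'a list \<Rightarrow> 'c) \<Rightarrow> nat list \<Rightarrow> 'a list \<Rightarrow> 'd" where
  "tcomp2 sD m n R G H = (\<lambda>u xs.
     \<Sum>p\<in>P 2. \<Sum>q\<in>P m. \<Sum>q'\<in>P n.
       sD (struct_const p [q, q'] u) (hom_comp2 m n (R p) (G q) (H q') xs))"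

definition id_op :: "nat list \<Rightarrow> 'g::zero list \<Rightarrow> 'g" where
  "id_op = pure_tensor [0] (\<lambda>xs. if length xs = 1 then xs ! 0 else 0)"


section \<open>The Chevalley--Eilenberg complex\<close>

definition alpha :: "('g::ab_group_add \<Rightarrow> 'g \<Rightarrow> 'g) \<Rightarrow> nat list \<Rightarrow> 'g list \<Rightarrow> 'g" where
  "alpha om =
     (let w = (\<lambda>xs. if length xs = 2 then om (xs ! 0) (xs ! 1) else 0)
      in pure_tensor [1, 0] w - pure_tensor [0, 1] (hom_act (transpose 0 1) w))"

definition rho :: "('g \<Rightarrow> 'm \<Rightarrow> 'm) \<Rightarrow> ('g \<Rightarrow> 'm \<Rightarrow> 'm) \<Rightarrow> nat list \<Rightarrow> 'g \<Rightarrow> 'm \<Rightarrow> 'm::ab_group_add" where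
  "rho l r = pure_tensor [1, 0] l - pure_tensor [0, 1] r"

definition CE ::
  "('k::field \<Rightarrow> 'g::ab_group_add \<Rightarrow> 'g) \<Rightarrow> ('k \<Rightarrow> 'm::ab_group_add \<Rightarrow> 'm) \<Rightarrow> nat
    \<Rightarrow> (nat list \<Rightarrow> 'g list \<Rightarrow> 'm) set" where
  "CE sG sM n = {F \<in> rNov_tensor sG sM n.
     \<forall>\<sigma>. \<sigma> permutes {..<n} \<longrightarrow> act \<sigma> F = tscale sM (of_int (sign \<sigma>)) F}"

definition Sh_inv :: "nat \<Rightarrow> nat \<Rightarrow> (nat \<Rightarrow> nat) set" where
  "Sh_inv i j = {\<sigma>. \<sigma> permutes {..<i + j} \<and>
     strict_mono_on {..<i} (inv \<sigma>) \<and> strict_mono_on {i..<i + j} (inv \<sigma>)}"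

definition d_CE ::
  "('k::field \<Rightarrow> 'm::ab_group_add \<Rightarrow> 'm) \<Rightarrow> ('g::ab_group_add \<Rightarrow> 'g \<Rightarrow> 'g)
    \<Rightarrow> ('g \<Rightarrow> 'm \<Rightarrow> 'm) \<Rightarrow> ('g \<Rightarrow> 'm \<Rightarrow> 'm) \<Rightarrow> nat
    \<Rightarrow> (nat list \<Rightarrow> 'g list \<Rightarrow> 'm) \<Rightarrow> nat list \<Rightarrow> 'g list \<Rightarrow> 'm" where
  "d_CE sM om l r n F =
     (\<Sum>\<sigma>\<in>Sh_inv 1 n. tscale sM (of_int (sign \<sigma>))
        (act \<sigma> (tcomp2 sM 1 n (rho l r) id_op F)))
   - (\<Sum>\<sigma>\<in>Sh_inv 2 (n - 1). tscale sM (of_int (sign \<sigma>))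
        (act \<sigma> (tcomp sM (2 # replicate (n - 1) 1) F (alpha om # replicate (n - 1) id_op))))"


section \<open>The Novikov complex\<close>

text \<open>An element \<open>(k\<^bsub>n-1\<^esub>, \<dots>, k\<^sub>0)\<close> of \<open>K\<^sub>n\<close> is the list with entry \<open>k\<^sub>j\<close> at
  position \<open>n - 1 - j\<close>.\<close>

definition K :: "nat \<Rightarrow> nat list set" where
  "K n = {k. length k = n \<and> sum_list k = n \<and> (\<Sum>j<n. j * k ! (n - 1 - j)) + 1 = n}"

definition same_block :: "nat list \<Rightarrow> nat \<Rightarrow> nat \<Rightarrow> bool" where
  "same_block k i j \<longleftrightarrow> (\<exists>b<length k.
     {i, j} \<subseteq> {sum_list (take b k)..<sum_list (take (Suc b) k)})"

text \<open>\<open>Hom(\<Lambda>\<^bsup>k\<^sub>n\<^sub>-\<^sub>1\<^esup>g \<otimes> \<dots> \<otimes> \<Lambda>\<^bsup>k\<^sub>0\<^esup>g, M)\<close>, by the universal property of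
  the exterior powers: multilinear maps that vanish whenever two arguments in the same block are
  equal.\<close>

definition wedge_maps ::
  "('k::field \<Rightarrow> 'g::ab_group_add \<Rightarrow> 'g) \<Rightarrow> ('k \<Rightarrow> 'm::ab_group_add \<Rightarrow> 'm) \<Rightarrow> nat list
    \<Rightarrow> ('g list \<Rightarrow> 'm) set" where
  "wedge_maps sG sM k = {f \<in> multilinear_maps sG sM (sum_list k).
     \<forall>xs i j. length xs = sum_list k \<longrightarrow> i \<noteq> j \<longrightarrow> same_block k i j \<longrightarrow> xs ! i = xs ! j \<longrightarrow> f xs = 0}"

definition Nov_cochains ::
  "('k::field \<Rightarrow> 'g::ab_group_add \<Rightarrow> 'g) \<Rightarrow> ('k \<Rightarrow> 'm::ab_group_add \<Rightarrow> 'm) \<Rightarrow> nat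
    \<Rightarrow> (nat list \<Rightarrow> 'g list \<Rightarrow> 'm) set" where
  "Nov_cochains sG sM n =
     {c. (\<forall>k\<in>K n. c k \<in> wedge_maps sG sM k) \<and> (\<forall>k. k \<notin> K n \<longrightarrow> c k = 0)}"

definition multiplicities :: "nat \<Rightarrow> nat list \<Rightarrow> nat list" where
  "multiplicities n p = map (\<lambda>j. card {i. i < n \<and> p ! i = j}) (rev [0..<n])"

definition Gamma :: "nat \<Rightarrow> (nat list \<Rightarrow> 'g list \<Rightarrow> 'm::zero) \<Rightarrow> nat list \<Rightarrow> 'g list \<Rightarrow> 'm" where
  "Gamma n F = (\<lambda>k. if k \<in> K n
      then F (inv_into {p \<in> P n. sorted_wrt (\<ge>) p} (multiplicities n) k) else 0)"

definition d_Nov ::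
  "('k::field \<Rightarrow> 'g::ab_group_add \<Rightarrow> 'g) \<Rightarrow> ('g \<Rightarrow> 'g \<Rightarrow> 'g) \<Rightarrow> ('k \<Rightarrow> 'm::ab_group_add \<Rightarrow> 'm)
    \<Rightarrow> ('g \<Rightarrow> 'm \<Rightarrow> 'm) \<Rightarrow> ('g \<Rightarrow> 'm \<Rightarrow> 'm) \<Rightarrow> nat
    \<Rightarrow> (nat list \<Rightarrow> 'g list \<Rightarrow> 'm) \<Rightarrow> nat list \<Rightarrow> 'g list \<Rightarrow> 'm" where
  "d_Nov sG om sM l r n c =
     Gamma (n + 1) (d_CE sM om l r n (inv_into (CE sG sM n) (Gamma n) c))"

end

theory Submission
  imports Defs
begin

text \<open>
  An element \<open>\<Sum>\<^sub>p \<mu>\<^sub>n \<circ> (D\<^bsup>p\<^sub>1\<^esup>, \<dots>, D\<^bsup>p\<^sub>n\<^esup>) \<otimes> F\<^sub>p\<close> is determined by its values on powers \<open>t\<^sup>a\<close>,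
  \<open>a \<in> \<bbbK>\<close>, of a formal variable with \<open>D t\<^sup>a = a t\<^bsup>a-1\<^esup>\<close>: evaluation gives the function
  \<open>(x\<^sub>1 t\<^bsup>a\<^sub>1\<^esup>, \<dots>, x\<^sub>n t\<^bsup>a\<^sub>n\<^esup>) \<mapsto> (\<Sum>\<^sub>p (\<Prod>\<^sub>i (a\<^sub>i)\<^bsub>p\<^sub>i\<^esub>) F\<^sub>p(x\<^sub>1, \<dots>, x\<^sub>n)) t\<^bsup>a\<^sub>1+\<dots>+a\<^sub>n-n+1\<^esup>\<close> with falling factorials
  \<open>(a)\<^sub>p\<close>, and on \<open>P\<^sub>n\<close> the matrix \<open>(\<Prod>\<^sub>i (q\<^sub>i)\<^bsub>p\<^sub>i\<^esub>)\<^bsub>q,p\<^esub>\<close> is diagonal with nonzero diagonal entries in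
  characteristic \<open>0\<close>. Under evaluation \<open>d\<^bsub>CE\<^esub>\<close> becomes the ordinary Chevalley--Eilenberg differential for the
  bracket \<open>[x t\<^sup>a, y t\<^sup>b] = (a x\<diamond>y - b y\<diamond>x) t\<^bsup>a+b-1\<^esup>\<close>. With \<open>\<iota>\<^sub>z\<close> the insertion of \<open>z\<close> as first
  argument and \<open>L\<^sub>z\<close> the Lie derivative, that differential satisfies Cartan's formula
  \<open>\<iota>\<^sub>z d = L\<^sub>z - d \<iota>\<^sub>z\<close>. It commutes with every \<open>L\<^sub>z\<close>, hence
  \<open>\<iota>\<^sub>z d d = L\<^sub>z d - d L\<^sub>z + d d \<iota>\<^sub>z = d d \<iota>\<^sub>z\<close>, and \<open>d d = 0\<close> follows by induction on the number of
  arguments.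
\<close>

section \<open>Normal forms in ComDer\<close>

text \<open>The obstacle is that composition in \<open>rNov\<close> is available only through
  \<open>struct_const\<close>, a definite description over a quotient of spaces of monomials. Its
  values are never computed. Rewriting with the relations shows that an expansion exists, evaluation
  shows that it is unique, and from then on the structure constants enter through their pairing with
  falling factorials, which turns composition of operations into composition of functions. Pairs
  \<open>(x, a)\<close> cannot be added, so the bracket on them is not literally a Lie algebra. Its
  Jacobi identity and antisymmetry are stated inside one argument of a cochain, where multilinearity
  gives them a meaning. Cartan's formula is taken as the definition of the differential, by
  recursion on the argument list; shuffles occur only in one comparison with it, which uses that the
  cochain is alternating. Transport to \<open>Nov_cochains\<close> needs \<open>Gamma\<close> to be
  bijective on \<open>CE\<close>. This rests on the fact that the blocks of a wedge map are the
  level sets of the exponent list, so that permutations within blocks are the stabilizer of that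
  list.\<close>

interpretation fscale: vector_space "fscale :: 'k::field \<Rightarrow> (monomial \<Rightarrow> 'k) \<Rightarrow> monomial \<Rightarrow> 'k"
  by unfold_locales (auto simp: fscale_def fun_eq_iff algebra_simps)

primrec ders :: "monomial \<Rightarrow> nat" where
  "ders (Inp i) = 0"
| "ders (Der t) = Suc (ders t)"
| "ders (Prd s t) = ders s + ders t"

text \<open>Every relation is homogeneous in the inputs and in the number of derivations. Hence a
  monomial of arity \<open>n\<close> with \<open>n - 1\<close> derivations can only be rewritten
  into basis elements indexed by \<open>P n\<close>.\<close>

lemma comder_rel_invariants:
  assumes "comder_rel t ts" "s \<in> set ts"
  shows "mset (inputs s) = mset (inputs t) \<and> ders s = ders t"
  using assms by (induction arbitrary: s rule: comder_rel.induct) auto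

lemma monomials_iff: "t \<in> monomials n \<longleftrightarrow> mset (inputs t) = mset [0..<n]"
proof
  assume "t \<in> monomials n"
  then show "mset (inputs t) = mset [0..<n]"
    using set_eq_iff_mset_eq_distinct[of "inputs t" "[0..<n]"]
    by (simp add: monomials_def atLeast0LessThan)
next
  assume "mset (inputs t) = mset [0..<n]"
  then show "t \<in> monomials n"
    using mset_eq_imp_distinct_iff[of "inputs t" "[0..<n]"] mset_eq_setD[of "inputs t" "[0..<n]"]
    by (simp add: monomials_def atLeast0LessThan)
qed

text \<open>A list stands for the sum of its entries. The right-hand sides of all relations are sums
  with coefficients 1, so rewriting involves no scalars.\<close>

inductive expand :: "monomial list \<Rightarrow> monomial list \<Rightarrow> bool" where
  "comder_rel t ts \<Longrightarrow> expand (us @ t # vs) (us @ ts @ vs)"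

abbreviation expands :: "monomial list \<Rightarrow> monomial list \<Rightarrow> bool" where
  "expands \<equiv> expand\<^sup>*\<^sup>*"

lemma expands_rel: "comder_rel t ts \<Longrightarrow> expands [t] ts"
  using expand.intros[of t ts "[]" "[]"] by auto

lemma expands_mono:
  assumes "\<And>s ss. expand s ss \<Longrightarrow> expand (C s) (C ss)" and "expands ts us"
  shows "expands (C ts) (C us)"
  using assms(2) by induction (auto intro: assms(1) rtranclp.rtrancl_into_rtrancl)

lemma expand_append:
  assumes "expand ts us"
  shows "expand (as @ ts @ bs) (as @ us @ bs)"
  using assms
proof cases
  case (1 t ts us vs)
  then show ?thesis using expand.intros[of t ts "as @ us" "vs @ bs"] by simp
qed

lemma expands_append:
  assumes "expands ts us" and "expands ts' us'"
  shows "expands (ts @ ts') (us @ us')"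
proof -
  have "expands (ts @ ts') (us @ ts')"
    using expands_mono[where C = "\<lambda>s. s @ ts'"] expand_append[of _ _ "[]"] assms(1) by auto
  moreover have "expands (us @ ts') (us @ us')"
    using expands_mono[where C = "\<lambda>s. us @ s"] expand_append[of _ _ _ "[]"] assms(2) by auto
  ultimately show ?thesis by auto
qed

lemma expands_Der: "expands ts us \<Longrightarrow> expands (map Der ts) (map Der us)"
  by (rule expands_mono) (auto elim!: expand.cases intro!: expand.intros under_Der)

lemma expands_Prd1: "expands ts us \<Longrightarrow> expands (map (\<lambda>s. Prd s u) ts) (map (\<lambda>s. Prd s u) us)"
  by (rule expands_mono) (auto elim!: expand.cases intro!: expand.intros under_Prd1)

lemma expands_Prd2: "expands ts us \<Longrightarrow> expands (map (Prd u) ts) (map (Prd u) us)"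
  by (rule expands_mono) (auto elim!: expand.cases intro!: expand.intros under_Prd2)

lemma expands_commute: "expands [Prd s t] [Prd t s]"
  by (intro expands_rel symmetric)

text \<open>The associativity relation is oriented to the right only. Cyclic rotation by
  commutativity turns it around.\<close>

lemma expands_assoc: "expands [Prd s (Prd t u)] [Prd (Prd s t) u]"
proof -
  have "expands [Prd s (Prd t u)] [Prd (Prd t u) s]" by (rule expands_commute)
  also have "expands [Prd (Prd t u) s] [Prd t (Prd u s)]" by (intro expands_rel associative)
  also have "expands [Prd t (Prd u s)] [Prd (Prd u s) t]" by (rule expands_commute)
  also have "expands [Prd (Prd u s) t] [Prd u (Prd s t)]" by (intro expands_rel associative)
  also have "expands [Prd u (Prd s t)] [Prd (Prd s t) u]" by (rule expands_commute)
  finally show ?thesis .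
qed

lemma expands_all:
  assumes "\<And>t. t \<in> set ts \<Longrightarrow> \<exists>us. expands [t] us \<and> (\<forall>u\<in>set us. Q u)"
  shows "\<exists>us. expands ts us \<and> (\<forall>u\<in>set us. Q u)"
  using assms
proof (induction ts)
  case (Cons t ts)
  obtain us where "expands [t] us" "\<forall>u\<in>set us. Q u" using Cons.prems by auto
  moreover obtain vs where "expands ts vs" "\<forall>u\<in>set vs. Q u" using Cons by auto
  ultimately show ?case
    using expands_append[of "[t]" us ts vs] by (intro exI[of _ "us @ vs"]) auto
qed auto

section \<open>Rearrangement of iterated products\<close>

definition prd :: "monomial list \<Rightarrow> monomial" where
  "prd ts = foldl Prd (hd ts) (tl ts)"

lemma prd_single [simp]: "prd [t] = t"
  by (simp add: prd_def)

lemma prd_snoc: "ts \<noteq> [] \<Longrightarrow> prd (ts @ [t]) = Prd (prd ts) t"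
  by (simp add: prd_def)

lemma inputs_prd: "ts \<noteq> [] \<Longrightarrow> inputs (prd ts) = concat (map inputs ts)"
  by (induction ts rule: rev_nonempty_induct) (auto simp: prd_snoc)

lemma ders_prd: "ts \<noteq> [] \<Longrightarrow> ders (prd ts) = sum_list (map ders ts)"
  by (induction ts rule: rev_nonempty_induct) (auto simp: prd_snoc)

lemma expands_prd_append:
  assumes "ts \<noteq> []" "us \<noteq> []"
  shows "expands [Prd (prd ts) (prd us)] [prd (ts @ us)]"
  using assms(2)
proof (induction us rule: rev_nonempty_induct)
  case (single u)
  then show ?case using assms(1) by (simp add: prd_snoc)
next
  case (snoc u us)
  have "expands [Prd (prd ts) (prd (us @ [u]))] [Prd (Prd (prd ts) (prd us)) u]"
    using expands_assoc snoc by (simp add: prd_snoc)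
  also have "expands [Prd (Prd (prd ts) (prd us)) u] [Prd (prd (ts @ us)) u]"
    using expands_Prd1[OF snoc.IH, of u] by simp
  also have "[Prd (prd (ts @ us)) u] = [prd (ts @ us @ [u])]"
    using assms(1) prd_snoc[of "ts @ us"] by simp
  finally show ?case .
qed

lemma expands_prd_append_rev:
  assumes "ts \<noteq> []" "us \<noteq> []"
  shows "expands [prd (ts @ us)] [Prd (prd ts) (prd us)]"
  using assms(2)
proof (induction us rule: rev_nonempty_induct)
  case (single u)
  then show ?case using assms(1) by (simp add: prd_snoc)
next
  case (snoc u us)
  have "[prd (ts @ us @ [u])] = [Prd (prd (ts @ us)) u]"
    using assms(1) prd_snoc[of "ts @ us"] by simp
  also have "expands \<dots> [Prd (Prd (prd ts) (prd us)) u]"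
    using expands_Prd1[OF snoc.IH, of u] by simp
  also have "expands \<dots> [Prd (prd ts) (prd (us @ [u]))]"
    using snoc by (auto simp: prd_snoc intro!: expands_rel associative)
  finally show ?case .
qed

lemma expands_prd_swap: "expands [prd (ts @ us)] [prd (us @ ts)]"
proof (cases "ts = [] \<or> us = []")
  case False
  then have "expands [prd (ts @ us)] [Prd (prd ts) (prd us)]"
    by (intro expands_prd_append_rev) auto
  also have "expands \<dots> [Prd (prd us) (prd ts)]" by (rule expands_commute)
  also have "expands \<dots> [prd (us @ ts)]" using False by (intro expands_prd_append) auto
  finally show ?thesis .
qed auto

text \<open>Induction on the target: a cyclic rotation brings the wanted last factor to the end, and
  the induction hypothesis rearranges the remaining ones.\<close>

lemma expands_prd_permute:
  assumes "mset ts = mset us"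
  shows "expands [prd ts] [prd us]"
  using assms
proof (induction us arbitrary: ts rule: rev_induct)
  case (snoc u us)
  then have "u \<in> set ts" by (metis in_set_conv_decomp mset_eq_setD)
  then obtain as bs where ts: "ts = as @ u # bs" by (auto dest: split_list)
  have IH: "expands [prd (bs @ as)] [prd us]"
    using snoc.prems by (intro snoc.IH) (simp add: ts add.commute)
  have "expands [prd ts] [prd (bs @ as @ [u])]"
    using expands_prd_swap[of "as @ [u]" bs] by (simp add: ts)
  also have "expands [prd (bs @ as @ [u])] [prd (us @ [u])]"
  proof (cases "bs @ as = []")
    case True
    then show ?thesis using snoc.prems by (auto simp: ts)
  next
    case False
    then have "us \<noteq> []" using snoc.prems by (auto simp: ts)
    then show ?thesis
      using expands_Prd1[OF IH, of u] prd_snoc[OF False, of u] by (simp add: prd_snoc)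
  qed
  finally show ?case .
qed auto

section \<open>Reduction to products of iterated derivatives of inputs\<close>

definition atomic :: "monomial \<Rightarrow> bool" where
  "atomic t \<longleftrightarrow> (\<exists>p i. t = (Der ^^ p) (Inp i))"

lemma atomic_Inp: "atomic (Inp i)"
  unfolding atomic_def by (rule exI[of _ 0]) simp

lemma atomic_Der: "atomic t \<Longrightarrow> atomic (Der t)"
  unfolding atomic_def by (metis funpow.simps(2) o_apply)

lemma inputs_funpow_Der [simp]: "inputs ((Der ^^ p) t) = inputs t"
  by (induction p) auto

lemma ders_funpow_Der [simp]: "ders ((Der ^^ p) t) = p + ders t"
  by (induction p) auto

definition product_of_atoms :: "monomial \<Rightarrow> bool" where
  "product_of_atoms t \<longleftrightarrow> (\<exists>ts. ts \<noteq> [] \<and> (\<forall>s\<in>set ts. atomic s) \<and> t = prd ts)"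

lemma product_of_atoms_Prd:
  "product_of_atoms s \<Longrightarrow> atomic t \<Longrightarrow> product_of_atoms (Prd s t)"
  unfolding product_of_atoms_def
  apply clarsimp
  subgoal for ts by (rule exI[of _ "ts @ [t]"]) (auto simp: prd_snoc)
  done

text \<open>The Leibniz rule splits off the last factor: the derivative falls either on it, giving
  an atom again, or on the shorter product, which is the induction hypothesis.\<close>

lemma Der_prd_expands:
  assumes "ts \<noteq> []" "\<forall>s\<in>set ts. atomic s"
  shows "\<exists>us. expands [Der (prd ts)] us \<and> (\<forall>u\<in>set us. product_of_atoms u)"
  using assms
proof (induction ts rule: rev_nonempty_induct)
  case (single t)
  then show ?case
    by (intro exI[of _ "[Der t]"])
       (auto simp: product_of_atoms_def atomic_Der intro!: exI[of _ "[Der t]"])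
next
  case (snoc t ts)
  then obtain us where us: "expands [Der (prd ts)] us" "\<forall>u\<in>set us. product_of_atoms u" by auto
  have "expands [Der (prd (ts @ [t]))] [Prd (Der (prd ts)) t, Prd (prd ts) (Der t)]"
    using snoc by (auto simp: prd_snoc intro!: expands_rel leibniz)
  also have "expands \<dots> (map (\<lambda>s. Prd s t) us @ [Prd (prd ts) (Der t)])"
    using expands_append[OF expands_Prd1[OF us(1), of t] rtranclp.rtrancl_refl] by simp
  finally show ?case
    using us(2) snoc
    by (intro exI[of _ "map (\<lambda>s. Prd s t) us @ [Prd (prd ts) (Der t)]"])
       (auto intro!: product_of_atoms_Prd atomic_Der simp: product_of_atoms_def[of "prd ts"])
qed

text \<open>Derivatives are pushed inwards and products flattened. A subterm rewrites to a whole
  list, so each case rewrites inside its context and then treats the entries one by one through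
  \<open>expands_all\<close>.\<close>

lemma expands_product_of_atoms:
  "\<exists>us. expands [t] us \<and> (\<forall>u\<in>set us. product_of_atoms u)"
proof (induction t)
  case (Inp i)
  show ?case
    by (intro exI[of _ "[Inp i]"])
       (auto simp: product_of_atoms_def atomic_Inp intro!: exI[of _ "[Inp i]"])
next
  case (Der t)
  then obtain us where us: "expands [t] us" "\<forall>u\<in>set us. product_of_atoms u" by auto
  have "\<exists>vs. expands (map Der us) vs \<and> (\<forall>v\<in>set vs. product_of_atoms v)"
  proof (rule expands_all)
    fix u' assume "u' \<in> set (map Der us)"
    then obtain ts where "ts \<noteq> []" "\<forall>s\<in>set ts. atomic s" "u' = Der (prd ts)"
      using us(2) by (auto simp: product_of_atoms_def)
    then show "\<exists>vs. expands [u'] vs \<and> (\<forall>v\<in>set vs. product_of_atoms v)"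
      using Der_prd_expands by simp
  qed
  with expands_Der[OF us(1)] show ?case
    by (metis list.simps(8) list.simps(9) rtranclp_trans)
next
  case (Prd s t)
  then obtain us vs where us: "expands [s] us" "\<forall>u\<in>set us. product_of_atoms u"
    and vs: "expands [t] vs" "\<forall>u\<in>set vs. product_of_atoms u" by auto
  have 1: "\<exists>ws. expands [Prd u v] ws \<and> (\<forall>w\<in>set ws. product_of_atoms w)"
    if u: "product_of_atoms u" and v: "product_of_atoms v" for u v
  proof -
    obtain as bs where "as \<noteq> []" "\<forall>s\<in>set as. atomic s" "u = prd as"
      "bs \<noteq> []" "\<forall>s\<in>set bs. atomic s" "v = prd bs"
      using u v by (auto simp: product_of_atoms_def)
    then show ?thesis
      by (intro exI[of _ "[prd (as @ bs)]"])
         (auto simp: product_of_atoms_def expands_prd_append intro!: exI[of _ "as @ bs"])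
  qed
  have 2: "\<exists>ws. expands [Prd u t] ws \<and> (\<forall>w\<in>set ws. product_of_atoms w)"
    if u: "product_of_atoms u" for u
  proof -
    have "\<exists>ws. expands (map (Prd u) vs) ws \<and> (\<forall>w\<in>set ws. product_of_atoms w)"
      by (rule expands_all) (use 1[OF u] vs(2) in force)
    with expands_Prd2[OF vs(1), of u] show ?thesis
      by (metis list.simps(8) list.simps(9) rtranclp_trans)
  qed
  have "\<exists>ws. expands (map (\<lambda>s. Prd s t) us) ws \<and> (\<forall>w\<in>set ws. product_of_atoms w)"
    by (rule expands_all) (use 2 us(2) in force)
  with expands_Prd1[OF us(1), of t] show ?case
    by (metis (no_types, lifting) list.simps(8) list.simps(9) rtranclp_trans)
qed

lemma bas_eq_prd: "bas p = prd (map (\<lambda>i. (Der ^^ (p ! i)) (Inp i)) [0..<length p])"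
  by (simp add: bas_def prd_def Let_def)

lemma inputs_bas: "p \<noteq> [] \<Longrightarrow> inputs (bas p) = [0..<length p]"
proof -
  have "concat (map (\<lambda>i. [i]) xs) = xs" for xs :: "nat list" by (induction xs) auto
  then show "p \<noteq> [] \<Longrightarrow> inputs (bas p) = [0..<length p]"
  unfolding bas_eq_prd
  by (subst inputs_prd) (auto simp: comp_def)
qed

lemma ders_bas: "p \<noteq> [] \<Longrightarrow> ders (bas p) = sum_list p"
  unfolding bas_eq_prd
  by (subst ders_prd) (auto simp: comp_def map_nth)

text \<open>In arity \<open>n\<close> the atoms carry each input exactly once, so sorting them by
  input puts the atom with input \<open>i\<close> in place \<open>i\<close>. The numbers of
  derivations then form \<open>p\<close>.\<close>

lemma product_of_atoms_expands_bas:
  assumes "product_of_atoms t" "t \<in> monomials n"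
  shows "\<exists>p. length p = n \<and> sum_list p = ders t \<and> p \<noteq> [] \<and> expands [t] [bas p]"
proof -
  obtain ts where ts: "ts \<noteq> []" "\<forall>s\<in>set ts. atomic s" "t = prd ts"
    using assms(1) by (auto simp: product_of_atoms_def)
  define f where "f = (\<lambda>(p, i). (Der ^^ p) (Inp i))"
  obtain qs where qs: "ts = map f qs"
  proof -
    have "\<forall>s\<in>set ts. \<exists>q. s = f q" using ts(2) by (simp add: atomic_def f_def)
    then show ?thesis using that by (metis ex_map_conv)
  qed
  have "concat (map (inputs \<circ> f) qs) = map snd qs"
    by (induction qs) (auto simp: f_def)
  then have "inputs t = map snd qs"
    using ts by (simp add: inputs_prd qs)
  then have snd: "mset (map snd qs) = mset [0..<n]"
    using assms(2) monomials_iff by metis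
  obtain rs where rs: "mset rs = mset qs" "map snd rs = [0..<n]"
  proof -
    have "map snd (sort_key snd qs) = sort (map snd qs)"
      by (rule properties_for_sort[symmetric]) auto
    also have "\<dots> = [0..<n]" using snd by (metis properties_for_sort sorted_upt)
    finally show ?thesis by (intro that[of "sort_key snd qs"]) auto
  qed
  define p where "p = map fst rs"
  have len: "length rs = n" using rs(2) by (metis length_map diff_zero length_upt)
  have "map f rs = map (\<lambda>i. (Der ^^ (p ! i)) (Inp i)) [0..<length p]"
  proof (rule nth_equalityI)
    fix i assume i: "i < length (map f rs)"
    then have "snd (rs ! i) = i" using rs(2) len by (metis add_0 length_map nth_map nth_upt)
    then show "map f rs ! i = map (\<lambda>i. (Der ^^ (p ! i)) (Inp i)) [0..<length p] ! i"
      using i by (simp add: p_def f_def case_prod_unfold)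
  qed (simp add: p_def)
  then have "prd (map f rs) = bas p" by (simp add: bas_eq_prd)
  moreover have "expands [t] [prd (map f rs)]"
    unfolding ts(3) qs using rs(1) by (intro expands_prd_permute) simp
  moreover have "sum_list p = ders t"
  proof -
    have 1: "ders \<circ> f = fst" by (auto simp: f_def fun_eq_iff)
    have "ders t = sum_list (map fst qs)" using ts by (simp add: ders_prd qs 1)
    also have "\<dots> = sum_list p" unfolding p_def using rs(1) by (metis mset_map sum_mset_sum_list)
    finally show ?thesis by simp
  qed
  moreover have "rs \<noteq> []" using ts(1) qs rs(1) by auto
  ultimately show ?thesis using len by (intro exI[of _ p]) (auto simp: p_def)
qed

lemma expands_invariants:
  assumes "expands ts us" "u \<in> set us"
  shows "\<exists>t\<in>set ts. mset (inputs u) = mset (inputs t) \<and> ders u = ders t"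
  using assms
proof (induction arbitrary: u rule: rtranclp_induct)
  case (step us vs)
  from step.hyps(2) step.prems obtain w where "w \<in> set us" "mset (inputs u) = mset (inputs w)" "ders u = ders w"
    by (cases rule: expand.cases) (auto dest: comder_rel_invariants)
  with step.IH show ?case by metis
qed auto

lemma expands_bas:
  assumes "t \<in> monomials n" "ders t + 1 = n"
  shows "\<exists>ps. set ps \<subseteq> P n \<and> expands [t] (map bas ps)"
proof -
  obtain us where us: "expands [t] us" "\<forall>u\<in>set us. product_of_atoms u"
    using expands_product_of_atoms by blast
  have "\<exists>vs. expands us vs \<and> (\<forall>v\<in>set vs. v \<in> bas ` P n)"
  proof (rule expands_all)
    fix u assume u: "u \<in> set us"
    with expands_invariants[OF us(1)] have inv: "mset (inputs u) = mset (inputs t)" "ders u = ders t" by auto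
    then have "u \<in> monomials n" using assms by (simp add: monomials_iff)
    then obtain p where p: "length p = n" "sum_list p = ders u" "expands [u] [bas p]"
      using product_of_atoms_expands_bas us(2) u by blast
    with inv(2) assms(2) have "p \<in> P n" by (simp add: P_def)
    with p(3) show "\<exists>vs. expands [u] vs \<and> (\<forall>v\<in>set vs. v \<in> bas ` P n)"
      by (intro exI[of _ "[bas p]"]) simp
  qed
  then obtain vs where vs: "expands us vs" "set vs \<subseteq> bas ` P n" by auto
  then obtain ps where "vs = map bas ps" "set ps \<subseteq> P n"
  proof -
    have "vs \<in> lists (bas ` P n)" using vs(2) by auto
    then show ?thesis using that by (auto simp: lists_image)
  qed
  with us(1) vs(1) show ?thesis by (metis rtranclp_trans)
qed

text \<open>One rewriting step changes the sum by a single generator of the ideal. The generators of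
  \<open>comder_ideal n\<close> come from monomials of arity \<open>n\<close>, so the arity is
  tracked along the rewriting.\<close>

lemma expands_comder_eq:
  assumes "expands ts us" "\<forall>t\<in>set ts. t \<in> monomials n"
  shows "comder_eq n (sum_list (map single ts) :: _ \<Rightarrow> 'k::field) (sum_list (map single us))"
  using assms
proof (induction rule: rtranclp_induct)
  case base
  then show ?case by (simp add: comder_eq_def comder_ideal_def fscale.span_zero)
next
  case (step us vs)
  have mon: "\<forall>t\<in>set us. t \<in> monomials n"
    using expands_invariants[OF step.hyps(1)] step.prems by (metis monomials_iff)
  from step.hyps(2) have "sum_list (map single us) - sum_list (map single vs) \<in> (comder_ideal n :: (_ \<Rightarrow> 'k) set)"
  proof cases
    case (1 t ts as bs)
    then have "single t - sum_list (map single ts) \<in> (comder_ideal n :: (_ \<Rightarrow> 'k) set)"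
      using mon unfolding comder_ideal_def by (intro fscale.span_base) auto
    then show ?thesis using 1 by simp
  qed
  from fscale.span_add[OF step.IH[OF step.prems, unfolded comder_eq_def comder_ideal_def] this[unfolded comder_ideal_def]]
  show ?case
    by (simp add: comder_eq_def comder_ideal_def)
qed

section \<open>Evaluation of differential monomials on powers\<close>

text \<open>Substituting the power \<open>t^(a i)\<close> for input \<open>i\<close> turns a
  monomial into the scalar \<open>mon_coef\<close> times a power of \<open>t\<close> with exponent
  \<open>mon_exp\<close>.\<close>

primrec mon_exp :: "(nat \<Rightarrow> 'k::field) \<Rightarrow> monomial \<Rightarrow> 'k" where
  "mon_exp a (Inp i) = a i"
| "mon_exp a (Der t) = mon_exp a t - 1"
| "mon_exp a (Prd s t) = mon_exp a s + mon_exp a t"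

primrec mon_coef :: "(nat \<Rightarrow> 'k::field) \<Rightarrow> monomial \<Rightarrow> 'k" where
  "mon_coef a (Inp i) = 1"
| "mon_coef a (Der t) = mon_exp a t * mon_coef a t"
| "mon_coef a (Prd s t) = mon_coef a s * mon_coef a t"

lemma comder_rel_mon_exp: "comder_rel t ts \<Longrightarrow> s \<in> set ts \<Longrightarrow> mon_exp a s = mon_exp a t"
  by (induction arbitrary: s rule: comder_rel.induct) (auto simp: algebra_simps)

text \<open>The relations of ComDer hold for powers of \<open>t\<close>. A surrounding derivation
  multiplies each coefficient by an exponent, and this is compatible with sums because all terms of
  a relation share one exponent.\<close>

lemma comder_rel_mon_coef: "comder_rel t ts \<Longrightarrow> sum_list (map (mon_coef a) ts) = mon_coef a t"
proof (induction rule: comder_rel.induct)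
  case (under_Der t ts)
  have "sum_list (map (mon_coef a) (map Der ts)) = sum_list (map (\<lambda>s. mon_exp a t * mon_coef a s) ts)"
    using comder_rel_mon_exp[OF under_Der.hyps, of _ a]
    by (auto intro!: arg_cong[where f = sum_list])
  then show ?case using under_Der.IH by (simp add: sum_list_const_mult)
qed (auto simp: algebra_simps comp_def sum_list_const_mult sum_list_mult_const)

text \<open>The linear extension of \<open>w\<close> from monomials to their combinations.
  Coefficient functions live on an infinite type, so the sum is meaningful only for finite support,
  a condition that the following lemmas carry along.\<close>

definition functional :: "(monomial \<Rightarrow> 'k::field) \<Rightarrow> (monomial \<Rightarrow> 'k) \<Rightarrow> 'k" where
  "functional w b = (\<Sum>t | b t \<noteq> 0. b t * w t)"

lemma functional_eq: "finite S \<Longrightarrow> {t. b t \<noteq> 0} \<subseteq> S \<Longrightarrow> functional w b = (\<Sum>t\<in>S. b t * w t)"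
  unfolding functional_def by (intro sum.mono_neutral_left) auto

lemma functional_add:
  assumes "finite {t. b t \<noteq> 0}" "finite {t. c t \<noteq> 0}"
  shows "finite {t. (b + c) t \<noteq> 0}" "functional w (b + c) = functional w b + functional w c"
proof -
  let ?S = "{t. b t \<noteq> 0} \<union> {t. c t \<noteq> 0}"
  have S: "finite ?S" "{t. (b + c) t \<noteq> 0} \<subseteq> ?S" using assms by auto
  show "finite {t. (b + c) t \<noteq> 0}" using S finite_subset by blast
  show "functional w (b + c) = functional w b + functional w c"
    unfolding functional_eq[OF S] functional_eq[of ?S b, OF S(1) Un_upper1]
      functional_eq[of ?S c, OF S(1) Un_upper2]
    by (simp add: distrib_right sum.distrib)
qed

lemma functional_fscale:
  assumes "finite {t. b t \<noteq> 0}"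
  shows "finite {t. fscale x b t \<noteq> 0}" "functional w (fscale x b) = x * functional w b"
proof -
  have S: "{t. fscale x b t \<noteq> 0} \<subseteq> {t. b t \<noteq> 0}" by (auto simp: fscale_def)
  show "finite {t. fscale x b t \<noteq> 0}" using S assms finite_subset by blast
  show "functional w (fscale x b) = x * functional w b"
    unfolding functional_eq[OF assms S] unfolding functional_def sum_distrib_left
    by (simp add: fscale_def mult.assoc)
qed

lemma functional_single:
  fixes w :: "monomial \<Rightarrow> 'k::field"
  shows "finite {s. single t s \<noteq> (0::'k)}" "functional w (single t) = w t"
proof -
  have S: "{s. single t s \<noteq> (0::'k)} \<subseteq> {t}" by (auto simp: single_def)
  show "finite {s. single t s \<noteq> (0::'k)}" using S finite_subset by blast
  show "functional w (single t) = w t"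
    unfolding functional_eq[OF finite.insertI[OF finite.emptyI] S] by (simp add: single_def)
qed

lemma functional_sum_list_single:
  fixes w :: "monomial \<Rightarrow> 'k::field"
  shows "finite {s. sum_list (map single ts) s \<noteq> (0::'k)}"
  "functional w (sum_list (map single ts)) = sum_list (map w ts)"
proof (induction ts)
  case Nil
  { case 1 show ?case by simp }
  { case 2 show ?case by (simp add: functional_def) }
next
  case (Cons t ts)
  { case 1
    show ?case using functional_add(1)[OF functional_single(1) Cons.IH(1)] by simp }
  { case 2
    show ?case
      unfolding list.map sum_list.Cons functional_add(2)[OF functional_single(1) Cons.IH(1)] Cons.IH(2)
        functional_single(2) .. }
qed

lemma functional_sum:
  fixes w :: "monomial \<Rightarrow> 'k::field"
  assumes "finite A"
  shows "finite {s. (\<Sum>u\<in>A. fscale (c u) (single (f u))) s \<noteq> (0::'k)}"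
    "functional w (\<Sum>u\<in>A. fscale (c u) (single (f u))) = (\<Sum>u\<in>A. c u * w (f u))"
  using assms
proof (induction A)
  case empty
  { case 1 show ?case by simp }
  { case 2 show ?case by (simp add: functional_def) }
next
  case (insert u A)
  note fin = functional_fscale(1)[OF functional_single(1), of "c u" "f u"]
  note eq = functional_fscale(2)[OF functional_single(1), of w "c u" "f u"]
  { case 1
    show ?case using functional_add(1)[OF fin insert.IH(1)] insert.hyps by simp }
  { case 2
    show ?case
      unfolding sum.insert[OF insert.hyps] functional_add(2)[OF fin insert.IH(1), of w] insert.IH(2) eq
      by (simp add: functional_single(2)) }
qed

lemma functional_diff:
  assumes "finite {t. b t \<noteq> 0}" "finite {t. c t \<noteq> 0}"
  shows "functional w (b - c) = functional w b - functional w c"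
proof -
  have m: "b - c = b + fscale (- 1) c" by (auto simp: fscale_def)
  show ?thesis
    unfolding m functional_add(2)[OF assms(1) functional_fscale(1)[OF assms(2), of "- 1"]]
      functional_fscale(2)[OF assms(2)]
    by simp
qed

lemma functional_comder_ideal:
  assumes "b \<in> comder_ideal n"
  shows "finite {t. b t \<noteq> 0} \<and> functional (mon_coef a) b = 0"
  using assms unfolding comder_ideal_def
proof (induction rule: fscale.span_induct_alt)
  case base
  show ?case by (simp add: functional_def)
next
  case (step c x b)
  then obtain t ts where x: "x = single t - sum_list (map single ts)" and rel: "comder_rel t ts" by auto
  have "x = single t + fscale (- 1) (sum_list (map single ts))"
    by (auto simp: x fscale_def fun_eq_iff)
  then have fin: "finite {t. x t \<noteq> 0}"
    using functional_add(1)[OF functional_single(1) functional_fscale(1)[OF functional_sum_list_single(1)]]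
    by metis
  have "functional (mon_coef a) x = 0"
    unfolding x functional_diff[OF functional_single(1) functional_sum_list_single(1)]
    by (simp add: functional_single(2) functional_sum_list_single(2) comder_rel_mon_coef[OF rel])
  with step.IH functional_add[OF functional_fscale(1)[OF fin, where x = c] conjunct1[OF step.IH]]
  show ?case by (simp only: functional_fscale(2)[OF fin]) simp
qed

section \<open>Falling factorials and linear independence of the basis of rNov\<close>

definition ffact :: "'k::field_char_0 \<Rightarrow> nat \<Rightarrow> 'k" where
  "ffact a p = (\<Prod>j<p. a - of_nat j)"

lemma mon_exp_atom: "mon_exp a ((Der ^^ p) (Inp i)) = a i - of_nat p"
  by (induction p) auto

lemma mon_coef_atom: "mon_coef a ((Der ^^ p) (Inp i)) = ffact (a i) p"
  by (induction p) (auto simp: ffact_def mon_exp_atom)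

lemma mon_exp_prd: "ts \<noteq> [] \<Longrightarrow> mon_exp a (prd ts) = sum_list (map (mon_exp a) ts)"
  by (induction ts rule: rev_nonempty_induct) (auto simp: prd_snoc)

lemma mon_coef_prd: "ts \<noteq> [] \<Longrightarrow> mon_coef a (prd ts) = prod_list (map (mon_coef a) ts)"
  by (induction ts rule: rev_nonempty_induct) (auto simp: prd_snoc)

lemma mon_exp_bas:
  assumes "p \<noteq> []"
  shows "mon_exp a (bas p) = (\<Sum>i<length p. a i) - of_nat (sum_list p)"
  using assms unfolding bas_eq_prd
  by (subst mon_exp_prd)
     (simp_all add: comp_def mon_exp_atom sum_list_distinct_conv_sum_set atLeast0LessThan
      sum_subtractf sum_list_sum_nth)

lemma mon_coef_bas:
  assumes "p \<noteq> []"
  shows "mon_coef a (bas p) = (\<Prod>i<length p. ffact (a i) (p ! i))"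
  using assms unfolding bas_eq_prd
  by (subst mon_coef_prd)
     (simp_all add: comp_def mon_coef_atom prod.distinct_set_conv_list[symmetric] atLeast0LessThan)

lemma mon_exp_plug: "mon_exp a (plug \<theta> t) = mon_exp (\<lambda>i. mon_exp a (\<theta> i)) t"
  by (induction t) auto

lemma mon_coef_plug:
  "mon_coef a (plug \<theta> t)
    = mon_coef (\<lambda>i. mon_exp a (\<theta> i)) t * prod_list (map (\<lambda>i. mon_coef a (\<theta> i)) (inputs t))"
  by (induction t) (auto simp: mon_exp_plug)

lemma inputs_plug: "inputs (plug \<theta> t) = concat (map (\<lambda>i. inputs (\<theta> i)) (inputs t))"
  by (induction t) auto

lemma ders_plug: "ders (plug \<theta> t) = ders t + sum_list (map (\<lambda>i. ders (\<theta> i)) (inputs t))"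
  by (induction t) auto

lemma P_nonempty: "p \<in> P n \<Longrightarrow> p \<noteq> []"
  by (auto simp: P_def)

lemma finite_P: "finite (P n)"
proof (rule finite_subset)
  show "P n \<subseteq> {p. set p \<subseteq> {..n} \<and> length p = n}"
    using member_le_sum_list by (fastforce simp: P_def)
qed (rule finite_lists_length_eq, simp)

text \<open>The scalar that \<open>bas p\<close> produces on powers of \<open>t\<close> with
  exponents \<open>as\<close>.\<close>

definition fall :: "nat list \<Rightarrow> 'k list \<Rightarrow> 'k::field_char_0" where
  "fall p as = (\<Prod>i<length p. ffact (as ! i) (p ! i))"

lemma fall_Cons: "fall (q # p) (a # as) = ffact a q * fall p as"
  unfolding fall_def by (simp del: prod.lessThan_Suc add: prod.lessThan_Suc_shift)

lemma ffact_of_nat_eq_0: "q < p \<Longrightarrow> ffact (of_nat q) p = 0"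
  by (auto simp: ffact_def)

lemma ffact_of_nat_self: "ffact (of_nat q) q \<noteq> 0"
  by (auto simp: ffact_def)

text \<open>Both lists have the same sum, so two different ones satisfy \<open>q ! i < p ! i\<close>
  for some \<open>i\<close>, and differentiating the power with exponent \<open>q ! i\<close> that
  many times gives zero.\<close>

lemma fall_diagonal:
  assumes "p \<in> P n" "q \<in> P n"
  shows "(fall p (map of_nat q) :: 'k::field_char_0) = 0 \<longleftrightarrow> p \<noteq> q"
proof
  have "fall q (map of_nat q) \<noteq> (0::'k)" by (simp add: fall_def ffact_of_nat_self)
  then show "fall p (map of_nat q) = (0::'k) \<Longrightarrow> p \<noteq> q" by auto
next
  assume "p \<noteq> q"
  have len: "length p = n" "length q = n" "sum_list p = sum_list q" using assms by (auto simp: P_def)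
  have "\<exists>i<n. q ! i < p ! i"
  proof (rule ccontr)
    assume "\<not> ?thesis"
    then have le: "p ! i \<le> q ! i" if "i < n" for i using that by (meson not_less)
    obtain j where j: "j < n" "p ! j \<noteq> q ! j" using \<open>p \<noteq> q\<close> len nth_equalityI by metis
    then have "(\<Sum>i<n. p ! i) < (\<Sum>i<n. q ! i)"
      using le[OF j(1)] by (intro sum_strict_mono_ex1) (auto intro!: le bexI[of _ j])
    then show False using len by (simp add: sum_list_sum_nth atLeast0LessThan)
  qed
  then obtain i where i: "i < n" "q ! i < p ! i" by auto
  then have "ffact (map of_nat q ! i) (p ! i) = (0::'k)"
    using len by (simp add: ffact_of_nat_eq_0)
  then show "fall p (map of_nat q) = (0::'k)"
    unfolding fall_def using i len by (intro prod_zero) auto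
qed

text \<open>Evaluation at the exponents \<open>q\<close> kills the ideal and every basis element
  except \<open>bas q\<close>.\<close>

lemma bas_independent:
  assumes "(\<Sum>u\<in>P n. fscale (c u) (single (bas u))) \<in> (comder_ideal n :: (_ \<Rightarrow> 'k::field_char_0) set)"
    and "q \<in> P n"
  shows "c q = 0"
proof -
  have "(\<Sum>u\<in>P n. c u * fall u (map of_nat q)) = (0::'k)"
  proof -
    have "mon_coef (\<lambda>i. map of_nat q ! i) (bas u) = (fall u (map of_nat q) :: 'k)" if "u \<in> P n" for u
      using that by (simp add: mon_coef_bas P_nonempty fall_def)
    then show ?thesis
      using functional_comder_ideal[OF assms(1), of "\<lambda>i. map of_nat q ! i"]
      by (simp add: functional_sum(2)[OF finite_P])
  qed
  also have "(\<Sum>u\<in>P n. c u * fall u (map of_nat q)) = (\<Sum>u\<in>P n. if u = q then c q * fall q (map of_nat q) else 0)"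
    using assms(2) fall_diagonal by (intro sum.cong) auto
  finally show ?thesis using fall_diagonal[OF assms(2,2), where 'k = 'k] assms(2) finite_P by (simp add: sum.delta)
qed

lemma sum_list_single_bas:
  assumes "set ps \<subseteq> P n"
  shows "sum_list (map single (map bas ps))
    = (\<Sum>u\<in>P n. fscale (of_nat (count_list ps u)) (single (bas u) :: _ \<Rightarrow> 'k::field))"
  using assms
proof (induction ps)
  case Nil
  show ?case by (simp add: fscale_def zero_fun_def)
next
  case (Cons p ps)
  have "(\<Sum>u\<in>P n. fscale (of_nat (count_list (p # ps) u)) (single (bas u) :: _ \<Rightarrow> 'k))
     = (\<Sum>u\<in>P n. (if u = p then single (bas p) else 0) + fscale (of_nat (count_list ps u)) (single (bas u)))"
    by (intro sum.cong) (auto simp: fscale_def algebra_simps fun_eq_iff)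
  then show ?case using Cons finite_P by (simp add: sum.distrib sum.delta)
qed

section \<open>Structure constants of rNov\<close>

definition block_start :: "nat list list \<Rightarrow> nat \<Rightarrow> nat" where
  "block_start qs i = (\<Sum>h<i. length (qs ! h))"

definition renumbered :: "nat list list \<Rightarrow> nat \<Rightarrow> monomial" where
  "renumbered qs i = plug (\<lambda>j. Inp (block_start qs i + j)) (bas (qs ! i))"

lemma graft_bas:
  assumes "p \<in> P (length qs)" "\<And>q. q \<in> set qs \<Longrightarrow> q \<in> P (length q)"
  shows "graft (bas p) (map bas qs) = plug (renumbered qs) (bas p)"
proof -
  have cong: "plug f t = plug g t" if "\<And>i. i \<in> set (inputs t) \<Longrightarrow> f i = g i" for f g t
    using that by (induction t) auto
  have nonempty: "qs ! i \<noteq> []" if "i < length qs" for i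
    using assms(2) that P_nonempty nth_mem by metis
  show ?thesis
    unfolding graft_def
  proof (rule cong)
    fix i assume "i \<in> set (inputs (bas p))"
    then have i: "i < length qs" using assms(1) by (auto simp: inputs_bas P_nonempty P_def)
    have "(\<Sum>h<i. length (inputs (map bas qs ! h))) = block_start qs i"
      unfolding block_start_def using i nonempty by (intro sum.cong) (auto simp: inputs_bas)
    then show "plug (\<lambda>j. Inp ((\<Sum>h<i. length (inputs (map bas qs ! h))) + j)) (map bas qs ! i) = renumbered qs i"
      using i by (simp add: renumbered_def)
  qed
qed

lemma inputs_renumbered:
  assumes "qs ! i \<noteq> []"
  shows "inputs (renumbered qs i) = [block_start qs i..<block_start qs (Suc i)]"
proof -
  have "concat (map (\<lambda>j. [c + j]) xs) = map (\<lambda>j. c + j) xs" for xs and c :: nat by (induction xs) auto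
  then show ?thesis
    using assms map_add_upt[of "block_start qs i" "length (qs ! i)"]
    by (simp add: renumbered_def inputs_plug inputs_bas block_start_def add.commute)
qed

text \<open>This is closure of \<open>rNov\<close> under composition: the outer operation has one
  derivation less than there are blocks, and each block one less than it has inputs.\<close>

lemma graft_bas_monomial:
  assumes p: "p \<in> P (length qs)" and qs: "\<And>q. q \<in> set qs \<Longrightarrow> q \<in> P (length q)"
  defines "N \<equiv> sum_list (map length qs)"
  shows "graft (bas p) (map bas qs) \<in> monomials N" "ders (graft (bas p) (map bas qs)) + 1 = N"
proof -
  have nonempty: "qs ! i \<noteq> []" if "i < length qs" for i
    using qs that P_nonempty nth_mem by metis
  have lenp: "length p = length qs" using p by (simp add: P_def)
  have N: "N = block_start qs (length qs)"
    by (simp add: N_def block_start_def sum_list_sum_nth atLeast0LessThan)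
  have "concat (map (\<lambda>i. inputs (renumbered qs i)) [0..<k]) = [0..<block_start qs k]"
    if "k \<le> length qs" for k
    using that
  proof (induction k)
    case (Suc k)
    have "block_start qs k \<le> block_start qs (Suc k)" by (simp add: block_start_def)
    with Suc nonempty show ?case
      using upt_add_eq_append[of 0 "block_start qs k" "block_start qs (Suc k) - block_start qs k"]
      by (simp add: inputs_renumbered)
  qed (simp add: block_start_def)
  then have "inputs (graft (bas p) (map bas qs)) = [0..<N]"
    by (simp add: graft_bas[OF p qs] inputs_plug inputs_bas P_nonempty[OF p] lenp N)
  then show "graft (bas p) (map bas qs) \<in> monomials N" by (simp add: monomials_iff)
  have "ders (graft (bas p) (map bas qs)) + 1 = sum_list p + (\<Sum>i<length qs. sum_list (qs ! i)) + 1"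
    using nonempty
    by (simp add: graft_bas[OF p qs] ders_plug ders_bas inputs_bas P_nonempty[OF p] renumbered_def lenp
       sum_list_distinct_conv_sum_set atLeast0LessThan)
  \<comment> \<open>The \<open>length qs\<close> units in \<open>sum_list p + 1\<close> are
    distributed, one to each block.\<close>
  also have "\<dots> = (\<Sum>i<length qs. sum_list (qs ! i) + 1)"
    using p by (simp only: P_def sum.distrib) simp
  also have "\<dots> = (\<Sum>i<length qs. length (qs ! i))"
    using qs nth_mem by (intro sum.cong) (auto simp: P_def)
  finally show "ders (graft (bas p) (map bas qs)) + 1 = N" by (simp add: N block_start_def)
qed

text \<open>Rewriting the composite yields an expansion and \<open>bas_independent\<close> makes it
  unique, so the definite description in \<open>struct_const\<close> denotes.\<close>

lemma struct_const_props:
  assumes p: "p \<in> P (length qs)" and qs: "\<And>q. q \<in> set qs \<Longrightarrow> q \<in> P (length q)"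
  defines "N \<equiv> sum_list (map length qs)"
  shows "(\<forall>u. u \<notin> P N \<longrightarrow> struct_const p qs u = (0::'k::field_char_0)) \<and>
    comder_eq N (single (graft (bas p) (map bas qs)))
      (\<Sum>u\<in>P N. fscale (struct_const p qs u :: 'k) (single (bas u)))"
    (is "?R (struct_const p qs)")
proof -
  have eq: "struct_const p qs = (THE c. ?R c)"
    by (simp add: struct_const_def N_def Let_def)
  obtain ps where ps: "set ps \<subseteq> P N" "expands [graft (bas p) (map bas qs)] (map bas ps)"
    using expands_bas graft_bas_monomial[OF p qs] unfolding N_def by blast
  \<comment> \<open>Rewriting may produce a basis element several times; its multiplicity is the
    coefficient.\<close>
  define c :: "nat list \<Rightarrow> 'k" where "c = (\<lambda>u. of_nat (count_list ps u))"
  have c: "?R c"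
  proof
    show "\<forall>u. u \<notin> P N \<longrightarrow> c u = 0" using ps(1) by (auto simp: c_def count_list_0_iff)
    show "comder_eq N (single (graft (bas p) (map bas qs))) (\<Sum>u\<in>P N. fscale (c u) (single (bas u)))"
      using expands_comder_eq[OF ps(2), of N] graft_bas_monomial(1)[OF p qs]
      unfolding c_def sum_list_single_bas[OF ps(1)] N_def by simp
  qed
  have "d = c" if d: "?R d" for d
  proof
    fix u
    let ?f = "\<lambda>c. \<Sum>u\<in>P N. fscale (c u) (single (bas u) :: _ \<Rightarrow> 'k)"
    have "?f d - ?f c \<in> comder_ideal N"
      using fscale.span_diff[OF conjunct2[OF c, unfolded comder_eq_def comder_ideal_def]
          conjunct2[OF d, unfolded comder_eq_def comder_ideal_def]]
      by (simp add: comder_ideal_def)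
    moreover have "?f d - ?f c = ?f (\<lambda>u. d u - c u)"
      by (simp add: sum_subtractf[symmetric] fscale.scale_left_diff_distrib)
    ultimately show "d u = c u"
      using bas_independent[of "\<lambda>u. d u - c u" N u] conjunct1[OF c] conjunct1[OF d]
      by (cases "u \<in> P N") simp_all
  qed
  then show ?thesis unfolding eq by (rule theI[of ?R, OF c])
qed

lemma length_blocks [simp]: "length (blocks ns xs) = length ns"
  by (induction ns arbitrary: xs) auto

lemma blocks_nth: "i < length ns \<Longrightarrow> blocks ns xs ! i = take (ns ! i) (drop (\<Sum>h<i. ns ! h) xs)"
proof (induction ns arbitrary: i xs)
  case (Cons n ns)
  then show ?case
    by (cases i) (auto simp del: sum.lessThan_Suc simp add: sum.lessThan_Suc_shift add.commute)
qed auto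

text \<open>Evaluation respects composition. Block \<open>i\<close> produces a power of
  \<open>t\<close> whose exponent is the sum of the exponents fed into it minus the number of
  derivations in \<open>qs ! i\<close>, and \<open>p\<close> is evaluated at these exponents. This
  stands in for explicit values of the structure constants.\<close>

lemma struct_const_fall:
  fixes as :: "'k::field_char_0 list"
  assumes p: "p \<in> P (length qs)" and qs: "\<And>q. q \<in> set qs \<Longrightarrow> q \<in> P (length q)"
    and as: "length as = sum_list (map length qs)"
  shows "(\<Sum>u\<in>P (length as). struct_const p qs u * fall u as)
    = fall p (map2 (\<lambda>q bs. sum_list bs - of_nat (sum_list q)) qs (blocks (map length qs) as))
      * prod_list (map2 fall qs (blocks (map length qs) as))"
proof -
  let ?N = "length as" and ?a = "(!) as"
  let ?bs = "blocks (map length qs) as"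
  have nonempty: "qs ! i \<noteq> []" if "i < length qs" for i
    using qs that P_nonempty nth_mem by metis
  have lenp: "length p = length qs" using p by (simp add: P_def)
  have len_le: "block_start qs (Suc i) \<le> ?N" if "i < length qs" for i
  proof -
    have "block_start qs (Suc i) \<le> block_start qs (length qs)"
      unfolding block_start_def using that by (intro sum_mono2) auto
    then show ?thesis by (simp add: as block_start_def sum_list_sum_nth atLeast0LessThan)
  qed
  have bs: "?bs ! i = take (length (qs ! i)) (drop (block_start qs i) as)" if "i < length qs" for i
    using that by (simp add: blocks_nth block_start_def)
  have bs_nth: "?bs ! i ! j = as ! (block_start qs i + j)" and bs_len: "length (?bs ! i) = length (qs ! i)"
    if "i < length qs" "j < length (qs ! i)" for i j
    using that len_le[OF that(1)] by (auto simp: bs block_start_def)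
  have exp: "mon_exp ?a (renumbered qs i) = sum_list (?bs ! i) - of_nat (sum_list (qs ! i))"
    if i: "i < length qs" for i
    using nonempty[OF i] bs_nth[OF i] bs_len[OF i, of 0]
    by (simp add: renumbered_def mon_exp_plug mon_exp_bas sum_list_sum_nth[of "?bs ! i"] atLeast0LessThan)
  have coef: "mon_coef ?a (renumbered qs i) = fall (qs ! i) (?bs ! i)"
    if i: "i < length qs" for i
    using nonempty[OF i] bs_nth[OF i]
    by (simp add: renumbered_def mon_coef_plug mon_coef_bas fall_def map_replicate_const)
  have "(\<Sum>u\<in>P ?N. struct_const p qs u * fall u as)
      = functional (mon_coef ?a) (\<Sum>u\<in>P ?N. fscale (struct_const p qs u) (single (bas u)))"
    unfolding functional_sum(2)[OF finite_P]
    by (intro sum.cong) (auto simp: mon_coef_bas P_nonempty fall_def)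
  also have "\<dots> = functional (mon_coef ?a) (single (graft (bas p) (map bas qs)))"
  proof -
    have "comder_eq ?N (single (graft (bas p) (map bas qs)))
        (\<Sum>u\<in>P ?N. fscale (struct_const p qs u :: 'k) (single (bas u)))"
      using struct_const_props[OF p qs, where 'k = 'k] as by simp
    then show ?thesis
      unfolding comder_eq_def
      by (auto dest!: functional_comder_ideal[of _ _ ?a]
          simp: functional_diff[OF functional_single(1) functional_sum(1)[OF finite_P]])
  qed
  also have "\<dots> = mon_coef ?a (plug (renumbered qs) (bas p))"
    by (simp add: functional_single(2) graft_bas[OF p qs])
  also have "\<dots> = (\<Prod>i<length qs. ffact (mon_exp ?a (renumbered qs i)) (p ! i))
      * (\<Prod>i<length qs. mon_coef ?a (renumbered qs i))"
    using P_nonempty[OF p]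
    by (simp add: mon_coef_plug mon_coef_bas inputs_bas lenp prod.distinct_set_conv_list[symmetric] atLeast0LessThan)
  also have "(\<Prod>i<length qs. ffact (mon_exp ?a (renumbered qs i)) (p ! i))
      = fall p (map2 (\<lambda>q bs. sum_list bs - of_nat (sum_list q)) qs ?bs)"
    unfolding fall_def lenp by (intro prod.cong) (auto simp: exp)
  also have "(\<Prod>i<length qs. mon_coef ?a (renumbered qs i)) = prod_list (map2 fall qs ?bs)"
  proof -
    have "map2 fall qs ?bs = map (\<lambda>i. fall (qs ! i) (?bs ! i)) [0..<length qs]"
      by (rule nth_equalityI) auto
    then show ?thesis
      by (simp add: prod.distinct_set_conv_list[symmetric] coef atLeast0LessThan)
  qed
  finally show ?thesis .
qed

section \<open>Alternating functions and the coboundary of a Leibniz representation\<close>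

text \<open>The sign \<open>(-1)^i\<close> in an abelian group without scalars.\<close>

definition alt_sign :: "nat \<Rightarrow> 'v::ab_group_add \<Rightarrow> 'v" where
  "alt_sign i v = (if even i then v else - v)"

lemma alt_sign_simps [simp]:
  "alt_sign 0 v = v" "alt_sign (Suc i) v = - alt_sign i v" "alt_sign i (- v) = - alt_sign i v"
  "alt_sign i (alt_sign i v) = v"
  by (auto simp: alt_sign_def)

definition remove_nth :: "nat \<Rightarrow> 'a list \<Rightarrow> 'a list" where
  "remove_nth i xs = take i xs @ drop (Suc i) xs"

lemma remove_nth_Cons [simp]:
  "remove_nth 0 (x # xs) = xs" "remove_nth (Suc i) (x # xs) = x # remove_nth i xs"
  by (auto simp: remove_nth_def)

lemma length_remove_nth: "i < length xs \<Longrightarrow> length (remove_nth i xs) = length xs - 1"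
  by (auto simp: remove_nth_def)

lemma nth_remove_nth:
  "i < length xs \<Longrightarrow> remove_nth i xs ! k = (if k < i then xs ! k else xs ! Suc k)"
  by (auto simp: remove_nth_def nth_append min_def)

text \<open>Swaps of neighbours generate all permutations, and the condition in this form passes at
  once to the function obtained by fixing the first argument.\<close>

definition alternating :: "('z list \<Rightarrow> 'v::ab_group_add) \<Rightarrow> bool" where
  "alternating w \<longleftrightarrow> (\<forall>us x y vs. w (us @ x # y # vs) = - w (us @ y # x # vs))"

lemma alternatingD: "alternating w \<Longrightarrow> w (us @ x # y # vs) = - w (us @ y # x # vs)"
  unfolding alternating_def by blast

lemma alternating_Cons: "alternating w \<Longrightarrow> alternating (\<lambda>ys. w (z # ys))"
  using alternatingD[of w "z # us" for us] unfolding alternating_def append_Cons by blast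

lemma alternating_move:
  "alternating w \<Longrightarrow> w (us @ y # vs @ ws) = alt_sign (length vs) (w (us @ vs @ y # ws))"
proof (induction vs arbitrary: us)
  case (Cons v vs)
  have "w (us @ y # (v # vs) @ ws) = - w ((us @ [v]) @ y # vs @ ws)"
    using alternatingD[OF Cons.prems, of us y v] by simp
  also have "\<dots> = - alt_sign (length vs) (w ((us @ [v]) @ vs @ y # ws))"
    using Cons by metis
  finally show ?case by simp
qed simp

lemma permute_list_transpose:
  assumes "i < length xs" "j < length xs"
  shows "permute_list (transpose i j) xs = xs[i := xs ! j, j := xs ! i]"
  using assms
  by (intro nth_equalityI) (auto simp: permute_list_def nth_list_update transpose_def)

text \<open>One entry is moved over the stretch between the two positions, exchanged with the other,
  and the other is moved back over the same stretch; the signs of the two moves cancel.\<close>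

lemma alternating_transpose:
  assumes w: "alternating w" and "i < length zs" "j < length zs" "i \<noteq> j"
  shows "w (permute_list (transpose i j) zs) = - w zs"
proof -
  have less: "w (permute_list (transpose i j) zs) = - w zs" if ij: "i < j" "j < length zs" for i j
  proof -
    define us vs ws where "us = take i zs" and "vs = take (j - Suc i) (drop (Suc i) zs)"
      and "ws = drop (Suc j) zs"
    have zs: "zs = us @ zs ! i # vs @ zs ! j # ws"
    proof -
      have "drop (Suc i) zs = vs @ zs ! j # ws"
        using id_take_nth_drop[of "j - Suc i" "drop (Suc i) zs"] ij by (simp add: vs_def ws_def)
      then show ?thesis using id_take_nth_drop[of i zs] ij by (simp add: us_def)
    qed
    have len: "length us = i" "length vs = j - Suc i" using ij by (auto simp: us_def vs_def)
    have "permute_list (transpose i j) zs = zs[i := zs ! j, j := zs ! i]"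
      using ij by (intro permute_list_transpose) auto
    also have "\<dots> = (us @ zs ! i # vs @ zs ! j # ws)[i := zs ! j, j := zs ! i]"
      using zs by simp
    also have "\<dots> = us @ zs ! j # vs @ zs ! i # ws"
      using len ij by (auto simp: list_update_append split: nat.split)
    finally have "w (permute_list (transpose i j) zs)
        = alt_sign (length vs) (w ((us @ vs) @ zs ! j # zs ! i # ws))"
      using alternating_move[OF w, of us "zs ! j" vs] by simp
    also have "\<dots> = - alt_sign (length vs) (w (us @ vs @ zs ! i # zs ! j # ws))"
      using alternatingD[OF w, of "us @ vs" "zs ! j" "zs ! i" ws] by simp
    also have "\<dots> = - w (us @ zs ! i # vs @ zs ! j # ws)"
      using alternating_move[OF w, of us "zs ! i" vs "zs ! j # ws"] by simp
    finally show ?thesis using zs by simp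
  qed
  show ?thesis
    using assms less[of i j] less[of j i] by (cases "i < j") (auto simp: transpose_commute)
qed

text \<open>A permutation that preserves the labelling \<open>g\<close> is a product of
  transpositions within level sets of \<open>g\<close>. A constant labelling gives the full
  symmetric group; an exponent list gives its stabilizer, the case met in
  \<open>Gamma_surj\<close>.\<close>

lemma antisymmetric_stabilizer:
  fixes f :: "'a list \<Rightarrow> 'v::ab_group_add"
  assumes swap: "\<And>i j xs. \<lbrakk>i < n; j < n; i \<noteq> j; g i = g j; length xs = n\<rbrakk>
      \<Longrightarrow> f (permute_list (transpose i j) xs) = - f xs"
    and "\<pi> permutes {..<n}" "\<And>i. g (\<pi> i) = g i" "length xs = n"
  shows "f (permute_list \<pi> xs) = (if evenperm \<pi> then f xs else - f xs)"
  using assms(2-)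
proof (induction "card {i. \<pi> i \<noteq> i}" arbitrary: \<pi> xs rule: less_induct)
  case less
  show ?case
  proof (cases "\<pi> = id")
    case True
    then show ?thesis by simp
  next
    case False
    then obtain i where i: "\<pi> i \<noteq> i" by (auto simp: fun_eq_iff)
    let ?t = "transpose i (\<pi> i)"
    \<comment> \<open>Composing with this transposition makes \<open>i\<close> a fixed point and
      moves no new point, so the number of moved points drops.\<close>
    define \<pi>' where "\<pi>' = ?t \<circ> \<pi>"
    have \<pi>: "\<pi> = ?t \<circ> \<pi>'" by (simp add: \<pi>'_def fun_eq_iff)
    have lt: "i < n" "\<pi> i < n"
      using less.prems(1) i by (metis lessThan_iff permutes_not_in permutes_in_image)+
    have t: "?t permutes {..<n}" using lt by (intro permutes_swap_id) auto
    have p': "\<pi>' permutes {..<n}"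
      unfolding \<pi>'_def using less.prems(1) t by (rule permutes_compose)
    have inj: "inj \<pi>" using less.prems(1) by (rule permutes_inj)
    have "{i. \<pi>' i \<noteq> i} \<subseteq> {i. \<pi> i \<noteq> i} - {i}"
      using inj i by (auto simp: \<pi>'_def transpose_def dest: injD split: if_splits)
    moreover have fin: "finite {i. \<pi> i \<noteq> i}"
    proof (rule finite_subset)
      show "{i. \<pi> i \<noteq> i} \<subseteq> {..<n}" using permutes_not_in[OF less.prems(1)] by blast
    qed simp
    ultimately have "card {i. \<pi>' i \<noteq> i} \<le> card ({i. \<pi> i \<noteq> i} - {i})"
      by (intro card_mono) auto
    also have "\<dots> < card {i. \<pi> i \<noteq> i}"
      using fin i by (intro card_Diff1_less) auto
    finally have c: "card {i. \<pi>' i \<noteq> i} < card {i. \<pi> i \<noteq> i}" .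
    have g': "g (\<pi>' k) = g k" for k
      using less.prems(2)[of k] less.prems(2)[of i] by (auto simp: \<pi>'_def transpose_def)
    have IH: "f (permute_list \<pi>' ys) = (if evenperm \<pi>' then f ys else - f ys)" if "length ys = n" for ys
      using less.hyps[OF c p' g' that] .
    have ev: "evenperm \<pi> \<longleftrightarrow> \<not> evenperm \<pi>'"
    proof -
      have "evenperm \<pi> = (evenperm ?t = evenperm \<pi>')"
        using evenperm_comp[OF permutation_swap_id, of \<pi>' i "\<pi> i"] p' permutation_permutes
          \<pi>[symmetric] by auto
      then show ?thesis using i evenperm_swap[of i "\<pi> i"] by auto
    qed
    have "permute_list \<pi> xs = permute_list \<pi>' (permute_list ?t xs)"
      by (subst \<pi>, rule permute_list_compose) (simp add: p' less.prems)
    then show ?thesis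
      using IH[of "permute_list ?t xs"] swap[of i "\<pi> i" xs] lt i less.prems ev by simp
  qed
qed

lemma alternating_permute:
  assumes "alternating w" "\<pi> permutes {..<length zs}"
  shows "w (permute_list \<pi> zs) = (if evenperm \<pi> then w zs else - w zs)"
  by (rule antisymmetric_stabilizer[where g = "\<lambda>_. ()" and n = "length zs"])
     (use assms in \<open>auto intro: alternating_transpose\<close>)

text \<open>The arguments will be homogeneous elements, which cannot be added. So \<open>br\<close>
  is a bare operation, and the axioms only speak of the module in which addition exists.\<close>

locale leibniz_representation =
  fixes br :: "'z \<Rightarrow> 'z \<Rightarrow> 'z" and ac :: "'z \<Rightarrow> 'v::ab_group_add \<Rightarrow> 'v"
  assumes ac_add: "ac z (u + v) = ac z u + ac z v"
    and ac_br: "ac (br x y) v = ac x (ac y v) - ac y (ac x v)"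
begin

lemma ac_0 [simp]: "ac z 0 = 0"
  using ac_add[of z 0 0] by simp

lemma ac_uminus [simp]: "ac z (- v) = - ac z v"
  using ac_add[of z v "- v"] by (simp add: eq_neg_iff_add_eq_0 add.commute)

lemma ac_diff: "ac z (u - v) = ac z u - ac z v"
  using ac_add[of z u "- v"] by simp

lemma ac_sum: "ac z (\<Sum>i\<in>A. f i) = (\<Sum>i\<in>A. ac z (f i))"
  by (induction A rule: infinite_finite_induct) (auto simp: ac_add)

definition lie :: "'z \<Rightarrow> ('z list \<Rightarrow> 'v) \<Rightarrow> 'z list \<Rightarrow> 'v" where
  "lie x w zs = ac x (w zs) - (\<Sum>i<length zs. w (zs[i := br x (zs ! i)]))"

text \<open>Cartan's formula read as a recursion on the argument list. No signs or index sets occur,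
  so identities become inductions on that list; \<open>coboundary_at_eq_sums\<close> recovers the
  alternating sums.\<close>

primrec coboundary_at :: "'z list \<Rightarrow> ('z list \<Rightarrow> 'v) \<Rightarrow> 'v" where
  "coboundary_at [] w = 0"
| "coboundary_at (z # zs) w = lie z w zs - coboundary_at zs (\<lambda>ys. w (z # ys))"

text \<open>The Jacobi identity after insertion into one argument of \<open>w\<close>: a difference
  of two elements of \<open>'z\<close> has no meaning by itself.\<close>

definition jacobi_compatible :: "('z list \<Rightarrow> 'v) \<Rightarrow> bool" where
  "jacobi_compatible w \<longleftrightarrow> (\<forall>us x y z vs. w (us @ br (br x y) z # vs)
    = w (us @ br x (br y z) # vs) - w (us @ br y (br x z) # vs))"

lemma jacobi_compatible_Cons: "jacobi_compatible w \<Longrightarrow> jacobi_compatible (\<lambda>ys. w (z # ys))"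
  unfolding jacobi_compatible_def by (metis append_Cons)

lemma jacobi_compatible_update:
  assumes "jacobi_compatible w" "i < length zs"
  shows "w (zs[i := br (br x y) z]) = w (zs[i := br x (br y z)]) - w (zs[i := br y (br x z)])"
  using assms by (simp add: upd_conv_take_nth_drop jacobi_compatible_def)

lemma lie_diff: "lie x (\<lambda>ys. v ys - w ys) zs = lie x v zs - lie x w zs"
  by (simp add: lie_def ac_diff sum_subtractf)

lemma lie_uminus: "lie x (\<lambda>ys. - w ys) zs = - lie x w zs"
  by (simp add: lie_def sum_negf)

lemma lie_Cons: "lie x w (z # zs) = lie x (\<lambda>ys. w (z # ys)) zs - w (br x z # zs)"
  by (simp add: lie_def sum.lessThan_Suc_shift del: sum.lessThan_Suc)

text \<open>In the commutator the terms acting on two different arguments cancel, since such actions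
  commute; those acting twice on the same argument combine by the Jacobi identity.\<close>

lemma lie_commutator:
  assumes w: "jacobi_compatible w"
  shows "lie (br x y) w zs = lie x (lie y w) zs - lie y (lie x w) zs"
proof -
  let ?n = "length zs"
  \<comment> \<open>\<open>T x y i j\<close> lets \<open>x\<close> act on argument \<open>i\<close>
    and then \<open>y\<close> on argument \<open>j\<close> of the updated list, so that
    \<open>i = j\<close> is the twofold action.\<close>
  define T where "T = (\<lambda>x y i j. w (zs[i := br x (zs ! i), j := br y (zs[i := br x (zs ! i)] ! j)]))"
  have lie_lie: "lie x (lie y w) zs = ac x (ac y (w zs)) - (\<Sum>i<?n. ac x (w (zs[i := br y (zs ! i)])))
     - (\<Sum>i<?n. ac y (w (zs[i := br x (zs ! i)]))) + (\<Sum>i<?n. \<Sum>j<?n. T x y i j)" for x y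
    by (simp add: lie_def ac_diff ac_sum sum_subtractf T_def)
  have "(\<Sum>i<?n. \<Sum>j<?n. T x y i j) - (\<Sum>i<?n. \<Sum>j<?n. T y x i j)
      = (\<Sum>i<?n. \<Sum>j<?n. T x y i j - T y x j i)"
    by (subst (2) sum.swap) (simp add: sum_subtractf)
  also have "\<dots> = (\<Sum>i<?n. \<Sum>j<?n. if i = j then T x y i i - T y x i i else 0)"
    by (intro sum.cong refl) (auto simp: T_def list_update_swap)
  also have "\<dots> = (\<Sum>i<?n. T x y i i - T y x i i)"
    by (intro sum.cong refl) (simp add: sum.delta)
  also have "\<dots> = - (\<Sum>i<?n. w (zs[i := br (br x y) (zs ! i)]))"
    unfolding sum_negf[symmetric]
    by (intro sum.cong) (simp_all add: T_def jacobi_compatible_update[OF w])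
  finally have "(\<Sum>i<?n. \<Sum>j<?n. T x y i j) - (\<Sum>i<?n. \<Sum>j<?n. T y x i j)
    = - (\<Sum>i<?n. w (zs[i := br (br x y) (zs ! i)]))" .
  then show ?thesis
    unfolding lie_lie lie_def[of "br x y"] ac_br by (simp add: algebra_simps)
qed

lemma coboundary_at_diff:
  "coboundary_at zs (\<lambda>ys. v ys - w ys) = coboundary_at zs v - coboundary_at zs w"
  by (induction zs arbitrary: v w) (auto simp: lie_diff)

lemma coboundary_at_uminus: "coboundary_at zs (\<lambda>ys. - w ys) = - coboundary_at zs w"
  using coboundary_at_diff[of zs "\<lambda>_. 0" w] coboundary_at_diff[of zs w w] by simp

text \<open>When \<open>x\<close> acts on the first argument \<open>z\<close>, coboundary terms of
  \<open>br x z\<close> appear; they match the commutator of the Lie derivatives along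
  \<open>x\<close> and \<open>z\<close>.\<close>

lemma coboundary_at_lie:
  "jacobi_compatible w \<Longrightarrow> coboundary_at zs (lie x w) = lie x (\<lambda>ys. coboundary_at ys w) zs"
proof (induction zs arbitrary: w)
  case Nil
  then show ?case by (simp add: lie_def)
next
  case (Cons z zs)
  show ?case
    by (simp add: lie_Cons lie_diff coboundary_at_diff lie_commutator[OF Cons.prems]
        Cons.IH[OF jacobi_compatible_Cons[OF Cons.prems]])
qed

lemma coboundary_at_coboundary_at:
  "jacobi_compatible w \<Longrightarrow> coboundary_at zs (\<lambda>ys. coboundary_at ys w) = 0"
proof (induction zs arbitrary: w)
  case (Cons z zs)
  show ?case
    by (simp add: coboundary_at_diff coboundary_at_lie[OF Cons.prems]
        Cons.IH[OF jacobi_compatible_Cons[OF Cons.prems]])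
qed simp

text \<open>Splitting off arguments by \<open>lie_Cons\<close> reduces to a swap of the first two.
  There the term with \<open>x\<close> acting on one of them is paired with the same term after the
  swap.\<close>

lemma alternating_lie: "alternating w \<Longrightarrow> alternating (lie x w)"
  unfolding alternating_def[of "lie x w"]
proof (intro allI)
  fix us y z vs
  assume "alternating w"
  then show "lie x w (us @ y # z # vs) = - lie x w (us @ z # y # vs)"
  proof (induction us arbitrary: w)
    case Nil
    note sw = alternatingD[OF Nil, of "[]", unfolded append_Nil]
    have "(\<lambda>ys. w (y # z # ys)) = (\<lambda>ys. - w (z # y # ys))" using sw[of y z] by auto
    then have "lie x (\<lambda>ys. w (y # z # ys)) vs = - lie x (\<lambda>ys. w (z # y # ys)) vs"
      using lie_uminus[of x "\<lambda>ys. w (z # y # ys)" vs] by simp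
    then show ?case using sw[of "br x y" z] sw[of y "br x z"] by (simp add: lie_Cons)
  next
    case (Cons u us)
    show ?case
      using Cons.IH[OF alternating_Cons[OF Cons.prems]] alternatingD[OF Cons.prems, of "br x u # us" y z vs]
      by (simp add: lie_Cons)
  qed
qed

definition skew_compatible :: "('z list \<Rightarrow> 'v) \<Rightarrow> bool" where
  "skew_compatible w \<longleftrightarrow> (\<forall>us x y vs. w (us @ br x y # vs) = - w (us @ br y x # vs))"

lemma skew_compatible_Cons: "skew_compatible w \<Longrightarrow> skew_compatible (\<lambda>ys. w (z # ys))"
  unfolding skew_compatible_def by (metis append_Cons)

text \<open>For a swap in front, unfolding the recursion twice gives two Lie terms that trade
  places, a bracket term that changes sign by antisymmetry of \<open>br\<close>, and a term with
  both arguments inserted that changes sign because \<open>w\<close> is alternating. A swap further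
  back follows by induction and \<open>alternating_lie\<close>.\<close>

lemma alternating_coboundary_at:
  "alternating w \<Longrightarrow> skew_compatible w \<Longrightarrow> alternating (\<lambda>zs. coboundary_at zs w)"
  unfolding alternating_def[of "\<lambda>zs. coboundary_at zs w"]
proof (intro allI)
  fix us y z vs
  assume "alternating w" "skew_compatible w"
  then show "coboundary_at (us @ y # z # vs) w = - coboundary_at (us @ z # y # vs) w"
  proof (induction us arbitrary: w)
    case Nil
    note sw = alternatingD[OF Nil(1), of "[]", unfolded append_Nil]
    have "w (br y z # vs) = - w (br z y # vs)"
      using Nil(2) unfolding skew_compatible_def by (metis append_Nil)
    moreover have "(\<lambda>ys. w (y # z # ys)) = (\<lambda>ys. - w (z # y # ys))" using sw[of y z] by auto
    then have "coboundary_at vs (\<lambda>ys. w (y # z # ys)) = - coboundary_at vs (\<lambda>ys. w (z # y # ys))"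
      using coboundary_at_uminus[of vs "\<lambda>ys. w (z # y # ys)"] by simp
    ultimately show ?case by (simp add: lie_Cons)
  next
    case (Cons u us)
    show ?case
      using Cons.IH[OF alternating_Cons[OF Cons.prems(1)] skew_compatible_Cons[OF Cons.prems(2)]]
        alternatingD[OF alternating_lie[OF Cons.prems(1)], of u us y z vs]
      by simp
  qed
qed

section \<open>Comparison with the explicit Chevalley--Eilenberg sums\<close>

definition action_sum :: "'z list \<Rightarrow> ('z list \<Rightarrow> 'v) \<Rightarrow> 'v" where
  "action_sum zs w = (\<Sum>i<length zs. alt_sign i (ac (zs ! i) (w (remove_nth i zs))))"

text \<open>Positions count from 0, and \<open>i + j + 1\<close> is the parity of the permutation
  that moves the entries at \<open>i < j\<close> to the front in this order.\<close>

definition bracket_sum :: "'z list \<Rightarrow> ('z list \<Rightarrow> 'v) \<Rightarrow> 'v" where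
  "bracket_sum zs w = (\<Sum>j<length zs. \<Sum>i<j.
     alt_sign (i + j + 1) (w (br (zs ! i) (zs ! j) # remove_nth i (remove_nth j zs))))"

lemma action_sum_Cons: "action_sum (z # zs) w = ac z (w zs) - action_sum zs (\<lambda>ys. w (z # ys))"
  by (simp add: action_sum_def sum.lessThan_Suc_shift sum_negf del: sum.lessThan_Suc)

text \<open>Pairs containing the new first argument give the action of \<open>z\<close> on each
  entry, as in \<open>lie\<close>. In all other pairs \<open>z\<close> stands right behind the
  bracket, and moving it to the front costs the minus sign of the recursive term.\<close>

lemma bracket_sum_Cons:
  assumes w: "alternating w"
  shows "bracket_sum (z # zs) w
    = (\<Sum>i<length zs. w (zs[i := br z (zs ! i)])) - bracket_sum zs (\<lambda>ys. w (z # ys))"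
proof -
  \<comment> \<open>The explicit sum writes the bracket first while \<open>lie\<close> leaves it in
    its place; the two differ by a move over \<open>i\<close> arguments.\<close>
  have upd: "w (zs[i := y]) = alt_sign i (w (y # remove_nth i zs))" if "i < length zs" for i y
    using that alternating_move[OF w, of "[]" y "take i zs"]
    by (simp add: upd_conv_take_nth_drop remove_nth_def)
  have swap: "w (x # z # ys) = - w (z # x # ys)" for x ys
    by (rule alternatingD[OF w, of "[]", unfolded append_Nil])
  let ?v = "\<lambda>i j. w (br (zs ! i) (zs ! j) # z # remove_nth i (remove_nth j zs))"
  have "bracket_sum (z # zs) w = (\<Sum>j<length zs. \<Sum>i<Suc j. alt_sign (i + Suc j + 1)
      (w (br ((z # zs) ! i) (zs ! j) # remove_nth i (z # remove_nth j zs))))"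
    unfolding bracket_sum_def length_Cons by (subst sum.lessThan_Suc_shift) simp
  also have "\<dots> = (\<Sum>j<length zs. w (zs[j := br z (zs ! j)]) + (\<Sum>i<j. alt_sign (i + j + 1) (?v i j)))"
    by (intro sum.cong refl, subst sum.lessThan_Suc_shift) (simp add: upd)
  finally show ?thesis by (simp add: swap sum.distrib sum_negf bracket_sum_def)
qed

lemma coboundary_at_eq_sums:
  "alternating w \<Longrightarrow> coboundary_at zs w = action_sum zs w - bracket_sum zs w"
proof (induction zs arbitrary: w)
  case Nil
  show ?case by (simp add: action_sum_def bracket_sum_def)
next
  case (Cons z zs)
  then show ?case
    by (simp add: action_sum_Cons bracket_sum_Cons alternating_Cons lie_def)
qed

end

section \<open>Sums over shuffles\<close>

text \<open>The values on the first \<open>m\<close> places determine the image of the remaining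
  ones as a set, and a set has only one increasing enumeration.\<close>

lemma permutes_eqI_shuffle:
  fixes m n :: nat
  assumes "\<pi> permutes {..<m + n}" "\<pi>' permutes {..<m + n}"
    and "strict_mono_on {m..<m + n} \<pi>" "strict_mono_on {m..<m + n} \<pi>'"
    and agree: "\<And>i. i < m \<Longrightarrow> \<pi> i = \<pi>' i"
  shows "\<pi> = \<pi>'"
proof -
  have img: "\<pi> ` {m..<m + n} = {..<m + n} - \<pi> ` {..<m}" if "\<pi> permutes {..<m + n}" for \<pi>
  proof -
    have "{m..<m + n} = {..<m + n} - {..<m}" by auto
    then have "\<pi> ` {m..<m + n} = \<pi> ` {..<m + n} - \<pi> ` {..<m}"
      using permutes_inj[OF that] by (simp only: image_set_diff)
    then show ?thesis using permutes_image[OF that] by simp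
  qed
  have sorted: "sorted (map \<pi> [m..<m + n])" if "strict_mono_on {m..<m + n} \<pi>" for \<pi> :: "nat \<Rightarrow> nat"
    using that by (auto simp: sorted_iff_nth_mono intro!: strict_mono_on_leD[OF that])
  have "map \<pi> [m..<m + n] = map \<pi>' [m..<m + n]"
  proof (rule sorted_distinct_set_unique)
    have "\<pi> ` {..<m} = \<pi>' ` {..<m}" using agree by auto
    then show "set (map \<pi> [m..<m + n]) = set (map \<pi>' [m..<m + n])"
      using img[OF assms(1)] img[OF assms(2)] by simp
  qed (use assms sorted in \<open>auto simp: distinct_map intro: inj_on_subset[OF permutes_inj]\<close>)
  then have "\<pi> i = \<pi>' i" if "i \<in> {m..<m + n}" for i using that by simp
  then show ?thesis
    using agree permutes_not_in[OF assms(1)] permutes_not_in[OF assms(2)]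
    by (metis atLeastLessThan_iff ext lessThan_iff not_less)
qed

text \<open>The cycles \<open>(0 \<mapsto> i \<mapsto> i - 1 \<mapsto> \<dots> \<mapsto> 1 \<mapsto> 0)\<close> and, shifted by one,
  \<open>(1 \<mapsto> i + 1 \<mapsto> i \<mapsto> \<dots> \<mapsto> 2 \<mapsto> 1)\<close>; they are the inverses of the shuffles that pull one
  argument to the front.\<close>

primrec to_front :: "nat \<Rightarrow> nat \<Rightarrow> nat" where
  "to_front 0 = id"
| "to_front (Suc i) = transpose i (Suc i) \<circ> to_front i"

primrec to_second :: "nat \<Rightarrow> nat \<Rightarrow> nat" where
  "to_second 0 = id"
| "to_second (Suc i) = transpose (Suc i) (Suc (Suc i)) \<circ> to_second i"

lemma to_front_apply: "to_front i k = (if k = 0 then i else if k \<le> i then k - 1 else k)"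
  by (induction i) (auto simp: transpose_def)

lemma to_second_apply:
  "to_second i k = (if k = 0 then 0 else if k = 1 then Suc i else if k \<le> Suc i then k - 1 else k)"
  by (induction i) (auto simp: transpose_def)

lemma to_front_permutes: "i < n \<Longrightarrow> to_front i permutes {..<n}"
  by (induction i) (auto intro!: permutes_compose permutes_swap_id permutes_id)

lemma to_second_permutes: "Suc i < n \<Longrightarrow> to_second i permutes {..<n}"
  by (induction i) (auto intro!: permutes_compose permutes_swap_id permutes_id)

lemma permutation_to_front: "permutation (to_front i)"
  using to_front_permutes[of i "Suc i"] permutation_permutes by blast

lemma permutation_to_second: "permutation (to_second i)"
  using to_second_permutes[of i "Suc (Suc i)"] permutation_permutes by blast

lemma evenperm_to_front: "evenperm (to_front i) = even i"
proof (induction i)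
  case (Suc i)
  then show ?case
    using evenperm_comp[OF permutation_swap_id permutation_to_front, of i "Suc i" i]
    by (simp add: evenperm_swap comp_def)
qed simp

lemma evenperm_to_second: "evenperm (to_second i) = even i"
proof (induction i)
  case (Suc i)
  then show ?case
    using evenperm_comp[OF permutation_swap_id permutation_to_second, of "Suc i" "Suc (Suc i)" i]
    by (simp add: evenperm_swap comp_def)
qed simp

lemma permute_list_to_front: "i < length xs \<Longrightarrow> permute_list (to_front i) xs = xs ! i # remove_nth i xs"
  by (rule nth_equalityI)
     (auto simp: permute_list_def to_front_apply nth_Cons nth_remove_nth length_remove_nth
       split: nat.split)

lemma permute_list_to_second:
  assumes "i < length xs"
  shows "permute_list (to_second i) (x # xs) = x # xs ! i # remove_nth i xs"
proof -
  have "permute_list (to_second i) (x # xs) = x # permute_list (to_front i) xs"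
    by (simp add: permute_list_def map_upt_Suc to_second_apply to_front_apply del: upt_Suc)
  with assms show ?thesis by (simp add: permute_list_to_front)
qed

definition sign_apply :: "(nat \<Rightarrow> nat) \<Rightarrow> 'v::ab_group_add \<Rightarrow> 'v" where
  "sign_apply \<sigma> v = (if evenperm \<sigma> then v else - v)"

text \<open>Both the action on maps and the shuffle condition refer to the inverse permutation, so
  it becomes the summation variable; the sign stays the same.\<close>

lemma sum_Sh_inv:
  "(\<Sum>\<sigma>\<in>Sh_inv m n. sign_apply \<sigma> (f (inv \<sigma>)))
    = (\<Sum>\<pi> | \<pi> permutes {..<m + n} \<and> strict_mono_on {..<m} \<pi> \<and> strict_mono_on {m..<m + n} \<pi>.
        sign_apply \<pi> (f \<pi>))"
proof (rule sum.reindex_bij_witness[of _ inv inv])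
  fix \<sigma> assume s: "\<sigma> \<in> Sh_inv m n"
  then have p: "\<sigma> permutes {..<m + n}" by (simp add: Sh_inv_def)
  then show "inv (inv \<sigma>) = \<sigma>" by (rule permutes_inv_inv)
  show "inv \<sigma> \<in> {\<pi>. \<pi> permutes {..<m + n} \<and> strict_mono_on {..<m} \<pi> \<and> strict_mono_on {m..<m + n} \<pi>}"
    using s permutes_inv[OF p] by (simp add: Sh_inv_def)
  have "permutation \<sigma>" using p permutation_permutes by blast
  then show "sign_apply (inv \<sigma>) (f (inv \<sigma>)) = sign_apply \<sigma> (f (inv \<sigma>))"
    by (simp add: sign_apply_def evenperm_inv)
next
  fix \<pi> assume s: "\<pi> \<in> {\<pi>. \<pi> permutes {..<m + n} \<and> strict_mono_on {..<m} \<pi> \<and> strict_mono_on {m..<m + n} \<pi>}"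
  then have p: "\<pi> permutes {..<m + n}" by simp
  then show "inv (inv \<pi>) = \<pi>" by (rule permutes_inv_inv)
  then show "inv \<pi> \<in> Sh_inv m n"
    using s permutes_inv[OF p] by (simp add: Sh_inv_def)
qed

text \<open>A permutation of this kind is determined by its value at 0, the position of the entry
  that is pulled to the front.\<close>

lemma sum_Sh_inv_1:
  assumes "length zs = Suc n"
  shows "(\<Sum>\<sigma>\<in>Sh_inv 1 n. sign_apply \<sigma> (f (permute_list (inv \<sigma>) zs)))
    = (\<Sum>i<Suc n. alt_sign i (f (zs ! i # remove_nth i zs)))"
  unfolding sum_Sh_inv[where f = "\<lambda>\<pi>. f (permute_list \<pi> zs)"]
proof (rule sum.reindex_bij_witness[of _ to_front "\<lambda>\<pi>. \<pi> 0"])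
  fix \<pi> assume "\<pi> \<in> {\<pi>. \<pi> permutes {..<1 + n} \<and> strict_mono_on {..<1} \<pi> \<and> strict_mono_on {1..<1 + n} \<pi>}"
  then have p: "\<pi> permutes {..<1 + n}" "strict_mono_on {1..<1 + n} \<pi>" by auto
  have lt: "\<pi> 0 < 1 + n" using p(1) by (metis lessThan_iff permutes_in_image zero_less_Suc plus_1_eq_Suc)
  then show "\<pi> 0 \<in> {..<Suc n}" by simp
  show eq: "to_front (\<pi> 0) = \<pi>"
    using p lt by (intro permutes_eqI_shuffle[of _ 1 n])
      (auto simp: to_front_apply to_front_permutes intro!: strict_mono_onI)
  show "alt_sign (\<pi> 0) (f (zs ! \<pi> 0 # remove_nth (\<pi> 0) zs)) = sign_apply \<pi> (f (permute_list \<pi> zs))"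
    by (subst (4 5) eq[symmetric])
       (use lt assms in \<open>simp add: sign_apply_def alt_sign_def evenperm_to_front permute_list_to_front\<close>)
next
  fix i assume "i \<in> {..<Suc n}"
  then show "to_front i \<in> {\<pi>. \<pi> permutes {..<1 + n} \<and> strict_mono_on {..<1} \<pi> \<and> strict_mono_on {1..<1 + n} \<pi>}"
    by (auto simp: to_front_apply to_front_permutes intro!: strict_mono_onI)
qed (simp add: to_front_apply)

text \<open>On lists the leftmost factor acts first: entry \<open>j\<close> is pulled to the front,
  entry \<open>i\<close> to second place, where \<open>i < j\<close> ensures that its index among
  the remaining entries is still \<open>i\<close>, and then the two are exchanged.\<close>

definition two_to_front :: "nat \<Rightarrow> nat \<Rightarrow> nat \<Rightarrow> nat" where
  "two_to_front i j = to_front j \<circ> (to_second i \<circ> transpose 0 1)"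

lemma two_to_front_apply:
  assumes "i < j"
  shows "two_to_front i j 0 = i" "two_to_front i j (Suc 0) = j"
    "1 < k \<Longrightarrow> two_to_front i j k = to_front j (to_second i k)"
  using assms by (auto simp: two_to_front_def to_front_apply to_second_apply)

lemma permute_list_two_to_front:
  assumes "i < j" "j < length xs"
  shows "permute_list (two_to_front i j) xs = xs ! i # xs ! j # remove_nth i (remove_nth j xs)"
proof -
  have s: "to_second i permutes {..<length xs}" using assms by (intro to_second_permutes) auto
  have t: "transpose 0 1 permutes {..<length xs}" using assms by (intro permutes_swap_id) auto
  have "permute_list (two_to_front i j) xs
      = permute_list (transpose 0 1) (permute_list (to_second i) (permute_list (to_front j) xs))"
    unfolding two_to_front_def using s t permutes_compose[OF t s] by (simp add: permute_list_compose)
  also have "\<dots> = permute_list (transpose 0 1) (xs ! j # xs ! i # remove_nth i (remove_nth j xs))"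
    using assms
    by (simp add: permute_list_to_front permute_list_to_second length_remove_nth nth_remove_nth)
  also have "\<dots> = xs ! i # xs ! j # remove_nth i (remove_nth j xs)"
    by (simp add: permute_list_def map_upt_Suc transpose_def map_nth del: upt_Suc)
  finally show ?thesis .
qed

lemma evenperm_two_to_front: "evenperm (two_to_front i j) = even (i + j + 1)"
  by (simp add: two_to_front_def evenperm_comp permutation_to_front permutation_to_second
      permutation_swap_id permutation_compose evenperm_to_front evenperm_to_second evenperm_swap) blast

lemma two_to_front_permutes:
  assumes "i < j" "j < n" 
  shows "two_to_front i j permutes {..<n}"
  unfolding two_to_front_def using assms
  by (intro permutes_compose to_front_permutes to_second_permutes permutes_swap_id) auto

lemma two_to_front_mono: "i < j \<Longrightarrow> strict_mono_on {2..<n} (two_to_front i j)"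
  by (rule strict_mono_onI) (auto simp: two_to_front_apply to_front_apply to_second_apply)

text \<open>The values at 0 and 1 determine such a permutation, and monotonicity on the first block
  orders them as \<open>i < j\<close>.\<close>

lemma sum_Sh_inv_2:
  assumes "length zs = Suc (Suc n)"
  shows "(\<Sum>\<sigma>\<in>Sh_inv 2 n. sign_apply \<sigma> (f (permute_list (inv \<sigma>) zs)))
    = (\<Sum>j<Suc (Suc n). \<Sum>i<j. alt_sign (i + j + 1) (f (zs ! i # zs ! j # remove_nth i (remove_nth j zs))))"
  unfolding sum_Sh_inv[where f = "\<lambda>\<pi>. f (permute_list \<pi> zs)"]
    sum.Sigma[OF finite_lessThan ballI[OF finite_lessThan]]
proof (rule sum.reindex_bij_witness[of _ "\<lambda>(j, i). two_to_front i j" "\<lambda>\<pi>. (\<pi> 1, \<pi> 0)"])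
  let ?A = "{\<pi>. \<pi> permutes {..<2 + n} \<and> strict_mono_on {..<2} \<pi> \<and> strict_mono_on {2..<2 + n} \<pi>}"
  fix \<pi> assume "\<pi> \<in> ?A"
  then have p: "\<pi> permutes {..<2 + n}" "strict_mono_on {..<2} \<pi>" "strict_mono_on {2..<2 + n} \<pi>" by auto
  have lt: "\<pi> 1 < 2 + n" using permutes_in_image[OF p(1), of 1] by simp
  have less: "\<pi> 0 < \<pi> 1" using p(2) by (auto dest: strict_mono_onD[of _ _ 0 1])
  show "(\<pi> 1, \<pi> 0) \<in> (SIGMA j:{..<Suc (Suc n)}. {..<j})" using lt less by simp
  have eq: "two_to_front (\<pi> 0) (\<pi> 1) = \<pi>"
  proof (rule permutes_eqI_shuffle[of _ 2 n])
    fix k :: nat assume "k < 2"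
    then consider "k = 0" | "k = 1" by linarith
    then show "two_to_front (\<pi> 0) (\<pi> 1) k = \<pi> k"
      using less by cases (simp_all add: two_to_front_apply)
  qed (use p lt less in \<open>simp_all add: two_to_front_permutes two_to_front_mono\<close>)
  then show "(case (\<pi> 1, \<pi> 0) of (j, i) \<Rightarrow> two_to_front i j) = \<pi>" by simp
  have "sign_apply \<pi> (f (permute_list \<pi> zs)) = sign_apply (two_to_front (\<pi> 0) (\<pi> 1))
      (f (permute_list (two_to_front (\<pi> 0) (\<pi> 1)) zs))"
    by (simp only: eq)
  then show "(case (\<pi> 1, \<pi> 0) of (j, i) \<Rightarrow>
      alt_sign (i + j + 1) (f (zs ! i # zs ! j # remove_nth i (remove_nth j zs))))
      = sign_apply \<pi> (f (permute_list \<pi> zs))"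
    using lt less assms
    by (simp add: sign_apply_def alt_sign_def evenperm_two_to_front permute_list_two_to_front)
next
  fix ji assume "ji \<in> (SIGMA j:{..<Suc (Suc n)}. {..<j})"
  then obtain i j where ji: "ji = (j, i)" "i < j" "j < 2 + n" by auto
  have "strict_mono_on {..<2} (two_to_front i j)"
  proof (rule strict_mono_onI)
    fix a b :: nat assume "a \<in> {..<2}" "b \<in> {..<2}" "a < b"
    then have "a = 0" "b = Suc 0" by auto
    then show "two_to_front i j a < two_to_front i j b" using ji by (simp add: two_to_front_apply)
  qed
  then show "(case ji of (j, i) \<Rightarrow> two_to_front i j)
      \<in> {\<pi>. \<pi> permutes {..<2 + n} \<and> strict_mono_on {..<2} \<pi> \<and> strict_mono_on {2..<2 + n} \<pi>}"
    using ji by (auto intro: two_to_front_permutes two_to_front_mono)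
  show "((case ji of (j, i) \<Rightarrow> two_to_front i j) 1, (case ji of (j, i) \<Rightarrow> two_to_front i j) 0) = ji"
    using ji by (simp add: two_to_front_apply)
qed

section \<open>Evaluation of the Chevalley--Eilenberg complex\<close>

lemma multilinear_mapsI:
  assumes "vector_space sG" "vector_space sM"
    and "\<And>xs. length xs \<noteq> n \<Longrightarrow> f xs = 0"
    and "\<And>us x y vs. length us + Suc (length vs) = n \<Longrightarrow>
      f (us @ (x + y) # vs) = f (us @ x # vs) + f (us @ y # vs)"
    and "\<And>us c x vs. length us + Suc (length vs) = n \<Longrightarrow> f (us @ sG c x # vs) = sM c (f (us @ x # vs))"
  shows "f \<in> multilinear_maps sG sM n"
  unfolding multilinear_maps_def Vector_Spaces.linear_iff
  using assms by (auto simp: upd_conv_take_nth_drop)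

lemma multilinear_maps_length: "f \<in> multilinear_maps sG sM n \<Longrightarrow> length xs \<noteq> n \<Longrightarrow> f xs = 0"
  by (simp add: multilinear_maps_def)

lemma multilinear_maps_linear:
  assumes "f \<in> multilinear_maps sG sM n" "length us + Suc (length vs) = n"
  shows "Vector_Spaces.linear sG sM (\<lambda>x. f (us @ x # vs))"
proof -
  have "Vector_Spaces.linear sG sM (\<lambda>x. f (xs[i := x]))" if "length xs = n" "i < n" for xs i
    using assms(1) that by (simp add: multilinear_maps_def)
  from this[of "us @ undefined # vs" "length us"] show ?thesis using assms(2) by simp
qed

text \<open>The equation covers lists of every length because all terms vanish at a wrong one; later
  rewriting can thus ignore lengths.\<close>

lemma multilinear_maps_add:
  assumes "f \<in> multilinear_maps sG sM n"
  shows "f (us @ (x + y) # vs) = f (us @ x # vs) + f (us @ y # vs)"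
  using multilinear_maps_linear[OF assms, of us vs] multilinear_maps_length[OF assms]
  by (cases "length us + Suc (length vs) = n") (auto simp: Vector_Spaces.linear_iff)

lemma multilinear_maps_scale:
  assumes "f \<in> multilinear_maps sG sM n" "vector_space sM"
  shows "f (us @ sG c x # vs) = sM c (f (us @ x # vs))"
proof -
  interpret vector_space sM by fact
  show ?thesis
    using multilinear_maps_linear[OF assms(1), of us vs] multilinear_maps_length[OF assms(1)]
    by (cases "length us + Suc (length vs) = n") (auto simp: Vector_Spaces.linear_iff)
qed

lemma multilinear_maps_diff:
  assumes "f \<in> multilinear_maps sG sM n"
  shows "f (us @ (x - y) # vs) = f (us @ x # vs) - f (us @ y # vs)"
  using multilinear_maps_add[OF assms, of us "x - y" y vs] by (simp add: algebra_simps)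

lemma sum_list_permute_list:
  "\<pi> permutes {..<length xs} \<Longrightarrow> sum_list (permute_list \<pi> xs) = (sum_list xs :: 'a::comm_monoid_add)"
  by (metis mset_permute_list sum_mset_sum_list)

lemma permute_list_permute_inv:
  assumes "\<pi> permutes {..<length xs}"
  shows "permute_list \<pi> (permute_list (inv \<pi>) xs) = xs" "permute_list (inv \<pi>) (permute_list \<pi> xs) = xs"
proof -
  have *: "inv \<pi> permutes {..<length xs}" using assms by (rule permutes_inv)
  show "permute_list \<pi> (permute_list (inv \<pi>) xs) = xs"
    using permute_list_compose[OF assms, of "inv \<pi>"] by (simp add: permutes_inv_o(2)[OF assms])
  show "permute_list (inv \<pi>) (permute_list \<pi> xs) = xs"
    using permute_list_compose[OF *, of \<pi>] by (simp add: permutes_inv_o(1)[OF assms])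
qed

lemma permute_list_in_P:
  assumes "\<pi> permutes {..<n}"
  shows "permute_list \<pi> p \<in> P n \<longleftrightarrow> p \<in> P n"
proof (cases "length p = n")
  case True
  with assms show ?thesis by (simp add: P_def sum_list_permute_list)
qed (simp add: P_def)

lemma fall_permute_list:
  assumes "\<pi> permutes {..<length p}" "length as = length p"
  shows "fall (permute_list \<pi> p) (permute_list \<pi> as) = fall p as"
  using prod.permute[OF assms(1), of "\<lambda>i. ffact (as ! i) (p ! i)"] assms
  by (simp add: fall_def permute_list_nth)

lemma P_1: "P 1 = {[0]}"
  by (auto simp: P_def length_Suc_conv)

lemma P_2: "P 2 = {[1, 0], [0, 1]}"
  by (auto simp: P_def numeral_2_eq_2 length_Suc_conv)

lemma fall_Nil [simp]: "fall [] as = 1"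
  by (simp add: fall_def)

lemma ffact_simps [simp]: "ffact a 0 = 1" "ffact a (Suc 0) = a"
  by (simp_all add: ffact_def)

lemma set_Cons_singleton: "set_Cons A {xs} = (\<lambda>x. x # xs) ` A"
  by (auto simp: set_Cons_def)

lemma listset_P_1: "listset (replicate m (P 1)) = {replicate m [0]}"
  by (induction m) (simp_all add: P_1 set_Cons_singleton del: One_nat_def)

lemma listset_P_2_1: "listset (map P (2 # replicate m 1)) = (\<lambda>q. q # replicate m [0]) ` P 2"
  by (simp add: listset_P_1 set_Cons_singleton del: One_nat_def)

lemma blocks_1: "length xs = m \<Longrightarrow> blocks (replicate m 1) xs = map (\<lambda>x. [x]) xs"
proof (induction m arbitrary: xs)
  case (Suc m)
  then show ?case by (cases xs) auto
qed simp

lemma id_op_single [simp]: "id_op [0] [x] = x"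
  by (simp add: id_op_def pure_tensor_def)

lemma map2_id_op:
  "length xs = m \<Longrightarrow> map2 (\<lambda>g ys. g ys) (replicate m (id_op [0])) (map (\<lambda>x. [x]) xs) = xs"
proof (induction m arbitrary: xs)
  case (Suc m)
  then show ?case by (cases xs) auto
qed simp

lemma struct_const_outside:
  assumes "p \<in> P (length qs)" "\<And>q. q \<in> set qs \<Longrightarrow> q \<in> P (length q)"
    and "u \<notin> P (sum_list (map length qs))"
  shows "struct_const p qs u = (0 :: 'k::field_char_0)"
  using struct_const_props[OF assms(1,2)] assms(3) by auto

context novikov_representation
begin

lemma om_linear:
  "om (x + y) z = om x z + om y z" "om x (y + z) = om x y + om x z"
  "om (sG c x) z = sG c (om x z)" "om x (sG c z) = sG c (om x z)"
  using om_bilinear by (auto simp: bilinear_map_def Vector_Spaces.linear_iff)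

lemma l_linear:
  "l (x + y) m = l x m + l y m" "l x (m + n) = l x m + l x n"
  "l (sG c x) m = sM c (l x m)" "l x (sM c m) = sM c (l x m)"
  using l_bilinear by (auto simp: bilinear_map_def Vector_Spaces.linear_iff)

lemma r_linear:
  "r (x + y) m = r x m + r y m" "r x (m + n) = r x m + r x n"
  "r (sG c x) m = sM c (r x m)" "r x (sM c m) = sM c (r x m)"
  using r_bilinear by (auto simp: bilinear_map_def Vector_Spaces.linear_iff)

lemma om_diff: "om (x - y) z = om x z - om y z" "om x (y - z) = om x y - om x z"
  using om_linear(1)[of "x - y" y z] om_linear(2)[of x "y - z" z] by (simp_all add: algebra_simps)

lemma l_diff: "l (x - y) m = l x m - l y m" "l x (m - n) = l x m - l x n"
  using l_linear(1)[of "x - y" y m] l_linear(2)[of x "m - n" n] by (simp_all add: algebra_simps)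

lemma r_diff: "r (x - y) m = r x m - r y m" "r x (m - n) = r x m - r x n"
  using r_linear(1)[of "x - y" y m] r_linear(2)[of x "m - n" n] by (simp_all add: algebra_simps)

text \<open>The pair \<open>(x, a)\<close> stands for \<open>x t\<^sup>a\<close>, and \<open>v :: 'k \<Rightarrow> 'm\<close> for the formal sum
  \<open>\<Sum>\<^sub>e v(e) t\<^sup>e\<close>.\<close>

fun lbr :: "'g \<times> 'k \<Rightarrow> 'g \<times> 'k \<Rightarrow> 'g \<times> 'k" where
  "lbr (x, a) (y, b) = (sG a (om x y) - sG b (om y x), a + b - 1)"

text \<open>On \<open>m t^c\<close> the element \<open>x t^a\<close> acts by
  \<open>(a l_x m - c r_x m) t^(a+c-1)\<close>, so the coefficient of \<open>t^e\<close> comes from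
  \<open>c = e - a + 1\<close>.\<close>

fun lac :: "'g \<times> 'k \<Rightarrow> ('k \<Rightarrow> 'm) \<Rightarrow> 'k \<Rightarrow> 'm" where
  "lac (x, a) v = (\<lambda>e. sM a (l x (v (e - a + 1))) - sM (e - a + 1) (r x (v (e - a + 1))))"

text \<open>The coefficient identity behind the commutator rule, with \<open>c\<close> the exponent
  at \<open>v\<close>. The representation axioms are solved for \<open>l (om x y) v\<close>,
  \<open>r (om x y) v\<close> and \<open>l y (l x v)\<close>; comparing scalar coefficients then
  suffices.\<close>

lemma lac_lbr_eq:
  fixes v :: 'm and a b c :: 'k
  shows "sM (a + b - 1) (l (sG a (om x y) - sG b (om y x)) v) - sM c (r (sG a (om x y) - sG b (om y x)) v)
    = (sM a (l x (sM b (l y v) - sM c (r y v))) - sM (c + b - 1) (r x (sM b (l y v) - sM c (r y v))))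
    - (sM b (l y (sM a (l x v) - sM c (r x v))) - sM (c + a - 1) (r y (sM a (l x v) - sM c (r x v))))"
proof -
  have 1: "l (om x y) v = r y (l x v)" "l (om y x) v = r x (l y v)" by (rule rep3)+
  have 2: "r (om x y) v = l x (r y v) - r y (l x v) + r x (r y v)"
    using rep2[of x y v] rep4[of x y v] by (simp add: algebra_simps)
  have 3: "r (om y x) v = l y (r x v) - r x (l y v) + r x (r y v)"
    using rep2[of y x v] by (simp add: algebra_simps)
  have 4: "l y (l x v) = l x (l y v) - r y (l x v) + r x (l y v)"
    using rep1[of x y v] 1 by (simp add: algebra_simps)
  show ?thesis
    unfolding l_diff r_diff l_linear r_linear 1 2 3 4 rep4[of y x]
    by (simp add: M.scale_right_diff_distrib M.scale_left_diff_distrib M.scale_right_distrib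
        M.scale_left_distrib algebra_simps)
qed

sublocale leibniz_representation lbr lac
proof
  show "lac z (u + v) = lac z u + lac z v" for z u v
    by (cases z) (simp add: fun_eq_iff l_linear r_linear M.scale_right_distrib)
  show "lac (lbr x y) v = lac x (lac y v) - lac y (lac x v)" for x y v
  proof (cases x, cases y)
    fix x' a y' b assume xy: "x = (x', a)" "y = (y', b)"
    show ?thesis
    proof
      fix e
      \<comment> \<open>Each action adds its own exponent and subtracts 1, so the component at
        \<open>e\<close> comes from the component of \<open>v\<close> at
        \<open>e - a - b + 2\<close>.\<close>
      have e: "e - (a + b - 1) + 1 = e - a - b + 2" "e - a + 1 - b + 1 = e - a - b + 2"
        "e - b + 1 - a + 1 = e - a - b + 2" "e - a + 1 = (e - a - b + 2) + b - 1"
        "e - b + 1 = (e - a - b + 2) + a - 1"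
        by (simp_all add: algebra_simps)
      show "lac (lbr x y) v e = (lac x (lac y v) - lac y (lac x v)) e"
        using lac_lbr_eq[of a b x' y' "v (e - a - b + 2)" "e - a - b + 2"]
        unfolding xy lbr.simps lac.simps fun_diff_def e(1-3) unfolding e(4,5) .
    qed
  qed
qed

text \<open>The first component of the Jacobi identity for \<open>lbr\<close>. It is the
  Balinskii--Novikov observation that a Novikov algebra tensored with powers of \<open>t\<close>
  becomes a Lie algebra, here with exponents in the field.\<close>

lemma jacobi_eq:
  fixes a b c :: 'k
  shows "sG (a + b - 1) (om (sG a (om x y) - sG b (om y x)) z) - sG c (om z (sG a (om x y) - sG b (om y x)))
    = (sG a (om x (sG b (om y z) - sG c (om z y))) - sG (b + c - 1) (om (sG b (om y z) - sG c (om z y)) x))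
    - (sG b (om y (sG a (om x z) - sG c (om z x))) - sG (a + c - 1) (om (sG a (om x z) - sG c (om z x)) y))"
proof -
  have 1: "om (om x z) y = om (om x y) z" "om (om y z) x = om (om y x) z" "om (om z y) x = om (om z x) y"
    by (rule right_commutative)+
  have 2: "om x (om y z) = om (om x y) z - om (om y x) z + om y (om x z)"
    using left_symmetric[of x y z] by (simp add: algebra_simps)
  have 3: "om x (om z y) = om (om x y) z - om (om z x) y + om z (om x y)"
    using left_symmetric[of x z y] right_commutative[of x z y] by (simp add: algebra_simps)
  have 4: "om y (om z x) = om (om y x) z - om (om z x) y + om z (om y x)"
    using left_symmetric[of y z x] right_commutative[of y z x] right_commutative[of z y x]
    by (simp add: algebra_simps)
  show ?thesis
    unfolding om_diff om_linear 1 2 3 4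
    by (simp add: scale_right_diff_distrib scale_left_diff_distrib scale_right_distrib
        scale_left_distrib algebra_simps)
qed

text \<open>All elements of \<open>P n\<close> have \<open>n - 1\<close> derivations, so the value
  sits in one degree: the sum of the exponents minus \<open>n - 1\<close>. The condition on
  \<open>e\<close> states this without truncated subtraction.\<close>

definition ev :: "nat \<Rightarrow> (nat list \<Rightarrow> 'g list \<Rightarrow> 'm) \<Rightarrow> ('g \<times> 'k) list \<Rightarrow> 'k \<Rightarrow> 'm" where
  "ev n F zs = (\<lambda>e. if e + of_nat n = sum_list (map snd zs) + 1
     then \<Sum>p\<in>P n. sM (fall p (map snd zs)) (F p (map fst zs)) else 0)"

lemma rNov_tensorD: "F \<in> rNov_tensor sG sM n \<Longrightarrow> p \<in> P n \<Longrightarrow> F p \<in> multilinear_maps sG sM n"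
  by (simp add: rNov_tensor_def)

lemma ev_length:
  assumes "F \<in> rNov_tensor sG sM n" "length zs \<noteq> n"
  shows "ev n F zs = 0"
  using assms multilinear_maps_length[OF rNov_tensorD[OF assms(1)], of _ "map fst zs"]
  by (auto simp: ev_def fun_eq_iff)

lemma ev_slot_diff:
  assumes "F \<in> rNov_tensor sG sM n"
  shows "ev n F (us @ (x - y, a) # vs) = ev n F (us @ (x, a) # vs) - ev n F (us @ (y, a) # vs)"
  using multilinear_maps_diff[OF rNov_tensorD[OF assms]]
  by (auto simp: ev_def fun_eq_iff sum_subtractf M.scale_right_diff_distrib)

text \<open>The three double brackets share the exponent \<open>a + b + c - 2\<close>, so the
  identity takes place in first components, where it is \<open>jacobi_eq\<close>.\<close>

lemma ev_jacobi_compatible: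
  assumes F: "F \<in> rNov_tensor sG sM n"
  shows "jacobi_compatible (ev n F)"
  unfolding jacobi_compatible_def
proof (intro allI)
  fix us vs and x y z :: "'g \<times> 'k"
  obtain x' a y' b z' c where xyz: "x = (x', a)" "y = (y', b)" "z = (z', c)"
    by (cases x, cases y, cases z) auto
  have e: "a + b - 1 + c - 1 = a + b + c - 2" "a + (b + c - 1) - 1 = a + b + c - 2"
    "b + (a + c - 1) - 1 = a + b + c - 2"
    by (simp_all add: algebra_simps)
  show "ev n F (us @ lbr (lbr x y) z # vs)
      = ev n F (us @ lbr x (lbr y z) # vs) - ev n F (us @ lbr y (lbr x z) # vs)"
    unfolding xyz lbr.simps e ev_slot_diff[OF F, symmetric] jacobi_eq ..
qed

lemma ev_skew_compatible:
  assumes F: "F \<in> rNov_tensor sG sM n"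
  shows "skew_compatible (ev n F)"
  unfolding skew_compatible_def
proof (intro allI)
  fix us vs and x y :: "'g \<times> 'k"
  obtain x' a y' b where xy: "x = (x', a)" "y = (y', b)" by (cases x, cases y) auto
  have e: "b + a - 1 = a + b - 1" by simp
  show "ev n F (us @ lbr x y # vs) = - ev n F (us @ lbr y x # vs)"
    unfolding xy lbr.simps e ev_slot_diff[OF F] by simp
qed

text \<open>At exponents equal to \<open>q\<close> all components except the one at \<open>q\<close>
  drop out by \<open>fall_diagonal\<close>. Equations between operations can therefore be checked on
  evaluations.\<close>

lemma ev_inject:
  assumes F: "F \<in> rNov_tensor sG sM n" and G: "G \<in> rNov_tensor sG sM n"
    and eq: "\<And>zs. length zs = n \<Longrightarrow> ev n F zs = ev n G zs"
  shows "F = G"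
proof (intro ext)
  fix q xs
  show "F q xs = G q xs"
  proof (cases "q \<in> P n \<and> length xs = n")
    case False
    then show ?thesis
      using F G multilinear_maps_length[OF rNov_tensorD[OF F]] multilinear_maps_length[OF rNov_tensorD[OF G]]
      by (cases "q \<in> P n") (auto simp: rNov_tensor_def)
  next
    case True
    define as :: "'k list" where "as = map of_nat q"
    define zs where "zs = zip xs as"
    have len: "length q = n" using True by (simp add: P_def)
    then have zs: "map fst zs = xs" "map snd zs = as" "length zs = n"
      using True by (simp_all add: zs_def as_def)
    \<comment> \<open>The degree chosen here is the only one in which the value can be
      nonzero.\<close>
    have "ev n H zs (sum_list as + 1 - of_nat n) = sM (fall q as) (H q xs)" for H
    proof -
      have "ev n H zs (sum_list as + 1 - of_nat n) = (\<Sum>p\<in>P n. sM (fall p as) (H p xs))"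
        by (simp add: ev_def zs)
      also have "\<dots> = (\<Sum>p\<in>P n. if p = q then sM (fall q as) (H q xs) else 0)"
        using True fall_diagonal[of _ n q, where 'k = 'k] by (intro sum.cong) (auto simp: as_def)
      finally show ?thesis using True finite_P by simp
    qed
    then have "sM (fall q as) (F q xs) = sM (fall q as) (G q xs)" using eq[OF zs(3)] by metis
    moreover have "fall q as \<noteq> 0"
      using True fall_diagonal[of q n q, where 'k = 'k] by (auto simp: as_def)
    ultimately show ?thesis by simp
  qed
qed

lemma ev_tscale: "ev n (tscale sM c F) zs = (\<lambda>e. sM c (ev n F zs e))"
  by (auto simp: ev_def tscale_def fun_eq_iff M.scale_sum_right mult.commute)

lemma ev_sign: "ev n (tscale sM (of_int (sign \<sigma>)) F) zs = sign_apply \<sigma> (ev n F zs)"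
  by (auto simp: ev_tscale sign_apply_def sign_def fun_eq_iff)

lemma ev_diff: "ev n (F - G) zs = ev n F zs - ev n G zs"
  by (auto simp: ev_def fun_eq_iff M.scale_right_diff_distrib sum_subtractf)

lemma ev_sum: "ev n (\<Sum>i\<in>A. F i) zs = (\<Sum>i\<in>A. ev n (F i) zs)"
proof (induction A rule: infinite_finite_induct)
  case (insert i A)
  have "ev n (F i + (\<Sum>i\<in>A. F i)) zs = ev n (F i) zs + ev n (\<Sum>i\<in>A. F i) zs"
    by (auto simp: ev_def fun_eq_iff M.scale_right_distrib sum.distrib)
  then show ?case unfolding sum.insert[OF insert.hyps] insert.IH .
qed (auto simp: ev_def fun_eq_iff)

text \<open>Since \<open>fall\<close> is unchanged when both its lists are permuted alike, the
  permutation of basis labels is absorbed by reindexing the sum over \<open>P n\<close>, and only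
  that of the arguments remains.\<close>

lemma ev_act:
  assumes \<sigma>: "\<sigma> permutes {..<n}" and zs: "length zs = n"
  shows "ev n (act \<sigma> F) zs = ev n F (permute_list (inv \<sigma>) zs)"
proof -
  have inv: "inv \<sigma> permutes {..<n}" using \<sigma> by (rule permutes_inv)
  have m: "map fst (permute_list (inv \<sigma>) zs) = permute_list (inv \<sigma>) (map fst zs)"
    "map snd (permute_list (inv \<sigma>) zs) = permute_list (inv \<sigma>) (map snd zs)"
    using inv zs by (simp_all add: permute_list_map)
  have "(\<Sum>p\<in>P n. sM (fall p (map snd zs)) (act \<sigma> F p (map fst zs)))
    = (\<Sum>p\<in>P n. sM (fall p (permute_list (inv \<sigma>) (map snd zs))) (F p (permute_list (inv \<sigma>) (map fst zs))))"
  proof (rule sum.reindex_bij_witness[of _ "permute_list \<sigma>" "permute_list (inv \<sigma>)"])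
    fix p assume "p \<in> P n"
    then have len: "length p = n" by (simp add: P_def)
    show "permute_list \<sigma> (permute_list (inv \<sigma>) p) = p" "permute_list (inv \<sigma>) (permute_list \<sigma> p) = p"
      using permute_list_permute_inv[of \<sigma> p] \<sigma> len by auto
    show "permute_list (inv \<sigma>) p \<in> P n" "permute_list \<sigma> p \<in> P n"
      using \<open>p \<in> P n\<close> permute_list_in_P \<sigma> inv by blast+
    show "sM (fall (permute_list (inv \<sigma>) p) (permute_list (inv \<sigma>) (map snd zs)))
        (F (permute_list (inv \<sigma>) p) (permute_list (inv \<sigma>) (map fst zs)))
      = sM (fall p (map snd zs)) (act \<sigma> F p (map fst zs))"
      using inv len zs by (simp add: fall_permute_list act_def hom_act_def)
  qed
  then show ?thesis
    using inv zs by (simp add: ev_def m sum_list_permute_list cong: if_cong)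
qed


section \<open>Closure properties of multilinear maps and of rNov tensors\<close>

lemma multilinear_mapsI':
  assumes "\<And>xs. length xs \<noteq> n \<Longrightarrow> f xs = 0"
    and "\<And>us x y vs. length us + Suc (length vs) = n \<Longrightarrow>
      f (us @ (x + y) # vs) = f (us @ x # vs) + f (us @ y # vs)"
    and "\<And>us c x vs. length us + Suc (length vs) = n \<Longrightarrow> f (us @ sG c x # vs) = sM c (f (us @ x # vs))"
  shows "f \<in> multilinear_maps sG sM n"
  by (rule multilinear_mapsI[OF vector_space_axioms M.vector_space_axioms assms])

lemma multilinear_maps_0: "(\<lambda>_. 0) \<in> multilinear_maps sG sM n"
  by (rule multilinear_mapsI') auto

lemma multilinear_maps_plus:
  assumes "f \<in> multilinear_maps sG sM n" "g \<in> multilinear_maps sG sM n"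
  shows "(\<lambda>xs. f xs + g xs) \<in> multilinear_maps sG sM n"
  by (rule multilinear_mapsI')
     (simp_all add: multilinear_maps_length[OF assms(1)] multilinear_maps_length[OF assms(2)]
      multilinear_maps_add[OF assms(1)] multilinear_maps_add[OF assms(2)]
      multilinear_maps_scale[OF assms(1) M.vector_space_axioms]
      multilinear_maps_scale[OF assms(2) M.vector_space_axioms] M.scale_right_distrib)

lemma multilinear_maps_smult:
  assumes "f \<in> multilinear_maps sG sM n"
  shows "(\<lambda>xs. sM c (f xs)) \<in> multilinear_maps sG sM n"
  by (rule multilinear_mapsI')
     (simp_all add: multilinear_maps_length[OF assms(1)] multilinear_maps_add[OF assms(1)]
      multilinear_maps_scale[OF assms(1) M.vector_space_axioms] M.scale_right_distrib mult.commute)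

lemma multilinear_maps_sum:
  assumes "\<And>i. i \<in> A \<Longrightarrow> f i \<in> multilinear_maps sG sM n"
  shows "(\<lambda>xs. \<Sum>i\<in>A. f i xs) \<in> multilinear_maps sG sM n"
  using assms
  by (induction A rule: infinite_finite_induct) (auto simp: multilinear_maps_0 multilinear_maps_plus)

lemma multilinear_maps_permute:
  assumes f: "f \<in> multilinear_maps sG sM n" and \<pi>: "\<pi> permutes {..<n}"
  shows "(\<lambda>xs. f (permute_list \<pi> xs)) \<in> multilinear_maps sG sM n"
proof -
  have "Vector_Spaces.linear sG sM (\<lambda>x. f (permute_list \<pi> (xs[i := x])))"
    if "length xs = n" "i < n" for xs i
  proof -
    have "inv \<pi> i < n" using permutes_in_image[OF permutes_inv[OF \<pi>], of i] that by simp
    moreover have "inv \<pi> i = j \<longleftrightarrow> \<pi> j = i" for j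
      using permutes_inverses[OF \<pi>] by metis
    then have "permute_list \<pi> (xs[i := x]) = (permute_list \<pi> xs)[inv \<pi> i := x]" for x
      using that permutes_inverses[OF \<pi>]
      by (intro nth_equalityI) (auto simp: permute_list_def nth_list_update)
    ultimately show ?thesis using f that by (simp add: multilinear_maps_def)
  qed
  then show ?thesis using f by (simp add: multilinear_maps_def)
qed

lemma rNov_tensor_tscale: "F \<in> rNov_tensor sG sM n \<Longrightarrow> tscale sM c F \<in> rNov_tensor sG sM n"
  by (auto simp: rNov_tensor_def tscale_def multilinear_maps_smult)

lemma rNov_tensor_add:
  "F \<in> rNov_tensor sG sM n \<Longrightarrow> G \<in> rNov_tensor sG sM n \<Longrightarrow> F + G \<in> rNov_tensor sG sM n"
  by (auto simp: rNov_tensor_def multilinear_maps_plus plus_fun_def)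

lemma rNov_tensor_diff:
  assumes "F \<in> rNov_tensor sG sM n" "G \<in> rNov_tensor sG sM n"
  shows "F - G \<in> rNov_tensor sG sM n"
proof -
  have "F - G = F + tscale sM (- 1) G" by (auto simp: tscale_def fun_eq_iff)
  then show ?thesis using assms rNov_tensor_add rNov_tensor_tscale by metis
qed

lemma rNov_tensor_0: "0 \<in> rNov_tensor sG sM n"
  by (auto simp: rNov_tensor_def multilinear_maps_0 zero_fun_def)

lemma rNov_tensor_sum:
  "(\<And>i. i \<in> A \<Longrightarrow> F i \<in> rNov_tensor sG sM n) \<Longrightarrow> (\<Sum>i\<in>A. F i) \<in> rNov_tensor sG sM n"
  by (induction A rule: infinite_finite_induct)
     (simp_all only: sum.infinite sum.empty sum.insert rNov_tensor_0 rNov_tensor_add insert_iff simp_thms)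

lemma rNov_tensor_act:
  assumes F: "F \<in> rNov_tensor sG sM n" and \<sigma>: "\<sigma> permutes {..<n}"
  shows "act \<sigma> F \<in> rNov_tensor sG sM n"
proof -
  have inv: "inv \<sigma> permutes {..<n}" using \<sigma> by (rule permutes_inv)
  have "act \<sigma> F p \<in> multilinear_maps sG sM n" if "p \<in> P n" for p
    unfolding act_def hom_act_def
    using F that permute_list_in_P[OF inv]
    by (intro multilinear_maps_permute[OF _ inv]) (simp add: rNov_tensor_def)
  moreover have "act \<sigma> F p = 0" if "p \<notin> P n" for p
    using F that permute_list_in_P[OF inv] by (auto simp: act_def hom_act_def rNov_tensor_def)
  ultimately show ?thesis by (simp add: rNov_tensor_def)
qed

section \<open>The two composites of the differential and their evaluations\<close>

abbreviation action_op :: "nat \<Rightarrow> (nat list \<Rightarrow> 'g list \<Rightarrow> 'm) \<Rightarrow> nat list \<Rightarrow> 'g list \<Rightarrow> 'm" where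
  "action_op n F \<equiv> tcomp2 sM 1 n (rho l r) id_op F"

abbreviation bracket_op :: "nat \<Rightarrow> (nat list \<Rightarrow> 'g list \<Rightarrow> 'm) \<Rightarrow> nat list \<Rightarrow> 'g list \<Rightarrow> 'm" where
  "bracket_op n F \<equiv> tcomp sM (2 # replicate (n - 1) 1) F (alpha om # replicate (n - 1) id_op)"

lemma rho_simps: "rho l r [1, 0] = l" "rho l r [0, 1] x m = - r x m"
  by (simp_all add: rho_def pure_tensor_def fun_diff_def)

lemma action_op_apply:
  "action_op n F u xs = (\<Sum>q\<in>P n. if length xs = Suc n
     then sM (struct_const [1, 0] [[0], q] u) (l (hd xs) (F q (tl xs)))
        - sM (struct_const [0, 1] [[0], q] u) (r (hd xs) (F q (tl xs))) else 0)"
proof (cases "length xs = Suc n")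
  case True
  then show ?thesis
    by (cases xs)
       (simp_all add: tcomp2_def P_1[simplified] P_2 hom_comp2_def rho_simps[simplified] sum.distrib[symmetric])
qed (simp add: tcomp2_def hom_comp2_def)

lemma action_op_rNov_tensor:
  assumes F: "F \<in> rNov_tensor sG sM n"
  shows "action_op n F \<in> rNov_tensor sG sM (Suc n)"
proof -
  have out: "struct_const p [[0], q] u = (0::'k)" if "p \<in> P 2" "q \<in> P n" "u \<notin> P (Suc n)" for p q u
    using that by (intro struct_const_outside) (auto simp: P_def)
  have "action_op n F u \<in> multilinear_maps sG sM (Suc n)" for u
    unfolding action_op_apply[abs_def]
  proof (rule multilinear_maps_sum)
    fix q assume q: "q \<in> P n"
    note Fq = rNov_tensorD[OF F q]
    note lin = multilinear_maps_add[OF Fq] multilinear_maps_scale[OF Fq M.vector_space_axioms]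
    show "(\<lambda>xs. if length xs = Suc n
       then sM (struct_const [1, 0] [[0], q] u) (l (hd xs) (F q (tl xs)))
        - sM (struct_const [0, 1] [[0], q] u) (r (hd xs) (F q (tl xs))) else 0)
      \<in> multilinear_maps sG sM (Suc n)"
    proof (rule multilinear_mapsI')
      fix us vs :: "'g list" and x y :: 'g assume "length us + Suc (length vs) = Suc n"
      then show "(if length (us @ (x + y) # vs) = Suc n
         then sM (struct_const [1, 0] [[0], q] u) (l (hd (us @ (x + y) # vs)) (F q (tl (us @ (x + y) # vs))))
         - sM (struct_const [0, 1] [[0], q] u) (r (hd (us @ (x + y) # vs)) (F q (tl (us @ (x + y) # vs)))) else 0)
       = (if length (us @ x # vs) = Suc n
         then sM (struct_const [1, 0] [[0], q] u) (l (hd (us @ x # vs)) (F q (tl (us @ x # vs))))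
         - sM (struct_const [0, 1] [[0], q] u) (r (hd (us @ x # vs)) (F q (tl (us @ x # vs)))) else 0)
       + (if length (us @ y # vs) = Suc n
         then sM (struct_const [1, 0] [[0], q] u) (l (hd (us @ y # vs)) (F q (tl (us @ y # vs))))
         - sM (struct_const [0, 1] [[0], q] u) (r (hd (us @ y # vs)) (F q (tl (us @ y # vs)))) else 0)"
        by (cases us) (simp_all add: lin l_linear r_linear M.scale_right_distrib)
    next
      fix us vs :: "'g list" and c :: 'k and x :: 'g assume "length us + Suc (length vs) = Suc n"
      then show "(if length (us @ sG c x # vs) = Suc n
         then sM (struct_const [1, 0] [[0], q] u) (l (hd (us @ sG c x # vs)) (F q (tl (us @ sG c x # vs))))
         - sM (struct_const [0, 1] [[0], q] u) (r (hd (us @ sG c x # vs)) (F q (tl (us @ sG c x # vs)))) else 0)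
       = sM c (if length (us @ x # vs) = Suc n
         then sM (struct_const [1, 0] [[0], q] u) (l (hd (us @ x # vs)) (F q (tl (us @ x # vs))))
         - sM (struct_const [0, 1] [[0], q] u) (r (hd (us @ x # vs)) (F q (tl (us @ x # vs)))) else 0)"
        by (cases us) (simp_all add: lin l_linear r_linear M.scale_right_diff_distrib mult.commute)
    qed simp
  qed
  moreover have "action_op n F u = 0" if "u \<notin> P (Suc n)" for u
  proof
    fix xs
    show "action_op n F u xs = 0 xs"
      unfolding action_op_apply using out[of "[1, 0]" _ u] out[of "[0, 1]" _ u] that
      by (simp add: P_2 cong: if_cong)
  qed
  ultimately show ?thesis by (simp add: rNov_tensor_def)
qed

text \<open>Composition with \<open>rho\<close> becomes the action \<open>lac\<close>: the label
  \<open>[1, 0]\<close> differentiates the power at \<open>z\<close>, the label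
  \<open>[0, 1]\<close> the power produced by \<open>F\<close>.\<close>

lemma ev_action_op:
  assumes "F \<in> rNov_tensor sG sM n" "length zs = n"
  shows "ev (Suc n) (action_op n F) (z # zs) = lac z (ev n F zs)"
proof
  fix e
  obtain x a where z: "z = (x, a)" by (cases z)
  let ?as = "map snd zs" and ?xs = "map fst zs"
  \<comment> \<open>The block of \<open>F\<close> enters with the exponent
    \<open>sum_list ?as - of_nat (n - 1)\<close>, the degree of its value.\<close>
  have sc: "(\<Sum>u\<in>P (Suc n). struct_const p [[0], q] u * fall u (a # ?as))
      = fall p [a, sum_list ?as - of_nat (n - 1)] * fall q ?as"
    if "p \<in> P 2" "q \<in> P n" for p q
  proof -
    have len: "length q = n" "sum_list q = n - 1" using that(2) by (auto simp: P_def)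
    have "(\<Sum>u\<in>P (length (a # ?as)). struct_const p [[0], q] u * fall u (a # ?as))
      = fall p (map2 (\<lambda>q bs. sum_list bs - of_nat (sum_list q)) [[0], q] (blocks (map length [[0], q]) (a # ?as)))
      * prod_list (map2 fall [[0], q] (blocks (map length [[0], q]) (a # ?as)))"
      using that assms len by (intro struct_const_fall) (auto simp: P_def)
    then show ?thesis using assms(2) len by (simp add: fall_Cons)
  qed
  have "(\<Sum>u\<in>P (Suc n). sM (fall u (a # ?as)) (action_op n F u (x # ?xs)))
    = (\<Sum>q\<in>P n. sM (\<Sum>u\<in>P (Suc n). struct_const [1, 0] [[0], q] u * fall u (a # ?as)) (l x (F q ?xs))
      - sM (\<Sum>u\<in>P (Suc n). struct_const [0, 1] [[0], q] u * fall u (a # ?as)) (r x (F q ?xs)))"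
    unfolding action_op_apply using assms(2)
    by (simp add: M.scale_sum_right M.scale_right_diff_distrib M.scale_sum_left
        sum_subtractf mult.commute) (simp add: sum.swap[of _ "P n"])
  also have "\<dots> = (\<Sum>q\<in>P n. sM (a * fall q ?as) (l x (F q ?xs))
      - sM ((sum_list ?as - of_nat (n - 1)) * fall q ?as) (r x (F q ?xs)))"
    using sc[of "[1, 0]"] sc[of "[0, 1]"] by (intro sum.cong refl) (simp add: P_2 fall_Cons)
  finally have eq: "(\<Sum>u\<in>P (Suc n). sM (fall u (a # ?as)) (action_op n F u (x # ?xs))) = \<dots>" .
  have sum_l: "l x (\<Sum>q\<in>A. f q) = (\<Sum>q\<in>A. l x (f q))" for A and f :: "nat list \<Rightarrow> 'm"
    using l_linear(4)[of x 0 0]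
    by (induction A rule: infinite_finite_induct) (simp_all add: l_linear)
  have sum_r: "r x (\<Sum>q\<in>A. f q) = (\<Sum>q\<in>A. r x (f q))" for A and f :: "nat list \<Rightarrow> 'm"
    using r_linear(4)[of x 0 0]
    by (induction A rule: infinite_finite_induct) (simp_all add: r_linear)
  show "ev (Suc n) (action_op n F) (z # zs) e = lac z (ev n F zs) e"
  proof (cases "e + of_nat (Suc n) = sum_list (map snd (z # zs)) + 1")
    case False
    then have "e - a + 1 + of_nat n \<noteq> sum_list (map snd zs) + 1"
      by (simp add: z algebra_simps)
    with False show ?thesis
      using l_linear(4)[of x 0 0] r_linear(4)[of x 0 0] by (simp add: ev_def z)
  next
    case True
    then have t: "e - a + 1 + of_nat n = sum_list (map snd zs) + 1"
      by (simp add: z algebra_simps)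
    \<comment> \<open>For \<open>n = 0\<close> the truncated \<open>n - 1\<close> would give a wrong
      exponent, but then \<open>P n\<close> is empty and the sums vanish.\<close>
    have n: "P n = {} \<or> sum_list ?as - of_nat (n - 1) = e - a + 1"
    proof (cases "n = 0")
      case True
      then show ?thesis by (auto simp: P_def)
    next
      case False
      then show ?thesis using t by (simp add: algebra_simps of_nat_diff)
    qed
    have "ev (Suc n) (action_op n F) (z # zs) e
      = (\<Sum>u\<in>P (Suc n). sM (fall u (a # ?as)) (action_op n F u (x # ?xs)))"
      using True by (simp add: ev_def z)
    also have "\<dots> = lac z (ev n F zs) e"
      unfolding eq using t n
      by (auto simp: ev_def z sum_l sum_r l_linear r_linear sum_subtractf M.scale_sum_right)
    finally show ?thesis .
  qed
qed


lemma alpha_simps: "alpha om [1, 0] [x, y] = om x y" "alpha om [0, 1] [x, y] = - om y x"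
  by (simp_all add: alpha_def pure_tensor_def hom_act_def permute_list_def Let_def)

lemma bracket_op_apply:
  assumes "length xs = m"
  shows "bracket_op (Suc m) F u (x # y # xs) = (\<Sum>p\<in>P (Suc m). \<Sum>q\<in>P 2.
    sM (struct_const p (q # replicate m [0]) u) (F p (alpha om q [x, y] # xs)))"
proof -
  have inj: "inj_on (\<lambda>q. q # replicate m [0]) (P 2)" by (auto simp: inj_on_def)
  show ?thesis
    unfolding tcomp_def diff_Suc_1 listset_P_2_1 sum.reindex[OF inj]
    using assms blocks_1[OF assms] map2_id_op[OF assms]
    by (simp add: hom_comp_def zip_replicate sum_list_replicate numeral_2_eq_2)
qed

lemma bracket_op_apply_other:
  assumes "length xs \<noteq> Suc (Suc m)"
  shows "bracket_op (Suc m) F u xs = 0"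
  using assms by (simp add: tcomp_def hom_comp_def sum_list_replicate)

lemma alpha_linear:
  assumes "q \<in> P 2"
  shows "alpha om q [x + x', y] = alpha om q [x, y] + alpha om q [x', y]"
    "alpha om q [x, y + y'] = alpha om q [x, y] + alpha om q [x, y']"
    "alpha om q [sG c x, y] = sG c (alpha om q [x, y])"
    "alpha om q [x, sG c y] = sG c (alpha om q [x, y])"
  using assms alpha_simps by (auto simp: P_2 om_linear)

lemma bracket_op_rNov_tensor:
  assumes F: "F \<in> rNov_tensor sG sM (Suc m)"
  shows "bracket_op (Suc m) F \<in> rNov_tensor sG sM (Suc (Suc m))"
proof -
  have out: "struct_const p (q # replicate m [0]) u = (0::'k)"
    if "p \<in> P (Suc m)" "q \<in> P 2" "u \<notin> P (Suc (Suc m))" for p q u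
    using that by (intro struct_const_outside) (auto simp: P_def sum_list_replicate)
  define S where "S = (\<lambda>xs p q. F p (alpha om q [xs ! 0, xs ! 1] # drop 2 xs))"
  have apply_eq: "bracket_op (Suc m) F u xs = (\<Sum>p\<in>P (Suc m). \<Sum>q\<in>P 2.
      sM (struct_const p (q # replicate m [0]) u) (S xs p q))" if "length xs = Suc (Suc m)" for u xs
  proof -
    obtain x y ys where xs: "xs = x # y # ys" "length ys = m"
      using \<open>length xs = Suc (Suc m)\<close> by (metis length_Suc_conv)
    show ?thesis unfolding xs(1) bracket_op_apply[OF xs(2)] by (simp add: S_def)
  qed
  have S_lin: "S (us @ (x + y) # vs) p q = S (us @ x # vs) p q + S (us @ y # vs) p q"
      "S (us @ sG c x # vs) p q = sM c (S (us @ x # vs) p q)"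
    if p: "p \<in> P (Suc m)" and q: "q \<in> P 2" and len: "length us + Suc (length vs) = Suc (Suc m)"
    for us x y vs p q c
  proof -
    note lin = multilinear_maps_add[OF rNov_tensorD[OF F p]]
      multilinear_maps_scale[OF rNov_tensorD[OF F p] M.vector_space_axioms]
    note lin0 = lin[of "[]", unfolded append_Nil]
    \<comment> \<open>The varied argument is the first input of the bracket, the second one, or lies
      behind the bracket.\<close>
    consider v vs' where "us = []" "vs = v # vs'" | u where "us = [u]" | u u' us' where "us = u # u' # us'"
      using len by (cases us; cases vs; cases "tl us") (auto simp: length_Suc_conv)
    then show "S (us @ (x + y) # vs) p q = S (us @ x # vs) p q + S (us @ y # vs) p q"
      "S (us @ sG c x # vs) p q = sM c (S (us @ x # vs) p q)"
      by (cases; simp add: S_def alpha_linear[OF q] lin0 lin[of "alpha om q _ # _", unfolded append_Cons])+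
  qed
  have "bracket_op (Suc m) F u \<in> multilinear_maps sG sM (Suc (Suc m))" for u
  proof (rule multilinear_mapsI')
    fix us vs :: "'g list" and x y :: 'g and c :: 'k
    assume len: "length us + Suc (length vs) = Suc (Suc m)"
    then have len': "length (us @ z # vs) = Suc (Suc m)" for z by simp
    show "bracket_op (Suc m) F u (us @ (x + y) # vs)
      = bracket_op (Suc m) F u (us @ x # vs) + bracket_op (Suc m) F u (us @ y # vs)"
      unfolding apply_eq[OF len'] sum.distrib[symmetric]
      by (intro sum.cong refl) (simp add: S_lin[OF _ _ len] M.scale_right_distrib)
    show "bracket_op (Suc m) F u (us @ sG c x # vs) = sM c (bracket_op (Suc m) F u (us @ x # vs))"
      unfolding apply_eq[OF len'] M.scale_sum_right
      by (intro sum.cong refl) (simp add: S_lin[OF _ _ len] mult.commute)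
  qed (rule bracket_op_apply_other)
  moreover have "bracket_op (Suc m) F u = 0" if "u \<notin> P (Suc (Suc m))" for u
  proof
    fix xs
    show "bracket_op (Suc m) F u xs = 0 xs"
      using apply_eq[of xs u] bracket_op_apply_other[of xs m F u] that
      by (cases "length xs = Suc (Suc m)") (auto simp: out)
  qed
  ultimately show ?thesis by (simp add: rNov_tensor_def)
qed

text \<open>The labels \<open>[1, 0]\<close> and \<open>[0, 1]\<close> of \<open>alpha\<close>
  evaluate at \<open>[b, c]\<close> to \<open>b\<close> and \<open>c\<close>, and their block has
  the exponent \<open>b + c - 1\<close>: together this is \<open>lbr y z\<close>. The other blocks
  are identities and keep their exponents.\<close>

lemma ev_bracket_op:
  assumes F: "F \<in> rNov_tensor sG sM (Suc m)" and len: "length zs = m"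
  shows "ev (Suc (Suc m)) (bracket_op (Suc m) F) (y # z # zs) = ev (Suc m) F (lbr y z # zs)"
proof
  fix e
  obtain y' b z' c where yz: "y = (y', b)" "z = (z', c)" by (cases y, cases z) auto
  let ?as = "map snd zs" and ?xs = "map fst zs"
  have sc: "(\<Sum>u\<in>P (Suc (Suc m)). struct_const p (q # replicate m [0]) u * fall u (b # c # ?as))
      = fall p ((b + c - 1) # ?as) * fall q [b, c]"
    if p: "p \<in> P (Suc m)" and q: "q \<in> P 2" for p q
  proof -
    have lenq: "length q = 2" "sum_list q = 1" using q by (auto simp: P_def)
    let ?qs = "q # replicate m [0]"
    have bl: "blocks (map length ?qs) (b # c # ?as) = [b, c] # map (\<lambda>a. [a]) ?as"
      using blocks_1[of ?as m] lenq len by (simp add: map_replicate numeral_2_eq_2)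
    have 1: "map2 (\<lambda>q bs. sum_list bs - of_nat (sum_list q)) (replicate m [0]) (map (\<lambda>a. [a]) as) = as"
      if "length as = m" for as :: "'k list"
      using that
    proof (induction m arbitrary: as)
      case (Suc m) then show ?case by (cases as) auto
    qed simp
    have 2: "prod_list (map2 fall (replicate m [0]) (map (\<lambda>a. [a]) as)) = 1"
      if "length as = m" for as :: "'k list"
      using that
    proof (induction m arbitrary: as)
      case (Suc m) then show ?case by (cases as) (auto simp: fall_Cons)
    qed simp
    have "(\<Sum>u\<in>P (length (b # c # ?as)). struct_const p ?qs u * fall u (b # c # ?as))
      = fall p (map2 (\<lambda>q bs. sum_list bs - of_nat (sum_list q)) ?qs (blocks (map length ?qs) (b # c # ?as)))
      * prod_list (map2 fall ?qs (blocks (map length ?qs) (b # c # ?as)))"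
      using p q len lenq by (intro struct_const_fall) (auto simp: P_def sum_list_replicate)
    then show ?thesis
      unfolding bl using len lenq 1[of ?as] 2[of ?as] by simp
  qed
  have Fadd: "sM d (F p (x # ?xs)) - sM d' (F p (x' # ?xs)) = F p ((sG d x - sG d' x') # ?xs)"
    if "p \<in> P (Suc m)" for p x x' d d'
    using multilinear_maps_diff[OF rNov_tensorD[OF F that], of "[]"]
      multilinear_maps_scale[OF rNov_tensorD[OF F that] M.vector_space_axioms, of "[]"] by simp
  have Fneg: "F p (- x # ?xs) = - F p (x # ?xs)" if "p \<in> P (Suc m)" for p x
    using Fadd[OF that, of 0 x 1 x] by simp
  have "(\<Sum>u\<in>P (Suc (Suc m)). sM (fall u (b # c # ?as)) (bracket_op (Suc m) F u (y' # z' # ?xs)))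
    = (\<Sum>p\<in>P (Suc m). \<Sum>q\<in>P 2. sM (\<Sum>u\<in>P (Suc (Suc m)). struct_const p (q # replicate m [0]) u * fall u (b # c # ?as))
        (F p (alpha om q [y', z'] # ?xs)))"
  proof -
    have len': "length ?xs = m" using len by simp
    show ?thesis
      unfolding bracket_op_apply[OF len'] M.scale_sum_right M.scale_sum_left
      by (subst sum.swap, rule sum.cong[OF refl], subst sum.swap) (simp add: mult.commute)
  qed
  also have "\<dots> = (\<Sum>p\<in>P (Suc m). sM (fall p ((b + c - 1) # ?as))
      (F p ((sG b (om y' z') - sG c (om z' y')) # ?xs)))"
  proof (intro sum.cong refl)
    fix p assume p: "p \<in> P (Suc m)"
    have "(\<Sum>q\<in>P 2. sM (\<Sum>u\<in>P (Suc (Suc m)). struct_const p (q # replicate m [0]) u * fall u (b # c # ?as))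
        (F p (alpha om q [y', z'] # ?xs)))
      = (\<Sum>q\<in>P 2. sM (fall p ((b + c - 1) # ?as) * fall q [b, c]) (F p (alpha om q [y', z'] # ?xs)))"
      using sc[OF p] by (intro sum.cong refl) simp
    also have "\<dots> = sM (fall p ((b + c - 1) # ?as)) (\<Sum>q\<in>P 2. sM (fall q [b, c]) (F p (alpha om q [y', z'] # ?xs)))"
      by (simp add: M.scale_sum_right)
    also have "(\<Sum>q\<in>P 2. sM (fall q [b, c]) (F p (alpha om q [y', z'] # ?xs)))
      = sM b (F p (om y' z' # ?xs)) - sM c (F p (om z' y' # ?xs))"
      using alpha_simps Fneg[OF p] by (simp add: P_2 fall_Cons)
    finally show "(\<Sum>q\<in>P 2. sM (\<Sum>u\<in>P (Suc (Suc m)). struct_const p (q # replicate m [0]) u * fall u (b # c # ?as))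
        (F p (alpha om q [y', z'] # ?xs))) = sM (fall p ((b + c - 1) # ?as))
      (F p ((sG b (om y' z') - sG c (om z' y')) # ?xs))"
      unfolding Fadd[OF p] .
  qed
  finally have eq: "(\<Sum>u\<in>P (Suc (Suc m)). sM (fall u (b # c # ?as)) (bracket_op (Suc m) F u (y' # z' # ?xs))) = \<dots>" .
  have "e + of_nat (Suc (Suc m)) = sum_list (map snd (y # z # zs)) + 1
      \<longleftrightarrow> e + of_nat (Suc m) = sum_list (map snd (lbr y z # zs)) + 1"
    by (auto simp: yz algebra_simps)
  then show "ev (Suc (Suc m)) (bracket_op (Suc m) F) (y # z # zs) e = ev (Suc m) F (lbr y z # zs) e"
    using eq unfolding ev_def by (simp add: yz)
qed

section \<open>The differential on evaluated cochains\<close>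

lemma alternating_ev:
  assumes "F \<in> CE sG sM n"
  shows "alternating (ev n F)"
  unfolding alternating_def
proof (intro allI)
  fix us x y and vs :: "('g \<times> 'k) list"
  have F: "F \<in> rNov_tensor sG sM n" using assms by (simp add: CE_def)
  show "ev n F (us @ x # y # vs) = - ev n F (us @ y # x # vs)"
  proof (cases "length us + Suc (Suc (length vs)) = n")
    case False
    then show ?thesis using ev_length[OF F] by simp
  next
    case True
    let ?i = "length us" and ?zs = "us @ y # x # vs"
    let ?\<sigma> = "transpose ?i (Suc ?i)"
    have \<sigma>: "?\<sigma> permutes {..<n}" using True by (intro permutes_swap_id) auto
    have "permute_list ?\<sigma> ?zs = us @ x # y # vs"
      by (simp add: permute_list_transpose nth_append list_update_append)
    then have "ev n F (us @ x # y # vs) = ev n (act ?\<sigma> F) ?zs"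
      using ev_act[OF \<sigma>, of ?zs F] True by simp
    also have "act ?\<sigma> F = tscale sM (of_int (sign ?\<sigma>)) F" using assms \<sigma> by (simp add: CE_def)
    finally show ?thesis by (simp add: ev_sign sign_apply_def evenperm_swap fun_Compl_def)
  qed
qed

text \<open>Converse of \<open>alternating_ev\<close>: as \<open>ev\<close> is injective, the sign
  condition of \<open>CE\<close> can be tested after evaluation.\<close>

lemma CE_I:
  assumes F: "F \<in> rNov_tensor sG sM n" and alt: "alternating (ev n F)"
  shows "F \<in> CE sG sM n"
proof -
  have "act \<sigma> F = tscale sM (of_int (sign \<sigma>)) F" if \<sigma>: "\<sigma> permutes {..<n}" for \<sigma>
  proof (rule ev_inject)
    fix zs :: "('g \<times> 'k) list" assume len: "length zs = n"
    have "permutation \<sigma>" using \<sigma> permutation_permutes by blast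
    then show "ev n (act \<sigma> F) zs = ev n (tscale sM (of_int (sign \<sigma>)) F) zs"
      using alternating_permute[OF alt, of "inv \<sigma>" zs] permutes_inv[OF \<sigma>] len
      by (simp add: ev_act[OF \<sigma> len] ev_sign sign_apply_def evenperm_inv)
  qed (use F \<sigma> in \<open>simp_all add: rNov_tensor_act rNov_tensor_tscale\<close>)
  then show ?thesis using F by (simp add: CE_def)
qed

lemma Sh_inv_permutes: "\<sigma> \<in> Sh_inv i j \<Longrightarrow> \<sigma> permutes {..<i + j}"
  by (simp add: Sh_inv_def)

lemma d_CE_rNov_tensor:
  assumes F: "F \<in> rNov_tensor sG sM (Suc m)"
  shows "d_CE sM om l r (Suc m) F \<in> rNov_tensor sG sM (Suc (Suc m))"
  unfolding d_CE_def
  using Sh_inv_permutes[of _ 1 "Suc m"] Sh_inv_permutes[of _ 2 m]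
    action_op_rNov_tensor[OF F] bracket_op_rNov_tensor[OF F]
  by (intro rNov_tensor_diff rNov_tensor_sum rNov_tensor_tscale rNov_tensor_act) auto

text \<open>Lists of every length are covered, so that the evaluated differential can be replaced by
  \<open>coboundary_at\<close> as a function, which iteration requires. At a wrong length both sides
  vanish.\<close>

lemma ev_d_CE:
  assumes "F \<in> CE sG sM (Suc m)"
  shows "ev (Suc (Suc m)) (d_CE sM om l r (Suc m) F) zs = coboundary_at zs (ev (Suc m) F)"
proof -
  have F: "F \<in> rNov_tensor sG sM (Suc m)" using assms by (simp add: CE_def)
  note sums = coboundary_at_eq_sums[OF alternating_ev[OF assms]]
  show ?thesis
  proof (cases "length zs = Suc (Suc m)")
    case False
    have "length (remove_nth i zs) \<noteq> Suc m" if "i < length zs" for i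
      using False that length_remove_nth[of i zs] by auto
    moreover have "length (x # remove_nth i (remove_nth j zs)) \<noteq> Suc m" if "i < j" "j < length zs" for i j x
      using False that by (simp add: length_remove_nth)
    ultimately have "action_sum zs (ev (Suc m) F) = 0" "bracket_sum zs (ev (Suc m) F) = 0"
      unfolding action_sum_def bracket_sum_def
      by (auto intro!: sum.neutral simp: ev_length[OF F] alt_sign_def)
    then show ?thesis using ev_length[OF d_CE_rNov_tensor[OF F] False] sums by simp
  next
    case len: True
    let ?w = "ev (Suc m) F"
    have "ev (Suc (Suc m)) (\<Sum>\<sigma>\<in>Sh_inv 1 (Suc m). tscale sM (of_int (sign \<sigma>)) (act \<sigma> (action_op (Suc m) F))) zs
      = (\<Sum>\<sigma>\<in>Sh_inv 1 (Suc m). sign_apply \<sigma> (ev (Suc (Suc m)) (action_op (Suc m) F) (permute_list (inv \<sigma>) zs)))"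
      unfolding ev_sum ev_sign using Sh_inv_permutes[of _ 1 "Suc m"] len
      by (intro sum.cong refl) (simp add: ev_act)
    also have "\<dots> = (\<Sum>i<Suc (Suc m). alt_sign i (ev (Suc (Suc m)) (action_op (Suc m) F) (zs ! i # remove_nth i zs)))"
      by (rule sum_Sh_inv_1[OF len])
    also have "\<dots> = action_sum zs ?w"
      unfolding action_sum_def len using len
      by (intro sum.cong refl) (simp add: ev_action_op[OF F] length_remove_nth del: One_nat_def)
    finally have 1: "ev (Suc (Suc m)) (\<Sum>\<sigma>\<in>Sh_inv 1 (Suc m). tscale sM (of_int (sign \<sigma>)) (act \<sigma> (action_op (Suc m) F))) zs
      = action_sum zs ?w" .
    have "ev (Suc (Suc m)) (\<Sum>\<sigma>\<in>Sh_inv 2 m. tscale sM (of_int (sign \<sigma>)) (act \<sigma> (bracket_op (Suc m) F))) zs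
      = (\<Sum>\<sigma>\<in>Sh_inv 2 m. sign_apply \<sigma> (ev (Suc (Suc m)) (bracket_op (Suc m) F) (permute_list (inv \<sigma>) zs)))"
      unfolding ev_sum ev_sign using Sh_inv_permutes[of _ 2 m] len
      by (intro sum.cong refl) (simp add: ev_act)
    also have "\<dots> = (\<Sum>j<Suc (Suc m). \<Sum>i<j. alt_sign (i + j + 1)
        (ev (Suc (Suc m)) (bracket_op (Suc m) F) (zs ! i # zs ! j # remove_nth i (remove_nth j zs))))"
      by (rule sum_Sh_inv_2[OF len])
    also have "\<dots> = bracket_sum zs ?w"
      unfolding bracket_sum_def len using len
      by (intro sum.cong refl arg_cong[where f = "alt_sign _"] ev_bracket_op[OF F])
        (simp add: length_remove_nth)
    finally have 2: "ev (Suc (Suc m)) (\<Sum>\<sigma>\<in>Sh_inv 2 m. tscale sM (of_int (sign \<sigma>)) (act \<sigma> (bracket_op (Suc m) F))) zs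
      = bracket_sum zs ?w" .
    show ?thesis
      unfolding d_CE_def diff_Suc_1 ev_diff sums using 1 2 by (simp only: diff_Suc_1)
  qed
qed

lemma d_CE_in_CE:
  assumes "F \<in> CE sG sM (Suc m)"
  shows "d_CE sM om l r (Suc m) F \<in> CE sG sM (Suc (Suc m))"
proof (rule CE_I)
  have F: "F \<in> rNov_tensor sG sM (Suc m)" using assms by (simp add: CE_def)
  then show "d_CE sM om l r (Suc m) F \<in> rNov_tensor sG sM (Suc (Suc m))" by (rule d_CE_rNov_tensor)
  have "alternating (\<lambda>zs. coboundary_at zs (ev (Suc m) F))"
    using alternating_ev[OF assms] ev_skew_compatible[OF F] by (rule alternating_coboundary_at)
  moreover have "ev (Suc (Suc m)) (d_CE sM om l r (Suc m) F) = (\<lambda>zs. coboundary_at zs (ev (Suc m) F))"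
    using ev_d_CE[OF assms] by auto
  ultimately show "alternating (ev (Suc (Suc m)) (d_CE sM om l r (Suc m) F))" by simp
qed

lemma d_CE_d_CE:
  assumes "F \<in> CE sG sM (Suc m)"
  shows "d_CE sM om l r (Suc (Suc m)) (d_CE sM om l r (Suc m) F) = 0"
proof (rule ev_inject)
  note dF = d_CE_in_CE[OF assms]
  show "d_CE sM om l r (Suc (Suc m)) (d_CE sM om l r (Suc m) F) \<in> rNov_tensor sG sM (Suc (Suc (Suc m)))"
    using d_CE_in_CE[OF dF] by (simp add: CE_def)
  fix zs
  have "jacobi_compatible (ev (Suc m) F)"
    using assms by (intro ev_jacobi_compatible) (simp add: CE_def)
  moreover have "ev (Suc (Suc m)) (d_CE sM om l r (Suc m) F) = (\<lambda>zs. coboundary_at zs (ev (Suc m) F))"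
    using ev_d_CE[OF assms] by auto
  ultimately have "ev (Suc (Suc (Suc m))) (d_CE sM om l r (Suc (Suc m)) (d_CE sM om l r (Suc m) F)) zs = 0"
    using ev_d_CE[OF dF, of zs] coboundary_at_coboundary_at by simp
  then show "ev (Suc (Suc (Suc m))) (d_CE sM om l r (Suc (Suc m)) (d_CE sM om l r (Suc m) F)) zs
    = ev (Suc (Suc (Suc m))) 0 zs"
    by (auto simp: ev_def fun_eq_iff)
qed (rule rNov_tensor_0)

end

section \<open>The isomorphism with the Novikov cochains\<close>

text \<open>One representative for each orbit of permutations on \<open>P n\<close>.\<close>

definition sorted_P :: "nat \<Rightarrow> nat list set" where
  "sorted_P n = {p \<in> P n. sorted_wrt (\<ge>) p}"

lemma P_nth_less: "p \<in> P n \<Longrightarrow> i < n \<Longrightarrow> p ! i < n"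
  using member_le_sum_list[of "p ! i" p] by (force simp: P_def)

lemma length_multiplicities [simp]: "length (multiplicities n p) = n"
  by (simp add: multiplicities_def)

lemma multiplicities_nth: "b < n \<Longrightarrow> multiplicities n p ! b = card {i. i < n \<and> p ! i = n - 1 - b}"
  by (simp add: multiplicities_def rev_nth)

text \<open>Block \<open>b\<close> counts the entries equal to \<open>n - 1 - b\<close>, so the
  first \<open>b\<close> blocks together count the entries that are at least
  \<open>n - b\<close>.\<close>

lemma sum_list_take_multiplicities:
  assumes p: "p \<in> P n"
  shows "b \<le> n \<Longrightarrow> sum_list (take b (multiplicities n p)) = card {i. i < n \<and> n \<le> p ! i + b}"
proof (induction b)
  case 0
  then show ?case using P_nth_less[OF p] by (simp add: not_le)
next
  case (Suc b)
  have "{i. i < n \<and> n \<le> p ! i + Suc b} = {i. i < n \<and> n \<le> p ! i + b} \<union> {i. i < n \<and> p ! i = n - 1 - b}"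
    using Suc.prems by auto
  moreover have "{i. i < n \<and> n \<le> p ! i + b} \<inter> {i. i < n \<and> p ! i = n - 1 - b} = {}"
    using Suc.prems by auto
  ultimately have "card {i. i < n \<and> n \<le> p ! i + Suc b}
      = card {i. i < n \<and> n \<le> p ! i + b} + card {i. i < n \<and> p ! i = n - 1 - b}"
    by (simp add: card_Un_disjoint)
  then show ?case using Suc by (simp add: take_Suc_conv_app_nth multiplicities_nth)
qed

lemma sum_list_multiplicities: "p \<in> P n \<Longrightarrow> sum_list (multiplicities n p) = n"
  using sum_list_take_multiplicities[of p n n] by simp

lemma multiplicities_in_K:
  assumes p: "p \<in> P n"
  shows "multiplicities n p \<in> K n"
proof -
  have "(\<Sum>j<n. j * multiplicities n p ! (n - 1 - j)) = (\<Sum>j<n. \<Sum>i<n. if j = p ! i then p ! i else 0)"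
  proof (intro sum.cong refl)
    fix j assume "j \<in> {..<n}"
    then have "j * multiplicities n p ! (n - 1 - j) = (\<Sum>i\<in>{i. i < n \<and> p ! i = j}. j)"
      by (simp add: multiplicities_nth)
    also have "\<dots> = (\<Sum>i<n. if p ! i = j then j else 0)"
      by (simp add: sum.inter_filter[symmetric])
    finally show "j * multiplicities n p ! (n - 1 - j) = (\<Sum>i<n. if j = p ! i then p ! i else 0)"
      by (simp add: eq_commute cong: if_cong)
  qed
  also have "\<dots> = (\<Sum>i<n. p ! i)"
    by (subst sum.swap) (simp add: P_nth_less[OF p])
  also have "\<dots> = sum_list p" using p by (simp add: P_def sum_list_sum_nth atLeast0LessThan)
  finally show ?thesis using p sum_list_multiplicities[OF p] by (simp add: K_def P_def)
qed

lemma down_closed_eq_lessThan: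
  assumes "finite A" "\<And>i j :: nat. j \<in> A \<Longrightarrow> i < j \<Longrightarrow> i \<in> A"
  shows "A = {..<card A}"
proof (cases "A = {}")
  case False
  define M where "M = Max A"
  have "A = {..M}"
  proof (intro equalityI subsetI)
    fix i assume "i \<in> {..M}"
    then show "i \<in> A"
      using Max_in[OF assms(1) False] assms(2)[of M i] by (cases "i = M") (auto simp: M_def)
  qed (use Max_ge[OF assms(1)] in \<open>auto simp: M_def\<close>)
  then show ?thesis by (simp add: lessThan_Suc_atMost)
qed simp

text \<open>In a weakly decreasing list the positions whose entries reach a given bound form an
  initial segment, which is determined by its size.\<close>

lemma sorted_P_block_boundary:
  assumes p: "p \<in> sorted_P n" and "b \<le> n" "i < n"
  shows "i < sum_list (take b (multiplicities n p)) \<longleftrightarrow> n \<le> p ! i + b"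
proof -
  have P: "p \<in> P n" and len: "length p = n" using p by (auto simp: sorted_P_def P_def)
  let ?A = "{i. i < n \<and> n \<le> p ! i + b}"
  have down: "i \<in> ?A" if "j \<in> ?A" "i < j" for i j
    using p that len sorted_wrt_nth_less[of "(\<ge>)" p i j] by (auto simp: sorted_P_def)
  have "?A = {..<card ?A}"
    by (rule down_closed_eq_lessThan) (use down in simp_all)
  then have "i \<in> ?A \<longleftrightarrow> i < card ?A" by blast
  then show ?thesis using assms sum_list_take_multiplicities[OF P] by simp
qed

text \<open>Blocks are level sets of the exponent list, so exchanging two positions of one block
  fixes \<open>p\<close>. This links the wedge condition to the sign condition in
  \<open>CE\<close>.\<close>

lemma same_block_multiplicities:
  assumes p: "p \<in> sorted_P n"
  shows "same_block (multiplicities n p) i j \<longleftrightarrow> i < n \<and> j < n \<and> p ! i = p ! j"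
proof
  have P: "p \<in> P n" using p by (simp add: sorted_P_def)
  let ?k = "multiplicities n p"
  {
    assume "same_block ?k i j"
    then obtain b where b: "b < n" "{i, j} \<subseteq> {sum_list (take b ?k)..<sum_list (take (Suc b) ?k)}"
      by (auto simp: same_block_def)
    have "sum_list (take (Suc b) ?k) \<le> n"
      using b(1) card_mono[of "{..<n}" "{i. i < n \<and> n \<le> p ! i + Suc b}"]
      by (subst sum_list_take_multiplicities[OF P]) auto
    then have ij: "i < n" "j < n" using b(2) by auto
    with b show "i < n \<and> j < n \<and> p ! i = p ! j"
      using sorted_P_block_boundary[OF p, of b i] sorted_P_block_boundary[OF p, of "Suc b" i]
        sorted_P_block_boundary[OF p, of b j] sorted_P_block_boundary[OF p, of "Suc b" j]
      by auto
  next
    assume ij: "i < n \<and> j < n \<and> p ! i = p ! j"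
    define b where "b = n - 1 - p ! i"
    have lt: "p ! i < n" using P_nth_less[OF P] ij by blast
    then have "b < n" by (auto simp: b_def)
    moreover have "{i, j} \<subseteq> {sum_list (take b ?k)..<sum_list (take (Suc b) ?k)}"
      using ij lt \<open>b < n\<close>
        sorted_P_block_boundary[OF p, of b i] sorted_P_block_boundary[OF p, of "Suc b" i]
        sorted_P_block_boundary[OF p, of b j] sorted_P_block_boundary[OF p, of "Suc b" j]
      by (simp add: b_def) linarith
    ultimately show "same_block ?k i j" by (auto simp: same_block_def)
  }
qed

lemma multiplicities_inj: "inj_on (multiplicities n) (sorted_P n)"
proof (rule inj_onI)
  fix p q assume p: "p \<in> sorted_P n" and q: "q \<in> sorted_P n" and eq: "multiplicities n p = multiplicities n q"
  have P: "p \<in> P n" "q \<in> P n" using p q by (auto simp: sorted_P_def)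
  have *: "n \<le> p ! i + b \<longleftrightarrow> n \<le> q ! i + b" if "b \<le> n" "i < n" for b i
    using sorted_P_block_boundary[OF p that] sorted_P_block_boundary[OF q that] eq by simp
  \<comment> \<open>The entry \<open>p ! i\<close> is recovered from the least \<open>b\<close> with
    \<open>n \<le> p ! i + b\<close>.\<close>
  have "p ! i = q ! i" if "i < n" for i
    using *[of "n - p ! i" i] *[of "n - q ! i" i] that P_nth_less[OF P(1) that] P_nth_less[OF P(2) that] by auto
  then show "p = q" using P by (intro nth_equalityI) (auto simp: P_def)
qed

lemma multiplicities_surj:
  assumes k: "k \<in> K n"
  shows "\<exists>p\<in>sorted_P n. multiplicities n p = k"
proof -
  define c where "c = concat (map (\<lambda>b. replicate (k ! b) (n - 1 - b)) [0..<n])"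
  \<comment> \<open>The list \<open>c\<close> is already weakly decreasing; sorting it makes this
    property available at once.\<close>
  define p where "p = rev (sort c)"
  have len_k: "length k = n" using k by (simp add: K_def)
  have m: "mset p = mset c" by (simp add: p_def)
  have concat: "sum_list (concat xss) = sum_list (map sum_list xss)" for xss :: "nat list list"
    by (induction xss) auto
  have "length c = sum_list k"
    using len_k by (simp add: c_def length_concat comp_def sum_list_sum_nth atLeast0LessThan
        sum_list_distinct_conv_sum_set)
  then have len: "length p = n" using k by (simp add: p_def K_def)
  have "sum_list p = sum_list c" using m by (metis sum_mset_sum_list)
  also have "\<dots> = (\<Sum>b<n. k ! b * (n - 1 - b))"
    by (simp add: c_def concat comp_def sum_list_replicate sum_list_distinct_conv_sum_set atLeast0LessThan)
  also have "\<dots> = (\<Sum>j<n. j * k ! (n - 1 - j))"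
    by (subst sum.nat_diff_reindex[symmetric], intro sum.cong) auto
  finally have "p \<in> P n" using k len by (simp add: P_def K_def)
  moreover have "sorted_wrt (\<ge>) p" by (simp add: p_def sorted_wrt_rev)
  moreover have "multiplicities n p = k"
  proof (rule nth_equalityI)
    fix b assume "b < length (multiplicities n p)"
    then have b: "b < n" by simp
    have "multiplicities n p ! b = length (filter (\<lambda>x. x = n - 1 - b) p)"
      using b len by (simp add: multiplicities_nth length_filter_conv_card)
    also have "\<dots> = length (filter (\<lambda>x. x = n - 1 - b) c)"
      using m by (metis mset_filter size_mset)
    also have "\<dots> = (\<Sum>a<n. if a = b then k ! b else 0)"
    proof -
      have "length (filter (\<lambda>x. x = n - 1 - b) (replicate (k ! a) (n - 1 - a))) = (if a = b then k ! b else 0)"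
        if "a < n" for a
        using b that by (auto simp: filter_empty_conv)
      then show ?thesis
        by (simp add: c_def filter_concat length_concat comp_def sum_list_distinct_conv_sum_set
            atLeast0LessThan del: filter_replicate diff_diff_left)
    qed
    finally show "multiplicities n p ! b = k ! b" using b by simp
  qed (simp add: len_k)
  ultimately show ?thesis by (auto simp: sorted_P_def)
qed

lemma Gamma_multiplicities:
  assumes "p \<in> sorted_P n"
  shows "Gamma n F (multiplicities n p) = F p"
  using assms inv_into_f_f[OF multiplicities_inj assms]
  by (simp add: Gamma_def multiplicities_in_K sorted_P_def)

lemma sorting_permutation:
  assumes "p \<in> P n"
  shows "\<exists>\<tau>. \<tau> permutes {..<n} \<and> permute_list \<tau> p \<in> sorted_P n"
proof -
  have "mset (rev (sort p)) = mset p" by simp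
  then obtain \<tau> where \<tau>: "\<tau> permutes {..<length p}" "permute_list \<tau> p = rev (sort p)"
    by (rule mset_eq_permutation)
  have "sorted_wrt (\<ge>) (rev (sort p))" by (simp add: sorted_wrt_rev)
  moreover have "permute_list \<tau> p \<in> P n"
    using permute_list_in_P[of \<tau> n p] \<tau>(1) assms by (simp add: P_def)
  ultimately show ?thesis using \<tau> assms by (intro exI[of _ \<tau>]) (simp add: sorted_P_def P_def)
qed

lemma sorted_P_unique:
  assumes "p \<in> sorted_P n" "q \<in> sorted_P n" "mset p = mset q"
  shows "p = q"
proof -
  have "sort (rev q) = rev p" "sort (rev q) = rev q"
    using assms by (intro properties_for_sort; simp add: sorted_P_def sorted_wrt_rev)+
  then show ?thesis by simp
qed

section \<open>Bijectivity of \<open>Gamma\<close> on the Chevalley--Eilenberg cochains\<close>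

context novikov_representation
begin

lemma CE_permute:
  assumes "F \<in> CE sG sM n" "\<tau> permutes {..<n}"
  shows "F (permute_list \<tau> p) (permute_list \<tau> xs) = sM (of_int (sign \<tau>)) (F p xs)"
proof -
  have \<sigma>: "inv \<tau> permutes {..<n}" "inv (inv \<tau>) = \<tau>"
    using assms(2) by (auto intro: permutes_inv permutes_inv_inv)
  have "act (inv \<tau>) F p xs = tscale sM (of_int (sign (inv \<tau>))) F p xs"
    using assms(1) \<sigma>(1) by (simp add: CE_def)
  moreover have "permutation \<tau>" using assms(2) permutation_permutes by blast
  ultimately show ?thesis using \<sigma>(2) by (simp add: act_def hom_act_def tscale_def sign_inverse)
qed

text \<open>A transposition within a block fixes the exponent list, so at equal arguments the
  component equals its own negative, hence vanishes in characteristic 0.\<close>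

lemma Gamma_in_Nov_cochains:
  assumes F: "F \<in> CE sG sM n"
  shows "Gamma n F \<in> Nov_cochains sG sM n"
proof -
  have tensor: "F \<in> rNov_tensor sG sM n" using F by (simp add: CE_def)
  have "Gamma n F k \<in> wedge_maps sG sM k" if k: "k \<in> K n" for k
  proof -
    obtain p where p: "p \<in> sorted_P n" "multiplicities n p = k"
      using multiplicities_surj[OF k] by blast
    then have P: "p \<in> P n" by (simp add: sorted_P_def)
    have "F p xs = 0" if len: "length xs = n" and ij: "i \<noteq> j" "same_block k i j" "xs ! i = xs ! j" for xs i j
    proof -
      have lt: "i < n" "j < n" "p ! i = p ! j"
        using same_block_multiplicities[OF p(1)] ij(2) p(2) by auto
      have "permute_list (transpose i j) p = p" "permute_list (transpose i j) xs = xs"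
        using lt ij(3) len P by (simp_all add: permute_list_transpose P_def)
          (metis list_update_id)+
      then have "F p xs = - F p xs"
        using CE_permute[OF F, of "transpose i j" p xs] lt ij(1)
        by (simp add: permutes_swap_id sign_swap_id)
      then have "sM 2 (F p xs) = 0"
        using M.scale_left_distrib[of 1 1 "F p xs"] by (simp add: eq_neg_iff_add_eq_0)
      then show ?thesis by simp
    qed
    moreover have "sum_list k = n" using sum_list_multiplicities[OF P] p(2) by simp
    ultimately show ?thesis
      using Gamma_multiplicities[OF p(1), of F] rNov_tensorD[OF tensor P] p(2)
      by (auto simp: wedge_maps_def)
  qed
  then show ?thesis by (auto simp: Nov_cochains_def Gamma_def)
qed

text \<open>Every exponent list can be sorted, and the sign condition recovers its component from
  the one at the sorted list.\<close>

lemma Gamma_inj: "inj_on (Gamma n) (CE sG sM n)"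
proof (rule inj_onI)
  fix F G assume F: "F \<in> CE sG sM n" and G: "G \<in> CE sG sM n" and eq: "Gamma n F = Gamma n G"
  have t: "F \<in> rNov_tensor sG sM n" "G \<in> rNov_tensor sG sM n" using F G by (auto simp: CE_def)
  show "F = G"
  proof (intro ext)
    fix p xs
    show "F p xs = G p xs"
    proof (cases "p \<in> P n")
      case False
      then show ?thesis using t by (simp add: rNov_tensor_def)
    next
      case True
      then obtain \<tau> where \<tau>: "\<tau> permutes {..<n}" "permute_list \<tau> p \<in> sorted_P n"
        using sorting_permutation by blast
      have "F (permute_list \<tau> p) = G (permute_list \<tau> p)"
        using Gamma_multiplicities[OF \<tau>(2)] eq by metis
      then have "sM (of_int (sign \<tau>)) (F p xs) = sM (of_int (sign \<tau>)) (G p xs)"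
        using CE_permute[OF F \<tau>(1)] CE_permute[OF G \<tau>(1)] by metis
      then show ?thesis by (simp add: sign_def split: if_splits)
    qed
  qed
qed

text \<open>Polarization: as a function of the two arguments \<open>f\<close> vanishes on the
  diagonal, and expanding at the sum of both entries gives antisymmetry.\<close>

lemma multilinear_transpose:
  assumes f: "f \<in> multilinear_maps sG sM n" and ij: "i < n" "j < n" "i \<noteq> j" and len: "length xs = n"
    and zero: "\<And>xs. length xs = n \<Longrightarrow> xs ! i = xs ! j \<Longrightarrow> f xs = 0"
  shows "f (permute_list (transpose i j) xs) = - f xs"
proof -
  define h where "h = (\<lambda>u v. f (xs[i := u, j := v]))"
  have add: "f (ys[a := u + v]) = f (ys[a := u]) + f (ys[a := v])" if "length ys = n" "a < n" for ys a u v
    using f that unfolding multilinear_maps_def Vector_Spaces.linear_iff by blast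
  have add1: "h (u + u') v = h u v + h u' v" and add2: "h u (v + v') = h u v + h u v'" for u u' v v'
    using add[of "xs[j := v]" i u u'] add[of "xs[i := u]" j v v'] ij len
    by (simp_all add: h_def list_update_swap[of i j])
  have "h u u = 0" for u unfolding h_def using ij len by (intro zero) auto
  then have "h (xs ! i) (xs ! j) + h (xs ! j) (xs ! i) = 0"
    using add1[of "xs ! i" "xs ! j" "xs ! i + xs ! j"] add2[of "xs ! i" "xs ! i" "xs ! j"]
      add2[of "xs ! j" "xs ! i" "xs ! j"] by simp
  then show ?thesis
    using ij len by (simp add: h_def permute_list_transpose eq_neg_iff_add_eq_0 add.commute)
qed

text \<open>The components at weakly decreasing exponent lists are prescribed; the others are
  defined by sorting and inserting the sign. Two sorting permutations differ by one that stabilizes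
  the sorted list, and there the wedge condition yields exactly the sign, so the extension does not
  depend on the choice.\<close>

lemma Gamma_surj:
  assumes c: "c \<in> Nov_cochains sG sM n"
  shows "\<exists>F\<in>CE sG sM n. Gamma n F = c"
proof -
  define G where "G = (\<lambda>s. c (multiplicities n s))"
  have G_wedge: "G s \<in> multilinear_maps sG sM n"
    "\<And>xs i j. \<lbrakk>length xs = n; i \<noteq> j; i < n; j < n; s ! i = s ! j; xs ! i = xs ! j\<rbrakk> \<Longrightarrow> G s xs = 0"
    if s: "s \<in> sorted_P n" for s
  proof -
    have P: "s \<in> P n" using s by (simp add: sorted_P_def)
    then have "G s \<in> wedge_maps sG sM (multiplicities n s)"
      using c multiplicities_in_K by (simp add: G_def Nov_cochains_def)
    then show "G s \<in> multilinear_maps sG sM n"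
      "\<And>xs i j. \<lbrakk>length xs = n; i \<noteq> j; i < n; j < n; s ! i = s ! j; xs ! i = xs ! j\<rbrakk> \<Longrightarrow> G s xs = 0"
      using sum_list_multiplicities[OF P] same_block_multiplicities[OF s]
      by (auto simp: wedge_maps_def)
  qed
  have stabilizer: "G s (permute_list \<pi> xs) = sM (of_int (sign \<pi>)) (G s xs)"
    if s: "s \<in> sorted_P n" and \<pi>: "\<pi> permutes {..<n}" "permute_list \<pi> s = s" and len: "length xs = n"
    for s \<pi> xs
  proof -
    have ls: "length s = n" using s by (simp add: sorted_P_def P_def)
    have "G s (permute_list \<pi> xs) = (if evenperm \<pi> then G s xs else - G s xs)"
    proof (rule antisymmetric_stabilizer[where g = "(!) s" and n = n])
      show "G s (permute_list (transpose i j) ys) = - G s ys"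
        if "i < n" "j < n" "i \<noteq> j" "s ! i = s ! j" "length ys = n" for i j ys
        using that by (intro multilinear_transpose[OF G_wedge(1)[OF s]]) (auto intro: G_wedge(2)[OF s])
      show "s ! \<pi> i = s ! i" for i
      proof (cases "i < n")
        case True
        then have "permute_list \<pi> s ! i = s ! \<pi> i"
          using ls \<pi>(1) by (intro permute_list_nth) auto
        then show ?thesis using \<pi>(2) by simp
      qed (use permutes_not_in[OF \<pi>(1)] in simp)
    qed (use \<pi> len in auto)
    then show ?thesis by (simp add: sign_def)
  qed
  define \<tau> where "\<tau> = (\<lambda>p. SOME \<tau>. \<tau> permutes {..<n} \<and> permute_list \<tau> p \<in> sorted_P n)"
  have \<tau>: "\<tau> p permutes {..<n}" "permute_list (\<tau> p) p \<in> sorted_P n" if "p \<in> P n" for p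
    using someI_ex[OF sorting_permutation[OF that]] by (auto simp: \<tau>_def)
  define F where "F = (\<lambda>p xs. if p \<in> P n
    then sM (of_int (sign (\<tau> p))) (G (permute_list (\<tau> p) p) (permute_list (\<tau> p) xs)) else 0)"
  \<comment> \<open>Any sorting permutation may replace the chosen one.\<close>
  have F_eq: "F p xs = sM (of_int (sign \<rho>)) (G (permute_list \<rho> p) (permute_list \<rho> xs))"
    if p: "p \<in> P n" and \<rho>: "\<rho> permutes {..<n}" "permute_list \<rho> p \<in> sorted_P n" and len: "length xs = n"
    for p \<rho> xs
  proof -
    have lp: "length p = n" using p by (simp add: P_def)
    let ?s = "permute_list (\<tau> p) p"
    have s: "permute_list \<rho> p = ?s"
      using \<tau>[OF p] \<rho> lp by (intro sorted_P_unique[of _ n]) auto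
    define \<pi> where "\<pi> = inv (\<tau> p) \<circ> \<rho>"
    have \<pi>: "\<pi> permutes {..<n}"
      unfolding \<pi>_def using \<rho>(1) permutes_inv[OF \<tau>(1)[OF p]] by (rule permutes_compose)
    have \<rho>_eq: "\<rho> = \<tau> p \<circ> \<pi>"
      using permutes_inverses[OF \<tau>(1)[OF p]] by (auto simp: \<pi>_def fun_eq_iff)
    have "permute_list \<rho> xs = permute_list \<pi> (permute_list (\<tau> p) xs)"
      unfolding \<rho>_eq using \<pi> len by (intro permute_list_compose) auto
    moreover have "permute_list \<rho> p = permute_list \<pi> ?s"
      unfolding \<rho>_eq using \<pi> lp by (intro permute_list_compose) auto
    moreover have "sign \<rho> = sign (\<tau> p) * sign \<pi>"
      unfolding \<rho>_eq using \<pi> \<tau>(1)[OF p] permutation_permutes by (intro sign_compose) blast+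
    ultimately show ?thesis
      using stabilizer[OF \<tau>(2)[OF p] \<pi>, of "permute_list (\<tau> p) xs"] s len p
      by (simp add: F_def sign_def)
  qed
  have tensor: "F \<in> rNov_tensor sG sM n"
    using \<tau> by (auto simp: rNov_tensor_def F_def
        intro!: multilinear_maps_smult multilinear_maps_permute[of "G _"] G_wedge(1))
  have "act \<sigma> F = tscale sM (of_int (sign \<sigma>)) F" if \<sigma>: "\<sigma> permutes {..<n}" for \<sigma>
  proof (intro ext)
    fix q xs
    have inv: "inv \<sigma> permutes {..<n}" using \<sigma> by (rule permutes_inv)
    note tD = multilinear_maps_length[OF rNov_tensorD[OF tensor]]
    show "act \<sigma> F q xs = tscale sM (of_int (sign \<sigma>)) F q xs"
    proof (cases "q \<in> P n \<and> length xs = n")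
      case False
      then have "act \<sigma> F q xs = 0" "F q xs = 0"
        using permute_list_in_P[OF inv, of q] tD[of q xs] tD[of "permute_list (inv \<sigma>) q" "permute_list (inv \<sigma>) xs"]
        by (auto simp: act_def hom_act_def F_def)
      then show ?thesis by (simp add: tscale_def)
    next
      case True
      then have lq: "length q = n" by (simp add: P_def)
      let ?q = "permute_list (inv \<sigma>) q" and ?xs = "permute_list (inv \<sigma>) xs"
      have q: "?q \<in> P n" using True permute_list_in_P[OF inv] by blast
      \<comment> \<open>Since \<open>\<tau> ?q\<close> sorts the permuted list \<open>?q\<close>,
        the composite \<open>?\<rho>\<close> sorts \<open>q\<close> itself, and \<open>F_eq\<close>
        applies to it.\<close>
      let ?t = "\<tau> ?q" and ?\<rho> = "inv \<sigma> \<circ> \<tau> ?q"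
      have \<rho>: "?\<rho> permutes {..<n}" using \<tau>(1)[OF q] inv by (rule permutes_compose)
      have pq: "permute_list ?\<rho> q = permute_list ?t ?q"
        using \<tau>(1)[OF q] lq by (intro permute_list_compose) auto
      have px: "permute_list ?\<rho> xs = permute_list ?t ?xs"
        using \<tau>(1)[OF q] True by (intro permute_list_compose) auto
      have "sign ?\<rho> = sign (inv \<sigma>) * sign ?t"
        using inv \<tau>(1)[OF q] permutation_permutes by (intro sign_compose) blast+
      moreover have "permutation \<sigma>" using \<sigma> permutation_permutes by blast
      ultimately have sg: "sign ?\<rho> = sign \<sigma> * sign ?t" by (simp add: sign_inverse)
      have "F q xs = sM (of_int (sign ?\<rho>)) (G (permute_list ?\<rho> q) (permute_list ?\<rho> xs))"
        using True \<rho> \<tau>(2)[OF q] by (intro F_eq) (simp_all add: pq)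
      then show ?thesis
        using q unfolding pq px sg
        by (simp add: act_def hom_act_def tscale_def F_def sign_def)
    qed
  qed
  then have "F \<in> CE sG sM n" using tensor by (simp add: CE_def)
  moreover have "Gamma n F = c"
  proof (intro ext)
    fix k xs
    show "Gamma n F k xs = c k xs"
    proof (cases "k \<in> K n")
      case False
      then show ?thesis using c by (simp add: Gamma_def Nov_cochains_def)
    next
      case True
      then obtain s where s: "s \<in> sorted_P n" "multiplicities n s = k"
        using multiplicities_surj by blast
      then have P: "s \<in> P n" by (simp add: sorted_P_def)
      have "F s xs = G s xs"
      proof (cases "length xs = n")
        case True
        then show ?thesis using F_eq[OF P permutes_id, of xs] s(1) by simp
      qed (use multilinear_maps_length[OF rNov_tensorD[OF tensor P]] multilinear_maps_length[OF G_wedge(1)[OF s(1)]] in simp)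
      then show ?thesis using Gamma_multiplicities[OF s(1), of F] s(2) by (simp add: G_def)
    qed
  qed
  ultimately show ?thesis by blast
qed

section \<open>Linearity of the differential\<close>

lemma Gamma_linear: "Gamma n (tscale sM a F + G) = tscale sM a (Gamma n F) + Gamma n G"
  by (auto simp: Gamma_def tscale_def fun_eq_iff)

lemma ev_linear: "ev n (tscale sM a F + G) zs = (\<lambda>e. sM a (ev n F zs e) + ev n G zs e)"
  by (auto simp: ev_def tscale_def fun_eq_iff M.scale_right_distrib sum.distrib M.scale_sum_right mult.commute)

lemma lac_linear: "lac z (\<lambda>e. sM a (u e) + v e) = (\<lambda>e. sM a (lac z u e) + lac z v e)"
  by (cases z) (auto simp: fun_eq_iff l_linear r_linear M.scale_right_distrib M.scale_right_diff_distrib mult.commute)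

lemma coboundary_at_linear:
  "coboundary_at zs (\<lambda>ys e. sM a (u ys e) + v ys e)
    = (\<lambda>e. sM a (coboundary_at zs u e) + coboundary_at zs v e)"
proof (induction zs arbitrary: u v)
  case (Cons z zs)
  have s: "(\<Sum>i\<in>A. f i) e = (\<Sum>i\<in>A. f i e)" for A :: "nat set" and f :: "nat \<Rightarrow> 'k \<Rightarrow> 'm" and e
    by (induction A rule: infinite_finite_induct) auto
  have "lie z (\<lambda>ys e. sM a (u ys e) + v ys e) zs = (\<lambda>e. sM a (lie z u zs e) + lie z v zs e)"
    by (auto simp: lie_def lac_linear s fun_eq_iff sum.distrib M.scale_sum_right M.scale_right_diff_distrib)
  then show ?case by (auto simp: Cons.IH fun_eq_iff M.scale_right_diff_distrib)
qed (simp add: fun_eq_iff)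

lemma CE_linear:
  assumes F: "F \<in> CE sG sM n" and G: "G \<in> CE sG sM n"
  shows "tscale sM a F + G \<in> CE sG sM n"
proof (rule CE_I)
  show "tscale sM a F + G \<in> rNov_tensor sG sM n"
    using F G by (intro rNov_tensor_add rNov_tensor_tscale) (auto simp: CE_def)
  show "alternating (ev n (tscale sM a F + G))"
    unfolding alternating_def ev_linear
  proof (intro allI)
    fix us x y vs
    show "(\<lambda>e. sM a (ev n F (us @ x # y # vs) e) + ev n G (us @ x # y # vs) e)
      = - (\<lambda>e. sM a (ev n F (us @ y # x # vs) e) + ev n G (us @ y # x # vs) e)"
      unfolding alternatingD[OF alternating_ev[OF F], of us x y vs] alternatingD[OF alternating_ev[OF G], of us x y vs]
      by (simp add: fun_eq_iff)
  qed
qed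

text \<open>Linearity is read off after evaluation from the recursion for
  \<open>coboundary_at\<close> instead of from the composition formulas.\<close>

lemma d_CE_linear:
  assumes F: "F \<in> CE sG sM (Suc m)" and G: "G \<in> CE sG sM (Suc m)"
  shows "d_CE sM om l r (Suc m) (tscale sM a F + G)
    = tscale sM a (d_CE sM om l r (Suc m) F) + d_CE sM om l r (Suc m) G"
proof (rule ev_inject)
  note FG = CE_linear[OF F G, of a]
  show "d_CE sM om l r (Suc m) (tscale sM a F + G) \<in> rNov_tensor sG sM (Suc (Suc m))"
    using d_CE_in_CE[OF FG] by (simp add: CE_def)
  show "tscale sM a (d_CE sM om l r (Suc m) F) + d_CE sM om l r (Suc m) G \<in> rNov_tensor sG sM (Suc (Suc m))"
    using CE_linear[OF d_CE_in_CE[OF F] d_CE_in_CE[OF G], of a] by (simp add: CE_def)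
  fix zs
  have "ev (Suc m) (tscale sM a F + G) = (\<lambda>ys e. sM a (ev (Suc m) F ys e) + ev (Suc m) G ys e)"
    by (rule ext) (rule ev_linear)
  then show "ev (Suc (Suc m)) (d_CE sM om l r (Suc m) (tscale sM a F + G)) zs
    = ev (Suc (Suc m)) (tscale sM a (d_CE sM om l r (Suc m) F) + d_CE sM om l r (Suc m) G) zs"
    unfolding ev_linear ev_d_CE[OF F] ev_d_CE[OF G] ev_d_CE[OF FG] by (simp add: coboundary_at_linear)
qed

lemma Gamma_inverse:
  assumes "c \<in> Nov_cochains sG sM n"
  shows "inv_into (CE sG sM n) (Gamma n) c \<in> CE sG sM n" "Gamma n (inv_into (CE sG sM n) (Gamma n) c) = c"
proof -
  have "c \<in> Gamma n ` CE sG sM n" using Gamma_surj[OF assms] by blast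
  then show "inv_into (CE sG sM n) (Gamma n) c \<in> CE sG sM n" "Gamma n (inv_into (CE sG sM n) (Gamma n) c) = c"
    by (rule inv_into_into, rule f_inv_into_f)
qed

end

theorem theorem5p13:
  fixes sG :: "'k::field_char_0 \<Rightarrow> 'g::ab_group_add \<Rightarrow> 'g"
    and om :: "'g \<Rightarrow> 'g \<Rightarrow> 'g"
    and sM :: "'k \<Rightarrow> 'm::ab_group_add \<Rightarrow> 'm"
    and l r :: "'g \<Rightarrow> 'm \<Rightarrow> 'm"
  assumes "novikov_algebra sG om"
    and "novikov_representation sG om sM l r"
  shows "(\<forall>n\<ge>1. \<forall>c\<in>Nov_cochains sG sM n.
            d_Nov sG om sM l r n c \<in> Nov_cochains sG sM (n + 1))
       \<and> (\<forall>n\<ge>1. \<forall>a. \<forall>c\<in>Nov_cochains sG sM n. \<forall>c'\<in>Nov_cochains sG sM n.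
            d_Nov sG om sM l r n (tscale sM a c + c')
              = tscale sM a (d_Nov sG om sM l r n c) + d_Nov sG om sM l r n c')
       \<and> (\<forall>n\<ge>1. \<forall>c\<in>Nov_cochains sG sM n.
            d_Nov sG om sM l r (n + 1) (d_Nov sG om sM l r n c) = 0)"
proof -
  interpret novikov_representation sG om sM l r by fact
  let ?inv = "\<lambda>n. inv_into (CE sG sM n) (Gamma n)"
  have ex: "\<exists>m. n = Suc m" if "n \<ge> 1" for n :: nat using that by (cases n) auto
  show ?thesis
  proof (intro conjI allI impI ballI)
    fix n c assume "n \<ge> (1 :: nat)" and c: "c \<in> Nov_cochains sG sM n"
    then obtain m where n: "n = Suc m" using ex by blast
    have dF: "d_CE sM om l r n (?inv n c) \<in> CE sG sM (Suc n)"
      using d_CE_in_CE Gamma_inverse(1)[OF c] unfolding n by blast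
    then show "d_Nov sG om sM l r n c \<in> Nov_cochains sG sM (n + 1)"
      by (simp add: d_Nov_def Gamma_in_Nov_cochains)
    \<comment> \<open>The differential stays in \<open>CE\<close>, where \<open>Gamma\<close> is
      injective, so \<open>Gamma\<close> and its inverse cancel between the two
      differentials.\<close>
    have "?inv (Suc n) (Gamma (Suc n) (d_CE sM om l r n (?inv n c))) = d_CE sM om l r n (?inv n c)"
      using Gamma_inj dF by (rule inv_into_f_f)
    then have "d_Nov sG om sM l r (n + 1) (d_Nov sG om sM l r n c)
        = Gamma (n + 1 + 1) (d_CE sM om l r (Suc n) (d_CE sM om l r n (?inv n c)))"
      by (simp add: d_Nov_def)
    also have "d_CE sM om l r (Suc n) (d_CE sM om l r n (?inv n c)) = 0"
      using d_CE_d_CE Gamma_inverse(1)[OF c] unfolding n by blast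
    also have "Gamma (n + 1 + 1) 0 = (0 :: nat list \<Rightarrow> 'g list \<Rightarrow> 'm)"
      by (simp add: Gamma_def fun_eq_iff)
    finally show "d_Nov sG om sM l r (n + 1) (d_Nov sG om sM l r n c) = 0" .
  next
    fix n a c c' assume "n \<ge> (1 :: nat)" and c: "c \<in> Nov_cochains sG sM n" and c': "c' \<in> Nov_cochains sG sM n"
    then obtain m where n: "n = Suc m" using ex by blast
    note FG = Gamma_inverse(1)[OF c] Gamma_inverse(1)[OF c']
    \<comment> \<open>The inverse of \<open>Gamma\<close> inherits linearity, because
      \<open>CE\<close> is closed under linear combinations and \<open>Gamma\<close> is injective on
      it.\<close>
    have "?inv n (Gamma n (tscale sM a (?inv n c) + ?inv n c')) = tscale sM a (?inv n c) + ?inv n c'"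
      using Gamma_inj CE_linear[OF FG] by (rule inv_into_f_f)
    then have "?inv n (tscale sM a c + c') = tscale sM a (?inv n c) + ?inv n c'"
      by (simp add: Gamma_linear Gamma_inverse(2)[OF c] Gamma_inverse(2)[OF c'])
    then show "d_Nov sG om sM l r n (tscale sM a c + c')
        = tscale sM a (d_Nov sG om sM l r n c) + d_Nov sG om sM l r n c'"
      using d_CE_linear FG unfolding n by (simp add: d_Nov_def Gamma_linear)
  qed
qed

end
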